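(* Let $\{\xi_k\}_{k\in\mathbf{Z}}$ be i.i.d. centered real random variables with $\mathbf{E}(\xi_0^2)=\sigma^2>0$, let $\{c_{ni}:1\le i\le k_n\}$ be a triangular array of real numbers, and set $S_n=\sum_{i=1}^{k_n}c_{ni}\xi_i$ and $s_n^2=\sigma^2\sum_{i=1}^{k_n}c_{ni}^2>0$. Let $(a_n)$ be a sequence of positive numbers with $a_n\to0$. Assume that $$\frac{1}{\sqrt{a_n}\,s_n}\max_{1\le j\le k_n}|c_{nj}|\to0\quad\text{as } n\to\infty,$$ and that for some positive constant $K$, $$\mathbf{E}(|\xi_0|^m)\le m!\,K^m\quad\text{for all } m\in\mathbf{N}.$$ Then $\{W_n\}$ satisfies the functional moderate deviation principle in $D[0,1]$ (uniform topology) with speed $a_n$ and good rate function $$I(z)=\tfrac12\int_0^1 (z'(u))^2\,du\ \text{ if } z(0)=0 \text{ and } z \text{ is absolutely continuous},\qquad I(z)=\infty\ \text{ otherwise.}$$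
   Context: $(k_n)$ is a sequence of positive integers; $\log 0=-\infty$. Notation: $X_{ni}=c_{ni}\xi_i$, $S_{n,0}=0$, $S_{nl}=\sum_{j=1}^{l}X_{nj}$, $s_{ni}^2=\sigma^2\sum_{j=1}^{i}c_{nj}^2$ (with $s_{n,0}^2=0$). The process $W_n$ is the random element of $D[0,1]$ (càdlàg functions on $[0,1]$) given by $W_n(t)=S_{n,i-1}/s_n$ for $t\in[s_{n,i-1}^2/s_n^2,\ s_{ni}^2/s_n^2)$, $1\le i\le k_n$, and $W_n(1)=S_n/s_n$. Functional moderate deviation principle: a family $\{W_n\}$ of random elements of $D[0,1]$, endowed with the uniform topology, satisfies the functional MDP with speed $a_n\to0$ and good rate function $I$ if the level sets $\{x: I(x)\le\alpha\}$ are compact for all $\alpha<\infty$ and for every Borel set $\Gamma\subset D[0,1]$, with interior $\Gamma^0$ and closure $\bar\Gamma$, $$-\inf_{z\in\Gamma^0}I(z)\le\liminf_n a_n\log\mathbf{P}(\sqrt{a_n}\,W_n\in\Gamma)\le\limsup_n a_n\log\mathbf{P}(\sqrt{a_n}\,W_n\in\Gamma)\le-\inf_{z\in\bar\Gamma}I(z).$$ *)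

theory Defs
  imports "HOL-Probability.Probability"
begin

text \<open>Functions on $[0,1]$ are represented as functions on the reals that are
  \<^const>\<open>extensional\<close> on $[0,1]$, so that equality is equality on $[0,1]$.\<close>

definition cadlag01 :: "(real \<Rightarrow> real) set" where
  "cadlag01 = {x \<in> extensional {0..1}.
     (\<forall>t\<in>{0..<1}. (x \<longlongrightarrow> x t) (at_right t)) \<and>
     (\<forall>t\<in>{0<..1}. \<exists>l. (x \<longlongrightarrow> l) (at_left t))}"

definition D01_metric :: "(real \<Rightarrow> real) metric" where
  "D01_metric = submetric (metric (Met_TC.fspace {0..1}, Met_TC.fdist {0..1})) cadlag01"

definition D01_topology :: "(real \<Rightarrow> real) topology" where
  "D01_topology = mtopology_of D01_metric"

definition D01_borel :: "(real \<Rightarrow> real) measure" where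
  "D01_borel = sigma cadlag01 {U. openin D01_topology U}"

lemma cadlag01_bounded:
  assumes x: "x \<in> cadlag01"
  shows "\<exists>B. \<forall>t\<in>{0..1}. \<bar>x t\<bar> \<le> B"
proof -
  have loc: "\<exists>U B. open U \<and> t \<in> U \<and> (\<forall>u\<in>U \<inter> {0..1}. \<bar>x u\<bar> \<le> B)" if t: "t \<in> {0..1}" for t
  proof -
    have ev: "\<exists>B. \<forall>\<^sub>F u in F. \<bar>x u\<bar> < B" if "(x \<longlongrightarrow> l) F" for l F
    proof -
      have "((\<lambda>u. \<bar>x u\<bar>) \<longlongrightarrow> \<bar>l\<bar>) F"
        using that by (rule tendsto_rabs)
      then have "\<forall>\<^sub>F u in F. \<bar>x u\<bar> < \<bar>l\<bar> + 1"
        by (rule order_tendstoD(2)) simp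
      then show ?thesis by blast
    qed
    have "\<exists>B1. \<forall>\<^sub>F u in at_right t. u \<in> {0..1} \<longrightarrow> \<bar>x u\<bar> < B1"
    proof (cases "t < 1")
      case True
      then obtain B where "\<forall>\<^sub>F u in at_right t. \<bar>x u\<bar> < B"
        using x t ev[of "x t" "at_right t"] by (auto simp: cadlag01_def)
      then show ?thesis by (intro exI[of _ B]) (auto elim: eventually_mono)
    next
      case False
      then show ?thesis using t by (intro exI[of _ 0]) (auto simp: eventually_at_filter)
    qed
    then obtain B1 where B1: "\<forall>\<^sub>F u in at_right t. u \<in> {0..1} \<longrightarrow> \<bar>x u\<bar> < B1" ..
    have "\<exists>B2. \<forall>\<^sub>F u in at_left t. u \<in> {0..1} \<longrightarrow> \<bar>x u\<bar> < B2"
    proof (cases "0 < t")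
      case True
      then obtain l where "(x \<longlongrightarrow> l) (at_left t)"
        using x t unfolding cadlag01_def by fastforce
      then obtain B where "\<forall>\<^sub>F u in at_left t. \<bar>x u\<bar> < B"
        using ev by blast
      then show ?thesis by (intro exI[of _ B]) (auto elim: eventually_mono)
    next
      case False
      then show ?thesis using t by (intro exI[of _ 0]) (auto simp: eventually_at_filter)
    qed
    then obtain B2 where B2: "\<forall>\<^sub>F u in at_left t. u \<in> {0..1} \<longrightarrow> \<bar>x u\<bar> < B2" ..
    define B where "B = max \<bar>x t\<bar> (max B1 B2)"
    have "\<forall>\<^sub>F u in at t. u \<in> {0..1} \<longrightarrow> \<bar>x u\<bar> \<le> B"
      unfolding eventually_at_split using B1 B2
      by (auto simp: B_def elim!: eventually_mono)
    then obtain U where "open U" "t \<in> U" "\<forall>u\<in>U. u \<noteq> t \<longrightarrow> u \<in> {0..1} \<longrightarrow> \<bar>x u\<bar> \<le> B"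
      unfolding eventually_at_topological by blast
    moreover have "\<bar>x t\<bar> \<le> B" by (simp add: B_def)
    ultimately show ?thesis by (intro exI[of _ U] exI[of _ B]) auto
  qed
  then obtain U B where UB: "\<And>t. t \<in> {0..1} \<Longrightarrow>
      open (U t) \<and> t \<in> U t \<and> (\<forall>u\<in>U t \<inter> {0..1}. \<bar>x u\<bar> \<le> B t)"
    by metis
  obtain C where C: "C \<subseteq> {0..1::real}" "finite C" "{0..1} \<subseteq> (\<Union>t\<in>C. U t)"
    by (rule compactE_image[of "{0..1::real}" "{0..1}" U]) (use UB in auto)
  have "\<bar>x t\<bar> \<le> (\<Sum>c\<in>C. \<bar>B c\<bar>)" if t: "t \<in> {0..1}" for t
  proof -
    obtain c where c: "c \<in> C" "t \<in> U c" using C t by blast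
    then have "\<bar>x t\<bar> \<le> \<bar>B c\<bar>" using UB[of c] C t by force
    also have "\<dots> \<le> (\<Sum>c\<in>C. \<bar>B c\<bar>)"
      using c C by (intro member_le_sum) auto
    finally show ?thesis .
  qed
  then show ?thesis by blast
qed

lemma cadlag01_subset_fspace: "cadlag01 \<subseteq> Met_TC.fspace {0..1}"
proof
  fix x assume x: "x \<in> cadlag01"
  then obtain B where B: "\<forall>t\<in>{0..1}. \<bar>x t\<bar> \<le> B"
    using cadlag01_bounded by blast
  have "Met_TC.mbounded (x ` {0..1})"
    unfolding Met_TC.mbounded_def using B
    by (intro exI[of _ 0] exI[of _ B]) (auto simp: Met_TC.mcball_def)
  then show "x \<in> Met_TC.fspace {0..1}"
    using x by (simp add: Met_TC.fspace_def cadlag01_def)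
qed

lemma mspace_D01_metric [simp]: "mspace D01_metric = cadlag01"
  using cadlag01_subset_fspace
  by (auto simp: D01_metric_def Metric_space.mspace_metric[OF Met_TC.Metric_space_funspace])

lemma mdist_D01_metric:
  assumes "x \<in> cadlag01" "y \<in> cadlag01"
  shows "mdist D01_metric x y = (SUP t\<in>{0..1}. \<bar>x t - y t\<bar>)"
proof -
  have "mdist D01_metric x y = Met_TC.fdist {0..1} x y"
    by (simp add: D01_metric_def Metric_space.mdist_metric[OF Met_TC.Metric_space_funspace])
  then show ?thesis
    using assms cadlag01_subset_fspace by (auto simp: Met_TC.fdist_def dist_real_def)
qed

lemma topspace_D01_topology [simp]: "topspace D01_topology = cadlag01"
  by (simp add: D01_topology_def)

lemma sets_D01_borel: "sets D01_borel = sigma_sets cadlag01 {U. openin D01_topology U}"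
  unfolding D01_borel_def using openin_subset[of D01_topology]
  by (intro sets_measure_of) auto

text \<open>The library's real logarithm satisfies \<open>ln 0 = 0\<close>, hence the case distinction.\<close>

definition log_ext :: "real \<Rightarrow> ereal" where
  "log_ext p = (if p = 0 then -\<infinity> else ereal (ln p))"

text \<open>The first conjunct says that each \<open>W n\<close> is a random element of $D[0,1]$, measurable for the
  Borel sets of the (nonseparable) uniform topology; it guarantees that the probabilities below are
  those of genuine events.\<close>

definition functional_mdp ::
  "'w measure \<Rightarrow> (nat \<Rightarrow> 'w \<Rightarrow> real \<Rightarrow> real) \<Rightarrow> (nat \<Rightarrow> real) \<Rightarrow> ((real \<Rightarrow> real) \<Rightarrow> ereal) \<Rightarrow> bool"
where
  "functional_mdp M W a I \<longleftrightarrow>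
     (\<forall>n. W n \<in> M \<rightarrow>\<^sub>M D01_borel) \<and>
     (\<forall>\<alpha><\<infinity>. compactin D01_topology {x \<in> cadlag01. I x \<le> \<alpha>}) \<and>
     (\<forall>\<Gamma>\<in>sets D01_borel.
        let L = (\<lambda>n. ereal (a n) * log_ext
                  (measure M {\<omega> \<in> space M. (\<lambda>t\<in>{0..1}. sqrt (a n) * W n \<omega> t) \<in> \<Gamma>}))
        in - (INF z\<in>D01_topology interior_of \<Gamma>. I z) \<le> liminf L \<and>
           liminf L \<le> limsup L \<and>
           limsup L \<le> - (INF z\<in>D01_topology closure_of \<Gamma>. I z))"

definition abs_cont_on_Icc :: "real \<Rightarrow> real \<Rightarrow> (real \<Rightarrow> real) \<Rightarrow> bool" where
  "abs_cont_on_Icc a b z \<longleftrightarrow>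
     (\<forall>\<epsilon>>0. \<exists>\<delta>>0. \<forall>(m::nat) (l::nat \<Rightarrow> real) (r::nat \<Rightarrow> real).
        (\<forall>i<m. a \<le> l i \<and> l i \<le> r i \<and> r i \<le> b) \<longrightarrow>
        disjoint_family_on (\<lambda>i. {l i<..<r i}) {..<m} \<longrightarrow>
        (\<Sum>i<m. r i - l i) < \<delta> \<longrightarrow> (\<Sum>i<m. \<bar>z (r i) - z (l i)\<bar>) < \<epsilon>)"

text \<open>An absolutely continuous \<open>z\<close> is differentiable almost everywhere on $[0,1]$, so the
  unspecified values of \<^const>\<open>deriv\<close> elsewhere do not matter. The nonnegative integral
  may be infinite.\<close>

definition rate_fn :: "(real \<Rightarrow> real) \<Rightarrow> ereal" where
  "rate_fn z = (if z 0 = 0 \<and> abs_cont_on_Icc 0 1 z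
     then ereal (1 / 2) * enn2ereal (\<integral>\<^sup>+u\<in>{0..1}. ennreal ((deriv z u)\<^sup>2) \<partial>lebesgue)
     else \<infinity>)"

definition partial_sum ::
  "(nat \<Rightarrow> nat \<Rightarrow> real) \<Rightarrow> (int \<Rightarrow> 'w \<Rightarrow> real) \<Rightarrow> nat \<Rightarrow> nat \<Rightarrow> 'w \<Rightarrow> real" where
  "partial_sum c \<xi> n l \<omega> = (\<Sum>j=1..l. c n j * \<xi> (int j) \<omega>)"

definition s_sq :: "real \<Rightarrow> (nat \<Rightarrow> nat \<Rightarrow> real) \<Rightarrow> nat \<Rightarrow> nat \<Rightarrow> real" where
  "s_sq \<sigma> c n i = \<sigma>\<^sup>2 * (\<Sum>j=1..i. (c n j)\<^sup>2)"

text \<open>The time intervals are pairwise disjoint, so at most one summand is nonzero.\<close>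

definition W_proc ::
  "(nat \<Rightarrow> nat) \<Rightarrow> (nat \<Rightarrow> nat \<Rightarrow> real) \<Rightarrow> real \<Rightarrow> (int \<Rightarrow> 'w \<Rightarrow> real) \<Rightarrow> nat \<Rightarrow> 'w \<Rightarrow> real \<Rightarrow> real" where
  "W_proc k c \<sigma> \<xi> n \<omega> = (\<lambda>t\<in>{0..1}.
     let s2 = s_sq \<sigma> c n (k n) in
     (\<Sum>i=1..k n. partial_sum c \<xi> n (i - 1) \<omega> / sqrt s2 *
        indicator {s_sq \<sigma> c n (i - 1) / s2 ..< s_sq \<sigma> c n i / s2} t) +
     partial_sum c \<xi> n (k n) \<omega> / sqrt s2 * indicator {1} t)"

lemma s_sq_mono: "i \<le> j \<Longrightarrow> s_sq \<sigma> c n i \<le> s_sq \<sigma> c n j"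
  unfolding s_sq_def by (intro mult_left_mono sum_mono2) auto

lemma W_proc_eq:
  assumes pos: "s_sq \<sigma> c n (k n) > 0" and i: "i \<in> {1..k n}"
    and t: "s_sq \<sigma> c n (i - 1) / s_sq \<sigma> c n (k n) \<le> t" "t < s_sq \<sigma> c n i / s_sq \<sigma> c n (k n)"
  shows "W_proc k c \<sigma> \<xi> n \<omega> t = partial_sum c \<xi> n (i - 1) \<omega> / sqrt (s_sq \<sigma> c n (k n))"
proof -
  define T where "T = (\<lambda>j. s_sq \<sigma> c n j / s_sq \<sigma> c n (k n))"
  have mono: "T j \<le> T j'" if "j \<le> j'" for j j'
    unfolding T_def using that pos by (intro divide_right_mono s_sq_mono) auto
  have "T 0 = 0" "T (k n) = 1" using pos by (auto simp: T_def s_sq_def)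
  with mono[of 0 "i - 1"] mono[of i "k n"] i t have t01: "0 \<le> t" "t < 1"
    by (auto simp: T_def)
  have ind: "indicator {T (j - 1) ..< T j} t = (if j = i then 1 else 0 :: real)"
    if "j \<in> {1..k n}" for j
  proof (cases j i rule: linorder_cases)
    case less
    then have "T j \<le> T (i - 1)" by (intro mono) auto
    then show ?thesis using less t by (auto simp: T_def indicator_def)
  next
    case greater
    then have "T i \<le> T (j - 1)" by (intro mono) auto
    then show ?thesis using greater t by (auto simp: T_def indicator_def)
  qed (use t in \<open>auto simp: T_def\<close>)
  have "(\<Sum>j=1..k n. partial_sum c \<xi> n (j - 1) \<omega> / sqrt (s_sq \<sigma> c n (k n)) *
          indicator {T (j - 1) ..< T j} t) =
        (\<Sum>j=1..k n. if j = i
           then partial_sum c \<xi> n (i - 1) \<omega> / sqrt (s_sq \<sigma> c n (k n)) else 0)"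
    using ind by (intro sum.cong) auto
  then show ?thesis
    using t01 i by (simp add: W_proc_def Let_def T_def)
qed

lemma W_proc_1:
  assumes pos: "s_sq \<sigma> c n (k n) > 0"
  shows "W_proc k c \<sigma> \<xi> n \<omega> 1 = partial_sum c \<xi> n (k n) \<omega> / sqrt (s_sq \<sigma> c n (k n))"
proof -
  have "s_sq \<sigma> c n i / s_sq \<sigma> c n (k n) \<le> 1" if "i \<in> {1..k n}" for i
    using pos s_sq_mono[of i "k n" \<sigma> c n] that by auto
  then show ?thesis
    by (fastforce simp: W_proc_def Let_def indicator_def not_less[symmetric] intro!: sum.neutral)
qed

end

theory Submission
  imports Defs "HOL-Complex_Analysis.Great_Picard"
begin

text \<open>
  The rate function has a variational form free of derivatives: $2I(z)$ is the supremum of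
  $\sum_i (z(r_i)-z(l_i))^2/(r_i-l_i)$ over finite families of disjoint intervals. The link is that an
  absolutely continuous function is differentiable almost everywhere and is the integral of its
  derivative. Lower semicontinuity and compactness of the level sets are immediate from this form.

  Upper bound: a path of $\sqrt{a_n}W_n$ is close to its linear interpolation on a grid of $m$ blocks,
  except with superexponentially small probability (Chernoff and Etemadi). The event that the energy of the
  interpolation exceeds $\beta$ lies, up to a small error, in finitely many half-spaces for the $m$ block
  increments, and each half-space is controlled by an exponential Chebyshev bound, in which the moment
  condition makes $\xi_0$ look Gaussian because all tilting parameters tend to $0$.

  Lower bound: replace $z$ by a Lipschitz path $y$ of no larger energy and tilt the law of
  each $\xi_j$ so that the mean of $\sqrt{a_n}W_n$ becomes $y$ along the time grid. Under the
  tilted law the path stays close to $y$ with probability at least $1/2$, and the density of the tilt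
  costs $\exp(-I(y)/a_n)$ up to lower order terms.
\<close>

section \<open>Absolutely continuous functions\<close>

text \<open>The uniform topology on D[0,1] is not separable: its Borel sets are not generated by the
  coordinates, and a finite dimensional principle does not carry over by itself. Two facts replace
  that route. Each path depends continuously on finitely many variables, which gives measurability;
  and compactness of the level sets turns the strict inequality I > \<beta> on the closure of
  \<Gamma> into the same inequality on a uniform neighbourhood of \<Gamma>, so that a path may be
  exchanged for its interpolation. Half-spaces enter because large energy means lying outside a ball
  in the space of block increments. This region is not convex, while exponential Chebyshev bounds
  linear functionals; rounding the increments to a fixed lattice selects finitely many tangent
  half-spaces. Their number does not depend on n, so it is lost once the logarithm is multiplied by
  a_n. The Lipschitz replacement bounds the slopes by some R, so that the tilting parameters are at
  most \<open>R * eps n\<close>. Etemadi's inequality reduces running maxima to tails at fixed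
  indices, estimated by Chernoff for the upper bound and by Chebyshev under the tilted law.\<close>

definition incr :: "(real \<Rightarrow> real) \<Rightarrow> real set \<Rightarrow> real" where
  "incr f K = (if K = {} then 0 else f (Sup K) - f (Inf K))"

lemma incr_Icc: "a \<le> b \<Longrightarrow> incr f {a..b} = f b - f a"
  by (simp add: incr_def)

text \<open>Increments add up when an interval is cut at a point, so \<open>incr f\<close> is
  operative; the value 0 on the empty set covers cuts outside the interval.\<close>

lemma incr_division:
  assumes "D division_of {a..b}"
  shows "sum (incr f) D = incr f {a..b}"
proof -
  interpret operative_real plus 0 "incr f"
    rewrites "comm_monoid_set.F (+) 0 = sum"
  proof -
    show "operative_real plus 0 (incr f)" by standard (auto simp: incr_def)
    show "comm_monoid_set.F (+) 0 = (sum :: ('z \<Rightarrow> real) \<Rightarrow> 'z set \<Rightarrow> real)" by (simp add: sum_def)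
  qed
  show ?thesis using division[of D a b] assms by simp
qed

lemma incr_id_eq_content: "D division_of S \<Longrightarrow> K \<in> D \<Longrightarrow> incr (\<lambda>x. x) K = measure lborel K"
  for D :: "real set set"
proof -
  assume "D division_of S" "K \<in> D"
  then obtain l r where "K = {l..r}" "l \<le> r"
    using division_ofD(3,4)[of D S K] by (metis atLeastatMost_empty_iff box_real(2))
  then show ?thesis by (simp add: incr_Icc)
qed

text \<open>Covering arguments and tagged divisions deliver finite sets of intervals, hence this
  version of absolute continuity for sets in place of indexed families. Intervals of a division have
  disjoint interiors, which is exactly what the definition asks of the open intervals.\<close>

lemma abs_cont_divisionD:
  assumes "abs_cont_on_Icc a b z" "e > 0"
  obtains d where "d > 0" "\<And>D S. D division_of S \<Longrightarrow> S \<subseteq> {a..b} \<Longrightarrow> (\<Sum>K\<in>D. measure lborel K) < d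
      \<Longrightarrow> (\<Sum>K\<in>D. \<bar>incr z K\<bar>) < e"
proof -
  obtain d where d: "d > 0" "\<And>(m::nat) (l::nat \<Rightarrow> real) (r::nat \<Rightarrow> real).
        (\<forall>i<m. a \<le> l i \<and> l i \<le> r i \<and> r i \<le> b) \<Longrightarrow>
        disjoint_family_on (\<lambda>i. {l i<..<r i}) {..<m} \<Longrightarrow>
        (\<Sum>i<m. r i - l i) < d \<Longrightarrow> (\<Sum>i<m. \<bar>z (r i) - z (l i)\<bar>) < e"
    using assms unfolding abs_cont_on_Icc_def by meson
  show ?thesis
  proof (rule that[OF d(1)])
    fix D S assume D: "D division_of S" "S \<subseteq> {a..b}" "(\<Sum>K\<in>D. measure lborel K) < d"
    obtain h where h: "bij_betw h {..<card D} D"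
      using ex_bij_betw_nat_finite[of D] D(1) by (auto simp: atLeast0LessThan division_of_finite)
    have hD: "h i \<in> D" if "i < card D" for i using h that by (auto simp: bij_betw_def)
    have "\<exists>l r. l \<le> r \<and> h i = {l..r}" if "i < card D" for i
      using division_ofD(3,4)[OF D(1) hD[OF that]] by (metis atLeastatMost_empty_iff box_real(2))
    then obtain l r where lr: "\<And>i. i < card D \<Longrightarrow> l i \<le> r i \<and> h i = {l i..r i}" by metis
    have sub: "h i \<subseteq> {a..b}" if "i < card D" for i
      using division_ofD(2)[OF D(1) hD[OF that]] D(2) by blast
    have "(\<Sum>i<card D. \<bar>z (r i) - z (l i)\<bar>) < e"
    proof (rule d(2))
      show "\<forall>i<card D. a \<le> l i \<and> l i \<le> r i \<and> r i \<le> b"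
        using lr sub by fastforce
      show "disjoint_family_on (\<lambda>i. {l i<..<r i}) {..<card D}"
        unfolding disjoint_family_on_def
      proof (intro ballI impI)
        fix i j assume ij: "i \<in> {..<card D}" "j \<in> {..<card D}" "i \<noteq> j"
        then have "h i \<noteq> h j" using h by (auto simp: bij_betw_def inj_on_def)
        then have "interior (h i) \<inter> interior (h j) = {}"
          using division_ofD(5)[OF D(1) hD hD] ij by auto
        then show "{l i<..<r i} \<inter> {l j<..<r j} = {}" using lr ij by (simp)
      qed
      have "(\<Sum>i<card D. r i - l i) = (\<Sum>i<card D. measure lborel (h i))"
        by (rule sum.cong) (use lr in auto)
      also have "\<dots> = (\<Sum>K\<in>D. measure lborel K)" by (rule sum.reindex_bij_betw[OF h])
      finally show "(\<Sum>i<card D. r i - l i) < d" using D(3) by simp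
    qed
    also have "(\<Sum>i<card D. \<bar>z (r i) - z (l i)\<bar>) = (\<Sum>i<card D. \<bar>incr z (h i)\<bar>)"
      by (rule sum.cong) (use lr in \<open>auto simp: incr_Icc\<close>)
    also have "\<dots> = (\<Sum>K\<in>D. \<bar>incr z K\<bar>)" by (rule sum.reindex_bij_betw[OF h])
    finally show "(\<Sum>K\<in>D. \<bar>incr z K\<bar>) < e" .
  qed
qed

lemma abs_cont_imp_continuous_on:
  assumes "abs_cont_on_Icc a b z"
  shows "continuous_on {a..b} z"
  unfolding continuous_on_iff
proof (intro ballI allI impI)
  fix x e :: real assume x: "x \<in> {a..b}" "e > 0"
  obtain d where d: "d > 0" "\<And>D S. D division_of S \<Longrightarrow> S \<subseteq> {a..b} \<Longrightarrow> (\<Sum>K\<in>D. measure lborel K) < d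
      \<Longrightarrow> (\<Sum>K\<in>D. \<bar>incr z K\<bar>) < e" using abs_cont_divisionD[OF assms x(2)] by blast
  have *: "\<bar>z v - z u\<bar> < e" if "a \<le> u" "u \<le> v" "v \<le> b" "v - u < d" for u v
    using d(2)[of "{cbox u v}" "cbox u v"] that division_of_self[of u v] by (simp add: incr_Icc)
  show "\<exists>d>0. \<forall>x'\<in>{a..b}. dist x' x < d \<longrightarrow> dist (z x') (z x) < e"
  proof (intro exI[of _ d] conjI ballI impI)
    fix y assume "y \<in> {a..b}" "dist y x < d"
    then show "dist (z y) (z x) < e" using *[of x y] *[of y x] x
      by (cases "x \<le> y") (auto simp: dist_real_def abs_minus_commute)
  qed (use d in auto)
qed

section \<open>Finite Vitali coverings and null sets of bad slopes\<close>

text \<open>Each interval of \<open>D\<close> is divided so that the members of \<open>E\<close>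
  inside it become pieces, and \<open>G\<close> collects the other pieces. The identity holds for
  all \<open>f\<close> with the same \<open>G\<close>: for the identity function it computes the
  total length of the gaps, for \<open>z\<close> it compares increments.\<close>

lemma division_gaps:
  fixes D E :: "real set set"
  assumes D: "finite D" "pairwise disjnt D" "\<And>I. I \<in> D \<Longrightarrow> \<exists>a b. a \<le> b \<and> I = {a..b}"
    and E: "E division_of \<Union>E" "\<And>J. J \<in> E \<Longrightarrow> \<exists>I\<in>D. J \<subseteq> I"
  obtains G where "G division_of \<Union>G" "\<Union>G \<subseteq> \<Union>D"
    "\<And>f. sum (incr f) D = sum (incr f) E + sum (incr f) G"
proof -
  define EI where "EI I = {J \<in> E. J \<subseteq> I}" for I
  have "\<exists>q. EI I \<subseteq> q \<and> q division_of I" if I: "I \<in> D" for I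
  proof -
    obtain a b where ab: "I = cbox a b" using D(3)[OF I] by auto
    have "EI I division_of \<Union>(EI I)"
      by (rule division_of_subset[OF E(1)]) (auto simp: EI_def)
    moreover have "\<Union>(EI I) \<subseteq> cbox a b" using ab by (auto simp: EI_def)
    ultimately show ?thesis using partial_division_extend_interval[of "EI I" a b] ab by metis
  qed
  then obtain q where q: "\<And>I. I \<in> D \<Longrightarrow> EI I \<subseteq> q I \<and> q I division_of I" by metis
  have qsub: "K \<subseteq> I" "K \<noteq> {}" if "I \<in> D" "K \<in> q I" for I K
    using division_ofD(2,3)[of "q I" I K] q[OF that(1)] that by auto
  have disj: "q I \<inter> q I' = {}" if "I \<in> D" "I' \<in> D" "I \<noteq> I'" for I I'
  proof -
    have "I \<inter> I' = {}" using D(2) that by (auto simp: pairwise_def disjnt_def)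
    then show ?thesis using qsub that by blast
  qed
  have fin: "finite (q I)" if "I \<in> D" for I using q[OF that] by (auto simp: division_of_finite)
  have Eun: "E = (\<Union>I\<in>D. EI I)" using E(2) by (auto simp: EI_def)
  define G where "G = (\<Union>I\<in>D. q I - EI I)"
  have "G division_of \<Union>G"
  proof (rule division_ofI)
    show "finite G" unfolding G_def using D(1) fin by auto
    show "\<exists>a b. K = cbox a b" if "K \<in> G" for K
      using that q division_ofD(4) unfolding G_def by blast
    show "K \<noteq> {}" if "K \<in> G" for K using that qsub unfolding G_def by blast
    show "interior K1 \<inter> interior K2 = {}" if K: "K1 \<in> G" "K2 \<in> G" "K1 \<noteq> K2" for K1 K2
    proof -
      obtain I1 I2 where I: "I1 \<in> D" "I2 \<in> D" "K1 \<in> q I1" "K2 \<in> q I2"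
        using K unfolding G_def by blast
      show ?thesis
      proof (cases "I1 = I2")
        case True
        then show ?thesis using I K(3) q[of I1] division_ofD(5)[of "q I1" I1 K1 K2] by auto
      next
        case False
        then have "I1 \<inter> I2 = {}" using D(2) I by (auto simp: pairwise_def disjnt_def)
        then show ?thesis using qsub[OF I(1,3)] qsub[OF I(2,4)] interior_subset by blast
      qed
    qed
  qed auto
  moreover have "\<Union>G \<subseteq> \<Union>D" unfolding G_def using qsub by blast
  moreover have "sum (incr f) D = sum (incr f) E + sum (incr f) G" for f
  proof -
    have "sum (incr f) D = (\<Sum>I\<in>D. sum (incr f) (q I))"
      by (intro sum.cong refl) (metis D(3) q incr_division)
    also have "\<dots> = (\<Sum>I\<in>D. sum (incr f) (EI I) + sum (incr f) (q I - EI I))"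
      by (intro sum.cong refl) (metis add.commute q fin sum.subset_diff)
    also have "\<dots> = (\<Sum>I\<in>D. sum (incr f) (EI I)) + (\<Sum>I\<in>D. sum (incr f) (q I - EI I))"
      by (rule sum.distrib)
    also have "(\<Sum>I\<in>D. sum (incr f) (EI I)) = sum (incr f) E"
      unfolding Eun
    proof (rule sum.UNION_disjoint[symmetric])
      show "\<forall>i\<in>D. \<forall>j\<in>D. i \<noteq> j \<longrightarrow> EI i \<inter> EI j = {}"
        using disj q by blast
      show "\<forall>i\<in>D. finite (EI i)" by (metis fin q finite_subset)
    qed (rule D(1))
    also have "(\<Sum>I\<in>D. sum (incr f) (q I - EI I)) = sum (incr f) G"
      unfolding G_def
    proof (rule sum.UNION_disjoint[symmetric])
      show "\<forall>i\<in>D. \<forall>j\<in>D. i \<noteq> j \<longrightarrow> (q i - EI i) \<inter> (q j - EI j) = {}"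
        using disj by blast
      show "\<forall>i\<in>D. finite (q i - EI i)" using fin by blast
    qed (rule D(1))
    finally show ?thesis .
  qed
  ultimately show ?thesis using that by blast
qed

text \<open>Vitali's theorem covers \<open>E\<close> up to a null set by countably many disjoint
  intervals, and continuity of measure leaves a finite subfamily at the cost of \<open>e\<close>.
  All intervals lie in \<open>U\<close>, whose finite measure bounds that of every finite
  union.\<close>

lemma Vitali_finite_intervals:
  fixes P :: "real \<Rightarrow> real \<Rightarrow> bool"
  assumes E: "E \<in> lmeasurable" "e > 0"
    and cov: "\<And>x d. x \<in> E \<Longrightarrow> d > 0 \<Longrightarrow> \<exists>l r. l < r \<and> l \<le> x \<and> x \<le> r \<and> r - l < d \<and> P l r \<and> {l..r} \<subseteq> U"
    and U: "U \<in> lmeasurable"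
  obtains D where "finite D" "pairwise disjnt D" "\<And>I. I \<in> D \<Longrightarrow> \<exists>l r. l < r \<and> I = {l..r} \<and> P l r \<and> {l..r} \<subseteq> U"
    "measure lebesgue (\<Union>D) > measure lebesgue E - e"
proof -
  define K where "K = {(l, r). l < r \<and> P l r \<and> {l..r} \<subseteq> U}"
  \<comment> \<open>The covering theorem speaks of closed balls, so an interval is encoded by its
    midpoint and half its length.\<close>
  have cb: "cball ((fst i + snd i) / 2) ((snd i - fst i) / 2) = {fst i..snd i}" for i :: "real \<times> real"
    by (auto simp: cball_eq_atLeastAtMost field_simps)
  obtain C where C: "countable C" "C \<subseteq> K"
     "pairwise (\<lambda>i j. disjnt {fst i..snd i} {fst j..snd j}) C"
     "negligible (E - (\<Union>i \<in> C. {fst i..snd i}))"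
  proof (rule Vitali_covering_theorem_cballs[of K "\<lambda>i. (snd i - fst i) / 2" E "\<lambda>i. (fst i + snd i) / 2", unfolded cb])
    show "0 < (snd i - fst i) / 2" if "i \<in> K" for i using that by (auto simp: K_def)
    show "\<exists>i. i \<in> K \<and> x \<in> {fst i..snd i} \<and> (snd i - fst i) / 2 < d" if xd: "x \<in> E" "0 < d" for x d
    proof -
      obtain l r where "l < r \<and> l \<le> x \<and> x \<le> r \<and> r - l < d \<and> P l r \<and> {l..r} \<subseteq> U"
        using cov[OF xd] by blast
      then show ?thesis by (intro exI[of _ "(l, r)"]) (auto simp: K_def)
    qed
  qed blast
  define \<D> where "\<D> = (\<lambda>i. {fst i..snd i}) ` C"
  have U': "I \<subseteq> U" if "I \<in> \<D>" for I using that C(2) by (fastforce simp: \<D>_def K_def)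
  have cD: "countable \<D>" unfolding \<D>_def using C(1) by simp
  have Un: "\<Union>\<D> \<in> lmeasurable"
    by (rule fmeasurableI2[OF U]) (use U' cD in \<open>auto simp: \<D>_def intro!: sets.countable_Union\<close>)
  obtain D where D: "D \<subseteq> \<D>" "finite D" "measure lebesgue (\<Union>\<D>) - e < measure lebesgue (\<Union>D)"
  proof (rule measure_countable_Union_approachable[OF cD E(2), of "measure lebesgue U"])
    show "d \<in> lmeasurable" if "d \<in> \<D>" for d using that by (auto simp: \<D>_def)
    show "measure lebesgue (\<Union>D') \<le> measure lebesgue U" if "D' \<subseteq> \<D>" "finite D'" for D'
      by (rule measure_mono_fmeasurable[OF _ _ U])
         (use that U' in \<open>auto simp: \<D>_def intro!: sets.finite_Union\<close>)
  qed blast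
  have "measure lebesgue E \<le> measure lebesgue (\<Union>\<D> \<union> (E - \<Union>\<D>))"
    by (rule measure_mono_fmeasurable) (use E Un in \<open>auto intro: fmeasurable.Un fmeasurable.Diff\<close>)
  also have "\<dots> = measure lebesgue (\<Union>\<D>)"
    by (rule measure_Un_null_set) (use Un C(4) in \<open>auto simp: negligible_iff_null_sets \<D>_def\<close>)
  finally have "measure lebesgue (\<Union>D) > measure lebesgue E - e" using D(3) by linarith
  moreover have "pairwise disjnt D"
  proof (rule pairwiseI)
    fix A B assume AB: "A \<in> D" "B \<in> D" "A \<noteq> B"
    then have "A \<in> \<D>" "B \<in> \<D>" using D(1) by auto
    then obtain i j where ij: "i \<in> C" "A = {fst i..snd i}" "j \<in> C" "B = {fst j..snd j}"
      unfolding \<D>_def by blast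
    then have "i \<noteq> j" using AB(3) by auto
    then show "disjnt A B" using C(3) ij by (simp add: pairwise_def)
  qed
  moreover have "\<exists>l r. l < r \<and> I = {l..r} \<and> P l r \<and> {l..r} \<subseteq> U" if I: "I \<in> D" for I
  proof -
    have "I \<in> \<D>" using I D(1) by auto
    then obtain i where i: "i \<in> C" "I = {fst i..snd i}" unfolding \<D>_def by blast
    then have "i \<in> K" using C(2) by auto
    then show ?thesis using i(2) by (auto simp: K_def)
  qed
  ultimately show ?thesis using D(2) that by blast
qed

lemma disjnt_intervals_division:
  fixes D :: "real set set"
  assumes "finite D" "pairwise disjnt D" "\<And>I. I \<in> D \<Longrightarrow> \<exists>l r. l < r \<and> I = {l..r}"
  shows "D division_of \<Union>D" "measure lebesgue (\<Union>D) = sum (measure lborel) D"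
proof -
  show "D division_of \<Union>D"
  proof (rule division_ofI)
    show "interior K1 \<inter> interior K2 = {}" if K: "K1 \<in> D" "K2 \<in> D" "K1 \<noteq> K2" for K1 K2
    proof -
      have "K1 \<inter> K2 = {}" using assms(2) K by (auto simp: pairwise_def disjnt_def)
      then show ?thesis using interior_subset by blast
    qed
    show "\<exists>a b. K = cbox a b" "K \<noteq> {}" if "K \<in> D" for K
      using assms(3)[OF that] by auto
  qed (use assms(1) in auto)
  have "measure lebesgue (\<Union>D) = sum (measure lebesgue) D"
  proof (rule measure_negligible_finite_Union)
    show "S \<in> lmeasurable" if "S \<in> D" for S using assms(3)[OF that] by auto
    show "pairwise (\<lambda>S T. negligible (S \<inter> T)) D"
      using assms(2) by (auto simp: pairwise_def disjnt_def)
  qed (rule assms(1))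
  also have "\<dots> = sum (measure lborel) D"
  proof (rule sum.cong)
    fix I assume "I \<in> D"
    then obtain l r where "l < r" "I = {l..r}" using assms(3) by blast
    then show "measure lebesgue I = measure lborel I" by simp
  qed simp
  finally show "measure lebesgue (\<Union>D) = sum (measure lborel) D" .
qed

lemma sum_incr_id_eq_content: "D division_of S \<Longrightarrow> sum (incr (\<lambda>x. x)) D = sum (measure lborel) D"
  for D :: "real set set"
  by (intro sum.cong refl) (metis incr_id_eq_content)

text \<open>Intervals of slope below \<open>p\<close> cover almost all of \<open>E\<close>, and inside them intervals of slope above \<open>q\<close>
  again cover almost all of \<open>E\<close>. The remaining gaps have small total length, so by absolute continuity
  they contribute little; comparing the total increments forces \<open>E\<close> to be null. No decomposition into
  monotone functions is needed.\<close>

lemma abs_cont_oscillating_null: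
  assumes ac: "abs_cont_on_Icc a b z" and pq: "p < q" and E: "E \<in> lmeasurable" "E \<subseteq> {a<..<b}"
    and lo: "\<And>x d. x \<in> E \<Longrightarrow> d > 0 \<Longrightarrow> \<exists>l r. l < x \<and> x < r \<and> r - l < d \<and> z r - z l < p * (r - l)"
    and hi: "\<And>x d. x \<in> E \<Longrightarrow> d > 0 \<Longrightarrow> \<exists>l r. l < x \<and> x < r \<and> r - l < d \<and> z r - z l > q * (r - l)"
  shows "negligible E"
proof (rule ccontr)
  assume "\<not> negligible E"
  define \<mu> where "\<mu> = measure lebesgue E"
  have \<mu>: "\<mu> > 0"
    using \<open>\<not> negligible E\<close> E(1) unfolding \<mu>_def
    by (metis measure_eq_0_null_sets negligible_iff_null_sets zero_less_measure_iff fmeasurableD negligible_iff_measure0)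
  \<comment> \<open>The inner intervals will have total length \<open>L \<ge> \<mu> / 2\<close>, and
    the estimates end with \<open>(q - p) * L < 2 * e\<close>; this \<open>e\<close> makes the two
    incompatible.\<close>
  define e where "e = (q - p) * \<mu> / 8"
  have e: "e > 0" using pq \<mu> by (simp add: e_def)
  obtain d0 where d0: "d0 > 0" "\<And>D S. D division_of S \<Longrightarrow> S \<subseteq> {a..b} \<Longrightarrow> (\<Sum>K\<in>D. measure lborel K) < d0
      \<Longrightarrow> (\<Sum>K\<in>D. \<bar>incr z K\<bar>) < e"
    using abs_cont_divisionD[OF ac e] by blast
  \<comment> \<open>\<open>d0\<close> makes the increments of \<open>z\<close> over the gaps small,
    \<open>\<mu> / 2\<close> leaves the inner intervals at least half of \<open>E\<close>, and the
    last entry gives \<open>\<bar>p\<bar> * d \<le> e\<close>. Each of the four approximations below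
    loses \<open>d / 4\<close> at most, so the gaps have length below \<open>d\<close>.\<close>
  define d where "d = min d0 (min (\<mu> / 2) (e / (\<bar>p\<bar> + 1)))"
  have d: "d > 0" "d \<le> d0" "d \<le> \<mu> / 2" "d \<le> e / (\<bar>p\<bar> + 1)"
    using d0(1) \<mu> e unfolding d_def by (auto simp del: le_divide_eq_numeral1)
  have pd: "\<bar>p\<bar> * d \<le> e" using d(1,4) by (simp add: field_simps)
  obtain T where T: "open T" "E \<subseteq> T" "T - E \<in> lmeasurable" "emeasure lebesgue (T - E) < ennreal (d/4)"
    using sets_lebesgue_outer_open[of E "d/4"] E(1) d(1) by auto
  define U where "U = T \<inter> {a<..<b}"
  have U: "open U" "E \<subseteq> U" "U \<subseteq> {a<..<b}" "U \<in> lmeasurable"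
  proof -
    show "open U" "E \<subseteq> U" "U \<subseteq> {a<..<b}" using T E by (auto simp: U_def)
    show "U \<in> lmeasurable"
      by (rule fmeasurableI2[of "{a<..<b}"]) (use \<open>open U\<close> \<open>U \<subseteq> _\<close> in auto)
  qed
  have mU: "measure lebesgue (U - E) < d/4"
  proof -
    have "measure lebesgue (U - E) \<le> measure lebesgue (T - E)"
      by (rule measure_mono_fmeasurable) (use T(3) U E in \<open>auto simp: U_def\<close>)
    also have "\<dots> < d/4"
      using T(3,4) d(1) by (simp add: emeasure_eq_measure2 ennreal_less_iff)
    finally show ?thesis .
  qed
  have mU2: "measure lebesgue U < \<mu> + d/4"
    using mU measurable_measure_Diff[OF U(4) fmeasurableD[OF E(1)] U(2)] by (simp add: \<mu>_def)
  have small: "\<exists>d'>0. \<forall>l r. l < x \<longrightarrow> x < r \<longrightarrow> r - l < d' \<longrightarrow> {l..r} \<subseteq> V" if xV: "open V" "x \<in> V" for x and V :: "real set"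
  proof -
    obtain d' where d': "d' > 0" "ball x d' \<subseteq> V" using xV openE by blast
    have "{l..r} \<subseteq> V" if "l < x" "x < r" "r - l < d'" for l r
    proof
      fix y assume "y \<in> {l..r}"
      then have "y \<in> ball x d'" using that by (simp add: dist_real_def abs_less_iff)
      then show "y \<in> V" using d'(2) by blast
    qed
    then show ?thesis using d'(1) by blast
  qed
  have fine: "\<exists>l r. l < r \<and> l \<le> x \<and> x \<le> r \<and> r - l < d' \<and> Q l r \<and> {l..r} \<subseteq> V"
    if V: "open V" "x \<in> V" "d' > 0" and Q: "\<And>d. d > 0 \<Longrightarrow> \<exists>l r. l < x \<and> x < r \<and> r - l < d \<and> Q l r" for x d' :: real and V Q
  proof -
    obtain d'' where d'': "d'' > 0" "\<And>l r. l < x \<Longrightarrow> x < r \<Longrightarrow> r - l < d'' \<Longrightarrow> {l..r} \<subseteq> V"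
      using small[OF V(1,2)] by blast
    obtain l r where "l < x" "x < r" "r - l < min d' d''" "Q l r"
      using Q[of "min d' d''"] V(3) d''(1) by auto
    then show ?thesis using d''(2)[of l r] by (intro exI[of _ l] exI[of _ r]) auto
  qed
  obtain D where D: "finite D" "pairwise disjnt D"
      "\<And>I. I \<in> D \<Longrightarrow> \<exists>l r. l < r \<and> I = {l..r} \<and> z r - z l < p * (r - l) \<and> {l..r} \<subseteq> U"
      "measure lebesgue (\<Union>D) > measure lebesgue E - d/4"
  proof (rule Vitali_finite_intervals[OF E(1), of "d/4" "\<lambda>l r. z r - z l < p * (r - l)" U])
    show "\<exists>l r. l < r \<and> l \<le> x \<and> x \<le> r \<and> r - l < d' \<and> z r - z l < p * (r - l) \<and> {l..r} \<subseteq> U"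
      if "x \<in> E" "d' > 0" for x d'
      by (rule fine) (use U that lo in auto)
  qed (use d U in auto)
  \<comment> \<open>The second covering is taken inside the interior of the first: short intervals
    around a point of \<open>E \<inter> V\<close> stay in the union, and passing to the interior
    loses a null set of endpoints.\<close>
  define V where "V = interior (\<Union>D)"
  have DU: "\<Union>D \<subseteq> U" using D(3) by blast
  have Dlm: "\<Union>D \<in> lmeasurable" using D(1,3) by (auto intro!: fmeasurable.finite_Union)
  have D': "\<exists>l r. l < r \<and> I = {l..r}" if "I \<in> D" for I using D(3)[OF that] by blast
  have negV: "negligible (\<Union>D - V)"
  proof -
    have "negligible (\<Union>I\<in>D. I - interior I)"
    proof (rule negligible_Union[of "(\<lambda>I. I - interior I) ` D"])
      show "negligible t" if t: "t \<in> (\<lambda>I. I - interior I) ` D" for t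
      proof -
        obtain I where I: "I \<in> D" "t = I - interior I" using t by blast
        obtain l r where lr: "l < r" "I = {l..r}" using D'[OF I(1)] by blast
        then have "t = {l..r} - {l<..<r}" using I(2) by simp
        then have "t = {l, r}" using lr(1) by auto
        then show ?thesis by auto
      qed
    qed (use D(1) in auto)
    moreover have "\<Union>D - V \<subseteq> (\<Union>I\<in>D. I - interior I)"
      unfolding V_def using interior_mono[of _ "\<Union>D"] by blast
    ultimately show ?thesis by (rule negligible_subset)
  qed
  define E' where "E' = E \<inter> V"
  have Vlm: "V \<in> lmeasurable" unfolding V_def
    by (rule fmeasurableI2[OF Dlm]) (auto simp: interior_subset)
  have E': "E' \<in> lmeasurable" unfolding E'_def using E(1) Vlm by (intro fmeasurable_Int_fmeasurable) auto
  have mE': "measure lebesgue E' > \<mu> - d/2"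
  proof -
    have "measure lebesgue (\<Union>D) \<le> measure lebesgue (E' \<union> (U - E) \<union> (\<Union>D - V))"
      by (rule measure_mono_fmeasurable)
         (use DU Dlm E' U E Vlm in \<open>auto simp: E'_def intro!: fmeasurable.Un fmeasurable.Diff\<close>)
    also have "\<dots> = measure lebesgue (E' \<union> (U - E))"
      by (rule measure_Un_null_set)
         (use E' U E negV in \<open>auto simp: negligible_iff_null_sets intro!: fmeasurableD fmeasurable.Un fmeasurable.Diff\<close>)
    also have "\<dots> \<le> measure lebesgue E' + measure lebesgue (U - E)"
      by (rule measure_Un_le) (use E' U E in auto)
    finally show ?thesis using D(4) mU by (simp add: \<mu>_def)
  qed
  obtain F where F: "finite F" "pairwise disjnt F"
      "\<And>I. I \<in> F \<Longrightarrow> \<exists>l r. l < r \<and> I = {l..r} \<and> (z r - z l > q * (r - l) \<and> (\<exists>I\<in>D. {l..r} \<subseteq> I)) \<and> {l..r} \<subseteq> V"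
      "measure lebesgue (\<Union>F) > measure lebesgue E' - d/4"
  proof (rule Vitali_finite_intervals[OF E', of "d/4" "\<lambda>l r. z r - z l > q * (r - l) \<and> (\<exists>I\<in>D. {l..r} \<subseteq> I)" V])
    show "\<exists>l r. l < r \<and> l \<le> x \<and> x \<le> r \<and> r - l < d' \<and> (z r - z l > q * (r - l) \<and> (\<exists>I\<in>D. {l..r} \<subseteq> I)) \<and> {l..r} \<subseteq> V"
      if x: "x \<in> E'" "d' > 0" for x d'
    proof -
      have xV: "x \<in> V" "x \<in> E" using x by (auto simp: E'_def)
      then obtain l r where lr: "l < r" "l \<le> x" "x \<le> r" "r - l < d'" "z r - z l > q * (r - l)" "{l..r} \<subseteq> V"
        using fine[of V x d' "\<lambda>l r. z r - z l > q * (r - l)"] hi x(2) by (auto simp: V_def)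
      have sub: "{l..r} \<subseteq> \<Union>D" using lr(6) interior_subset V_def by blast
      \<comment> \<open>A connected set inside a finite union of disjoint closed intervals lies in
        one of them.\<close>
      have "\<exists>I\<in>D. {l..r} \<subseteq> I"
      proof -
        obtain I where I: "I \<in> D" "x \<in> I" using sub lr(2,3) by fastforce
        have "I \<inter> {l..r} = {} \<or> \<Union>(D - {I}) \<inter> {l..r} = {}"
        proof (rule connected_closedD[of "{l..r}"])
          show "I \<inter> \<Union> (D - {I}) \<inter> {l..r} = {}"
            using D(2) I(1) by (auto simp: pairwise_def disjnt_def)
          show "closed I" using D'[OF I(1)] by auto
          show "closed (\<Union> (D - {I}))" using D(1) D' by (intro closed_Union) auto
        qed (use sub I in auto)
        then have "{l..r} \<subseteq> I" using I lr(2,3) sub by auto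
        then show ?thesis using I by blast
      qed
      then show ?thesis using lr by blast
    qed
  qed (use d Vlm in auto)
  have F': "\<exists>l r. l < r \<and> I = {l..r}" if "I \<in> F" for I using F(3)[OF that] by blast
  note divD = disjnt_intervals_division[OF D(1,2) D'] and divF = disjnt_intervals_division[OF F(1,2) F']
  obtain G where G: "G division_of \<Union>G" "\<Union>G \<subseteq> \<Union>D"
    "\<And>f. sum (incr f) D = sum (incr f) F + sum (incr f) G"
  proof (rule division_gaps[OF D(1,2) _ divF(1)])
    show "\<exists>a b. a \<le> b \<and> I = {a..b}" if "I \<in> D" for I using D'[OF that] less_imp_le by blast
    show "\<exists>I\<in>D. J \<subseteq> I" if "J \<in> F" for J using F(3)[OF that] by blast
  qed (assumption | rule that)+
  define L where "L = sum (measure lborel) F"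
  define g where "g = sum (measure lborel) G"
  have lenD: "sum (measure lborel) D = L + g"
    using G(3)[of "\<lambda>x. x"] sum_incr_id_eq_content[OF divD(1)] sum_incr_id_eq_content[OF divF(1)] sum_incr_id_eq_content[OF G(1)]
    by (simp add: L_def g_def)
  have "measure lebesgue (\<Union>D) \<le> measure lebesgue U"
    by (rule measure_mono_fmeasurable) (use DU Dlm U in auto)
  then have g: "g < d" "g \<ge> 0"
    using mU2 mE' F(4) divD(2) divF(2) lenD by (auto simp: L_def g_def intro: sum_nonneg)
  have L: "L \<ge> \<mu> / 2" using mE' F(4) divF(2) d(3) \<mu> by (simp add: L_def)
  have GU: "\<Union>G \<subseteq> {a..b}"
    by (rule order_trans[OF G(2)], rule order_trans[OF DU], rule order_trans[OF U(3)]) auto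
  have "(\<Sum>K\<in>G. \<bar>incr z K\<bar>) < e"
    by (rule d0(2)[OF G(1) GU]) (use g d(2) in \<open>simp add: g_def\<close>)
  then have zG: "sum (incr z) G > - e" using sum_abs[of "incr z" G] by linarith
  have zD: "sum (incr z) D \<le> p * sum (measure lborel) D"
    unfolding sum_distrib_left
  proof (rule sum_mono)
    fix I assume "I \<in> D"
    then obtain l r where "l < r" "I = {l..r}" "z r - z l < p * (r - l)" using D(3) by blast
    then show "incr z I \<le> p * measure lborel I" by (simp add: incr_Icc)
  qed
  have zF: "sum (incr z) F \<ge> q * L"
    unfolding sum_distrib_left L_def
  proof (rule sum_mono)
    fix I assume "I \<in> F"
    then obtain l r where "l < r" "I = {l..r}" "z r - z l > q * (r - l)" using F(3) by blast
    then show "q * measure lborel I \<le> incr z I" by (simp add: incr_Icc)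
  qed
  \<comment> \<open>The total increment over \<open>D\<close>, bounded above through the outer
    slopes and below through the inner slopes and the gaps.\<close>
  have "q * L - e < p * (L + g)"
    using zD zF zG G(3)[of z] lenD by simp
  moreover have "p * g \<le> e"
  proof -
    have "p * g \<le> \<bar>p\<bar> * d" using g by (intro mult_mono) auto
    then show ?thesis using pd by simp
  qed
  ultimately have "(q - p) * L < 2 * e" by (simp add: algebra_simps)
  moreover have "(q - p) * L \<ge> (q - p) * (\<mu> / 2)" using L pq by (intro mult_left_mono) auto
  moreover have "2 * e = (q - p) * (\<mu> / 4)" by (simp add: e_def)
  moreover have "(q - p) * \<mu> > 0" using pq \<mu> by simp
  ultimately show False by simp
qed

text \<open>If \<open>E\<close> were not null, some interval of length \<open>2 * d / 3\<close>
  would meet it in measure \<mu> > 0, where \<open>d\<close> is the modulus of absolute continuity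
  for variation 1. Intervals of slope above \<open>2 / \<mu>\<close> cover more than
  \<open>\<mu> / 2\<close> of that part, so their variation is at least 1 although their total
  length is below \<open>d\<close>.\<close>

lemma abs_cont_unbounded_slopes_null:
  assumes ac: "abs_cont_on_Icc a b z" and E: "E \<in> lmeasurable" "E \<subseteq> {a<..<b}"
    and unb: "\<And>x d q. x \<in> E \<Longrightarrow> d > 0 \<Longrightarrow> \<exists>l r. l < x \<and> x < r \<and> r - l < d \<and> \<bar>z r - z l\<bar> > q * (r - l)"
  shows "negligible E"
proof (rule ccontr)
  assume nE: "\<not> negligible E"
  obtain d where d: "d > 0" "\<And>D S. D division_of S \<Longrightarrow> S \<subseteq> {a..b} \<Longrightarrow> (\<Sum>K\<in>D. measure lborel K) < d
      \<Longrightarrow> (\<Sum>K\<in>D. \<bar>incr z K\<bar>) < 1"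
    using abs_cont_divisionD[OF ac zero_less_one] by blast
  obtain x where x: "x \<in> E" "\<not> negligible (E \<inter> ball x (d/3))"
  proof -
    have "\<exists>x\<in>E. \<not> negligible (E \<inter> ball x (d/3))"
    proof (rule ccontr)
      assume "\<not> ?thesis"
      then have *: "negligible (E \<inter> ball x (d/3))" if "x \<in> E" for x using that by blast
      have "negligible E"
        unfolding locally_negligible_alt[of E]
      proof
        fix x assume "x \<in> E"
        then show "\<exists>U. openin (top_of_set E) U \<and> x \<in> U \<and> negligible U"
          using d(1) *[of x] by (intro exI[of _ "E \<inter> ball x (d/3)"]) (auto simp: openin_open_Int)
      qed
      then show False using nE by simp
    qed
    then show ?thesis using that by blast
  qed
  define U where "U = ball x (d/3) \<inter> {a<..<b}"
  define E0 where "E0 = E \<inter> U"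
  have U: "open U" "U \<in> lmeasurable" unfolding U_def by (auto intro!: fmeasurable_Int_fmeasurable)
  have E0: "E0 \<in> lmeasurable" "E0 = E \<inter> ball x (d/3)"
    using E U by (auto simp: E0_def U_def intro!: fmeasurable_Int_fmeasurable)
  define \<mu> where "\<mu> = measure lebesgue E0"
  have \<mu>: "\<mu> > 0"
    using x(2) E0 unfolding \<mu>_def
    by (metis measure_eq_0_null_sets negligible_iff_null_sets zero_less_measure_iff fmeasurableD negligible_iff_measure0)
  obtain D where D: "finite D" "pairwise disjnt D"
      "\<And>I. I \<in> D \<Longrightarrow> \<exists>l r. l < r \<and> I = {l..r} \<and> \<bar>z r - z l\<bar> > 2/\<mu> * (r - l) \<and> {l..r} \<subseteq> U"
      "measure lebesgue (\<Union>D) > measure lebesgue E0 - \<mu>/2"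
  proof (rule Vitali_finite_intervals[OF E0(1), of "\<mu>/2" "\<lambda>l r. \<bar>z r - z l\<bar> > 2/\<mu> * (r - l)" U])
    show "\<exists>l r. l < r \<and> l \<le> y \<and> y \<le> r \<and> r - l < e \<and> \<bar>z r - z l\<bar> > 2/\<mu> * (r - l) \<and> {l..r} \<subseteq> U"
      if y: "y \<in> E0" "e > 0" for y e
    proof -
      have "y \<in> U" using y by (simp add: E0_def)
      then obtain d' where d': "d' > 0" "ball y d' \<subseteq> U" using U(1) openE by blast
      obtain l r where lr: "l < y" "y < r" "r - l < min e d'" "\<bar>z r - z l\<bar> > 2/\<mu> * (r - l)"
        using unb[of y "min e d'" "2/\<mu>"] y d' by (auto simp: E0_def)
      have "{l..r} \<subseteq> ball y d'" using lr by (auto simp: dist_real_def abs_less_iff)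
      then show ?thesis using lr d'(2) by (intro exI[of _ l] exI[of _ r]) auto
    qed
  qed (use \<mu> U in auto)
  have D': "\<exists>l r. l < r \<and> I = {l..r}" if "I \<in> D" for I using D(3)[OF that] by blast
  note divD = disjnt_intervals_division[OF D(1,2) D']
  have DU: "\<Union>D \<subseteq> U" using D(3) by blast
  have "measure lebesgue (\<Union>D) \<le> measure lebesgue (ball x (d/3))"
    by (rule measure_mono_fmeasurable) (use DU D(1) D' in \<open>auto simp: U_def intro!: sets.finite_Union\<close>, fastforce)
  also have "\<dots> = 2 * d / 3"
    using d(1) by (simp add: ball_eq_greaterThanLessThan)
  also have "\<dots> < d" using d(1) by simp
  finally have "(\<Sum>K\<in>D. measure lborel K) < d" using divD(2) by simp
  then have "(\<Sum>K\<in>D. \<bar>incr z K\<bar>) < 1"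
    by (intro d(2)[OF divD(1)]) (use DU in \<open>auto simp: U_def\<close>)
  moreover have "(\<Sum>K\<in>D. \<bar>incr z K\<bar>) \<ge> 2/\<mu> * (\<Sum>K\<in>D. measure lborel K)"
    unfolding sum_distrib_left
  proof (rule sum_mono)
    fix I assume "I \<in> D"
    then obtain l r where "l < r" "I = {l..r}" "2/\<mu> * (r - l) < \<bar>z r - z l\<bar>" using D(3) by blast
    then show "2/\<mu> * measure lborel I \<le> \<bar>incr z I\<bar>" by (simp add: incr_Icc)
  qed
  moreover have "2/\<mu> * (\<Sum>K\<in>D. measure lborel K) \<ge> 2/\<mu> * (\<mu>/2)"
    using D(4) divD(2) \<mu> by (intro mult_left_mono) (auto simp: \<mu>_def[symmetric])
  moreover have "2/\<mu> * (\<mu>/2) = 1" using \<mu> by simp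
  ultimately show False by linarith
qed

section \<open>Almost everywhere differentiability and the fundamental theorem\<close>

text \<open>For a fixed bound on the length, the points straddled by a suitable interval form a
  union of open intervals. The set is therefore a countable intersection of open sets, for arbitrary
  \<open>P\<close>.\<close>

lemma borel_straddling_frequently:
  fixes P :: "real \<Rightarrow> real \<Rightarrow> bool"
  shows "{x. \<forall>d>0. \<exists>l r. l < x \<and> x < r \<and> r - l < d \<and> P l r} \<in> sets borel"
proof -
  let ?U = "\<lambda>n::nat. {x. \<exists>l r. l < x \<and> x < r \<and> r - l < inverse (real (Suc n)) \<and> P l r}"
  have "?U n = (\<Union>(l, r)\<in>{(l, r). r - l < inverse (real (Suc n)) \<and> P l r}. {l<..<r})" for n
    by auto blast
  then have "open (?U n)" for n by (auto intro!: open_UN)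
  then have "(\<Inter>n. ?U n) \<in> sets borel" by (intro sets.countable_INT'') auto
  also have "(\<Inter>n. ?U n) = {x. \<forall>d>0. \<exists>l r. l < x \<and> x < r \<and> r - l < d \<and> P l r}"
  proof (intro set_eqI iffI)
    fix x assume x: "x \<in> (\<Inter>n. ?U n)"
    have "\<exists>l r. l < x \<and> x < r \<and> r - l < d \<and> P l r" if "d > 0" for d
    proof -
      obtain n where n: "inverse (real (Suc n)) < d" using reals_Archimedean \<open>d > 0\<close> by blast
      obtain l r where "l < x" "x < r" "r - l < inverse (real (Suc n))" "P l r" using x by blast
      then show ?thesis using n less_trans by blast
    qed
    then show "x \<in> {x. \<forall>d>0. \<exists>l r. l < x \<and> x < r \<and> r - l < d \<and> P l r}" by simp
  qed (auto)
  finally show ?thesis .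
qed

text \<open>One endpoint is sent to \<open>x\<close>: by continuity the estimate for intervals
  around \<open>x\<close> passes to intervals that end at \<open>x\<close>.\<close>

lemma has_real_derivative_of_straddling:
  fixes z :: "real \<Rightarrow> real"
  assumes cont: "isCont z x"
    and str: "\<And>e. e > 0 \<Longrightarrow> \<exists>d>0. \<forall>l r. l < x \<longrightarrow> x < r \<longrightarrow> r - l < d \<longrightarrow> \<bar>z r - z l - L * (r - l)\<bar> \<le> e * (r - l)"
  shows "(z has_real_derivative L) (at x)"
  unfolding has_field_derivative_def has_derivative_at_alt
proof (intro conjI allI impI)
  show "bounded_linear ((*) L)" by (rule bounded_linear_mult_right)
  fix e :: real assume "e > 0"
  then obtain d where d: "d > 0" "\<And>l r. l < x \<Longrightarrow> x < r \<Longrightarrow> r - l < d \<Longrightarrow> \<bar>z r - z l - L * (r - l)\<bar> \<le> e * (r - l)"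
    using str by blast
  have "\<bar>z y - z x - L * (y - x)\<bar> \<le> e * \<bar>y - x\<bar>" if y: "\<bar>y - x\<bar> < d" for y
  proof (cases y x rule: linorder_cases)
    case equal
    then show ?thesis by simp
  next
    case greater
    have "0 \<le> e * (y - x) - \<bar>z y - z x - L * (y - x)\<bar>"
    proof (rule tendsto_lowerbound)
      have "(z \<longlongrightarrow> z x) (at_left x)"
        using cont unfolding isCont_def by (rule filterlim_mono) (auto simp: at_le)
      then show "((\<lambda>l. e * (y - l) - \<bar>z y - z l - L * (y - l)\<bar>) \<longlongrightarrow> e * (y - x) - \<bar>z y - z x - L * (y - x)\<bar>) (at_left x)"
        by (intro tendsto_intros)
      have "eventually (\<lambda>l. l \<in> {y - d<..<x}) (at_left x)"
        using y greater by (intro eventually_at_left_real) auto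
      then show "\<forall>\<^sub>F l in at_left x. 0 \<le> e * (y - l) - \<bar>z y - z l - L * (y - l)\<bar>"
        by eventually_elim (use d(2)[of _ y] greater in auto)
    qed auto
    then show ?thesis using greater by simp
  next
    case less
    have "0 \<le> e * (x - y) - \<bar>z x - z y - L * (x - y)\<bar>"
    proof (rule tendsto_lowerbound)
      have "(z \<longlongrightarrow> z x) (at_right x)"
        using cont unfolding isCont_def by (rule filterlim_mono) (auto simp: at_le)
      then show "((\<lambda>r. e * (r - y) - \<bar>z r - z y - L * (r - y)\<bar>) \<longlongrightarrow> e * (x - y) - \<bar>z x - z y - L * (x - y)\<bar>) (at_right x)"
        by (intro tendsto_intros)
      have "eventually (\<lambda>r. r \<in> {x<..<y + d}) (at_right x)"
        using y less by (intro eventually_at_right_real) auto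
      then show "\<forall>\<^sub>F r in at_right x. 0 \<le> e * (r - y) - \<bar>z r - z y - L * (r - y)\<bar>"
        by eventually_elim (use d(2)[of y] less in auto)
    qed auto
    then show ?thesis using less by (simp add: abs_if algebra_simps split: if_splits)
  qed
  then show "\<exists>d>0. \<forall>y. norm (y - x) < d \<longrightarrow> norm (z y - z x - L * (y - x)) \<le> e * norm (y - x)"
    using d(1) by auto
qed

text \<open>Off the exceptional set, the slopes over shrinking intervals around \<open>x\<close>
  stay bounded and their upper and lower limits agree, since two rationals between different limits
  would put \<open>x\<close> into the set. Rational pairs keep the union countable.\<close>

theorem abs_cont_differentiable_ae:
  assumes ac: "abs_cont_on_Icc a b z"
  shows "negligible {x \<in> {a<..<b}. \<not> (\<exists>D. (z has_real_derivative D) (at x))}"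
proof -
  define fr where "fr P = {x::real. \<forall>d>0. \<exists>l r. l < x \<and> x < r \<and> r - l < d \<and> P l r}" for P
  have fr: "fr P \<in> sets borel" for P unfolding fr_def by (rule borel_straddling_frequently)
  define lo where "lo p = fr (\<lambda>l r. z r - z l < p * (r - l))" for p
  define hi where "hi q = fr (\<lambda>l r. z r - z l > q * (r - l))" for q
  define ub where "ub = (\<Inter>n::nat. fr (\<lambda>l r. \<bar>z r - z l\<bar> > real n * (r - l)))"
  have meas: "{a<..<b} \<inter> X \<in> lmeasurable" if "X \<in> sets borel" for X
    using that by (intro fmeasurable_Int_fmeasurable) auto
  have N1: "negligible ({a<..<b} \<inter> (lo p \<inter> hi q))" if "p < q" for p q
  proof (rule abs_cont_oscillating_null[OF ac that])
    show "{a<..<b} \<inter> (lo p \<inter> hi q) \<in> lmeasurable" by (rule meas) (auto simp: lo_def hi_def fr)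
  qed (auto simp: lo_def hi_def fr_def)
  have N2: "negligible ({a<..<b} \<inter> ub)"
  proof (rule abs_cont_unbounded_slopes_null[OF ac])
    show "{a<..<b} \<inter> ub \<in> lmeasurable" by (rule meas) (auto simp: ub_def fr)
    fix x d q :: real assume x: "x \<in> {a<..<b} \<inter> ub" "d > 0"
    obtain n :: nat where n: "q \<le> real n" using real_arch_simple by blast
    obtain l r where "l < x" "x < r" "r - l < d" "\<bar>z r - z l\<bar> > real n * (r - l)"
    proof -
      have "x \<in> fr (\<lambda>l r. \<bar>z r - z l\<bar> > real n * (r - l))" using x by (auto simp: ub_def)
      then show ?thesis using x(2) that unfolding fr_def by blast
    qed
    moreover from this have "q * (r - l) \<le> real n * (r - l)" using n by (intro mult_right_mono) auto
    ultimately show "\<exists>l r. l < x \<and> x < r \<and> r - l < d \<and> q * (r - l) < \<bar>z r - z l\<bar>"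
      by (intro exI[of _ l] exI[of _ r] conjI) linarith+
  qed auto
  define N where "N = (\<Union>(p, q)\<in>{(p, q). p \<in> \<rat> \<and> q \<in> \<rat> \<and> p < q}. {a<..<b} \<inter> (lo p \<inter> hi q)) \<union> ({a<..<b} \<inter> ub)"
  have "negligible N"
  proof -
    have "countable {(p, q). p \<in> \<rat> \<and> q \<in> \<rat> \<and> p < (q::real)}"
      by (rule countable_subset[of _ "\<rat> \<times> \<rat>"]) (auto intro: countable_rat)
    then have "negligible (\<Union>((\<lambda>(p, q). {a<..<b} \<inter> (lo p \<inter> hi q)) ` {(p, q). p \<in> \<rat> \<and> q \<in> \<rat> \<and> p < q}))"
      by (intro negligible_countable_Union) (use N1 in auto)
    then show ?thesis unfolding N_def using N2 by (intro negligible_Un) (simp_all add: case_prod_unfold)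
  qed
  moreover have "{x \<in> {a<..<b}. \<not> (\<exists>D. (z has_real_derivative D) (at x))} \<subseteq> N"
  proof (rule subsetI, rule ccontr)
    fix x assume x: "x \<in> {x \<in> {a<..<b}. \<not> (\<exists>D. (z has_real_derivative D) (at x))}" "x \<notin> N"
    have cont: "isCont z x"
      using abs_cont_imp_continuous_on[OF ac] x(1) by (auto simp: continuous_on_interior)
    have "x \<notin> ub" using x by (auto simp: N_def)
    then obtain n d0 where n: "d0 > 0" "\<And>l r. l < x \<Longrightarrow> x < r \<Longrightarrow> r - l < d0 \<Longrightarrow> \<bar>z r - z l\<bar> \<le> real n * (r - l)"
      unfolding ub_def fr_def INT_iff mem_Collect_eq by (meson UNIV_I not_less)
    \<comment> \<open>The eventual lower bounds of the slopes; the supremum is the lower derivate at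
      \<open>x\<close>, finite because \<open>x\<close> is not in \<open>ub\<close>.\<close>
    define S where "S = {p. \<exists>d>0. \<forall>l r. l < x \<longrightarrow> x < r \<longrightarrow> r - l < d \<longrightarrow> p * (r - l) \<le> z r - z l}"
    have "- real n \<in> S" unfolding S_def using n by (fastforce simp: abs_le_iff)
    then have ne: "S \<noteq> {}" by auto
    have bdd: "p \<le> real n" if "p \<in> S" for p
    proof -
      obtain d where d: "d > 0" "\<And>l r. l < x \<Longrightarrow> x < r \<Longrightarrow> r - l < d \<Longrightarrow> p * (r - l) \<le> z r - z l"
        using \<open>p \<in> S\<close> unfolding S_def by blast
      define m where "m = min d d0 / 4"
      have m: "m > 0" "2 * m < d" "2 * m < d0" using d(1) n(1) by (auto simp: m_def)
      have "p * (2 * m) \<le> z (x + m) - z (x - m)" "\<bar>z (x + m) - z (x - m)\<bar> \<le> real n * (2 * m)"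
        using d(2)[of "x - m" "x + m"] n(2)[of "x - m" "x + m"] m by simp_all
      then have "p * (2 * m) \<le> real n * (2 * m)" by linarith
      then show ?thesis using m(1) by simp
    qed
    then have bS: "bdd_above S" by (auto simp: bdd_above_def)
    define L where "L = Sup S"
    have "(z has_real_derivative L) (at x)"
    proof (rule has_real_derivative_of_straddling[OF cont])
      fix e :: real assume e: "e > 0"
      obtain p where p: "p \<in> S" "L - e < p"
        using less_cSup_iff[OF ne bS, of "L - e"] e by (auto simp: L_def)
      obtain d1 where d1: "d1 > 0" "\<And>l r. l < x \<Longrightarrow> x < r \<Longrightarrow> r - l < d1 \<Longrightarrow> p * (r - l) \<le> z r - z l"
        using p(1) unfolding S_def by blast
      \<comment> \<open>A number \<open>p'\<close> above \<open>L\<close> is no eventual lower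
        bound, so slopes below \<open>p'\<close> occur at all scales. Since \<open>x\<close> is not
        in \<open>N\<close>, slopes above the larger rational \<open>q'\<close> then disappear at
        small scales.\<close>
      obtain p' where p': "p' \<in> \<rat>" "L < p'" "p' < L + e" using Rats_dense_in_real[of L "L + e"] e by auto
      obtain q' where q': "q' \<in> \<rat>" "p' < q'" "q' < L + e" using Rats_dense_in_real[of p' "L + e"] p' by auto
      have "p' \<notin> S" using p'(2) cSup_upper[OF _ bS] unfolding L_def by force
      then have "x \<in> lo p'" unfolding S_def lo_def fr_def by (auto simp: not_le)
      then have "x \<notin> hi q'" using x p' q' unfolding N_def by auto
      then obtain d2 where d2: "d2 > 0" "\<And>l r. l < x \<Longrightarrow> x < r \<Longrightarrow> r - l < d2 \<Longrightarrow> z r - z l \<le> q' * (r - l)"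
        unfolding hi_def fr_def mem_Collect_eq by (meson not_less)
      show "\<exists>d>0. \<forall>l r. l < x \<longrightarrow> x < r \<longrightarrow> r - l < d \<longrightarrow> \<bar>z r - z l - L * (r - l)\<bar> \<le> e * (r - l)"
      proof (intro exI[of _ "min d1 d2"] conjI allI impI)
        fix l r assume lr: "l < x" "x < r" "r - l < min d1 d2"
        have "(L - e) * (r - l) \<le> p * (r - l)" using p lr by (intro mult_right_mono) auto
        moreover have "q' * (r - l) \<le> (L + e) * (r - l)" using q' lr by (intro mult_right_mono) auto
        ultimately show "\<bar>z r - z l - L * (r - l)\<bar> \<le> e * (r - l)"
          using d1(2)[of l r] d2(2)[of l r] lr by (simp add: abs_le_iff algebra_simps)
      qed (use d1 d2 in auto)
    qed
    then show False using x(1) by blast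
  qed
  ultimately show ?thesis by (rule negligible_subset)
qed

text \<open>A gauge argument in the style of Henstock. Intervals tagged off \<open>N\<close> are
  governed by the derivative. Those tagged in \<open>N\<close> contribute 0 to the Riemann sum of
  \<open>h\<close>, and they lie in an open set of measure below \<open>d\<close>, so absolute
  continuity bounds the increments of \<open>z\<close> over them.\<close>

theorem abs_cont_fundamental_theorem:
  assumes ac: "abs_cont_on_Icc a b z" and ab: "a \<le> b" and N: "negligible N"
    and der: "\<And>x. x \<in> {a..b} - N \<Longrightarrow> (z has_real_derivative g x) (at x)"
  shows "(g has_integral z b - z a) {a..b}"
proof -
  define h where "h x = (if x \<in> N then 0 else g x)" for x
  have "(h has_integral z b - z a) {a..b}"
    unfolding has_integral_real
  proof (intro allI impI)
    fix e :: real assume e: "e > 0"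
    \<comment> \<open>The error off \<open>N\<close> is at most \<open>e' * (b - a)\<close>, which
      has to stay below \<open>e / 2\<close>; the \<open>+ 1\<close> covers
      \<open>a = b\<close>.\<close>
    define e' where "e' = e / (2 * (b - a + 1))"
    have e': "e' > 0" "e' * (b - a) < e / 2" using e ab by (auto simp: e'_def field_simps)
    obtain d where d: "d > 0" "\<And>D S. D division_of S \<Longrightarrow> S \<subseteq> {a..b} \<Longrightarrow> (\<Sum>K\<in>D. measure lborel K) < d
      \<Longrightarrow> (\<Sum>K\<in>D. \<bar>incr z K\<bar>) < e / 2"
      using abs_cont_divisionD[OF ac, of "e / 2"] e by auto
    obtain T where T: "open T" "N \<subseteq> T" "T \<in> lmeasurable" "measure lebesgue T < d"
    proof -
      have "N \<in> sets lebesgue" using N by (simp add: negligible_imp_sets)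
      then obtain T where T: "open T" "N \<subseteq> T" "T - N \<in> lmeasurable" "emeasure lebesgue (T - N) < ennreal d"
        using sets_lebesgue_outer_open[of N d] d(1) by auto
      have N0: "N \<in> null_sets lebesgue" using N by (simp add: negligible_iff_null_sets)
      have T': "T = (T - N) \<union> N" using T(2) by auto
      have "T \<in> lmeasurable" using T' T(3) N0 by (metis fmeasurable.Un negligible_imp_measurable N)
      moreover have "measure lebesgue T = measure lebesgue (T - N)"
        by (metis T' measure_Un_null_set T(3) N0 fmeasurableD)
      moreover have "measure lebesgue (T - N) < d"
        using T(3,4) d(1) by (simp add: emeasure_eq_measure2 ennreal_less_iff)
      ultimately show ?thesis using that T(1,2) by auto
    qed
    have "\<exists>\<delta>>0. (x \<in> N \<longrightarrow> ball x \<delta> \<subseteq> T) \<and>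
        (x \<in> {a..b} - N \<longrightarrow> (\<forall>y. \<bar>y - x\<bar> < \<delta> \<longrightarrow> \<bar>z y - z x - g x * (y - x)\<bar> \<le> e' * \<bar>y - x\<bar>))" for x
    proof (cases "x \<in> N")
      case True
      then obtain \<delta> where "\<delta> > 0" "ball x \<delta> \<subseteq> T" using T openE by blast
      then show ?thesis using True by blast
    next
      case False
      show ?thesis
      proof (cases "x \<in> {a..b}")
        case True
        then have "(z has_derivative (*) (g x)) (at x)" using der[of x] False by (simp add: has_field_derivative_def)
        then show ?thesis using False e'(1) unfolding has_derivative_at_alt by auto
      qed (use False in \<open>auto intro: exI[of _ 1]\<close>)
    qed
    then obtain \<delta> where \<delta>: "\<And>x. \<delta> x > 0" "\<And>x. x \<in> N \<Longrightarrow> ball x (\<delta> x) \<subseteq> T"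
      "\<And>x y. x \<in> {a..b} - N \<Longrightarrow> \<bar>y - x\<bar> < \<delta> x \<Longrightarrow> \<bar>z y - z x - g x * (y - x)\<bar> \<le> e' * \<bar>y - x\<bar>"
      by metis
    show "\<exists>\<gamma>. gauge \<gamma> \<and> (\<forall>\<D>. \<D> tagged_division_of {a..b} \<and> \<gamma> fine \<D> \<longrightarrow>
        norm ((\<Sum>(x, K)\<in>\<D>. measure lborel K *\<^sub>R h x) - (z b - z a)) < e)"
    proof (intro exI[of _ "\<lambda>x. ball x (\<delta> x)"] conjI allI impI)
      show "gauge (\<lambda>x. ball x (\<delta> x))" using \<delta>(1) by (rule gauge_ball_dependent[rule_format])
      fix \<D> assume "\<D> tagged_division_of {a..b} \<and> (\<lambda>x. ball x (\<delta> x)) fine \<D>"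
      then have D: "\<D> tagged_division_of {a..b}" and fine: "(\<lambda>x. ball x (\<delta> x)) fine \<D>" by auto
      have fin: "finite \<D>" using D by auto
      have K: "\<exists>u v. u \<le> v \<and> K = {u..v} \<and> u \<le> x \<and> x \<le> v \<and> a \<le> u \<and> v \<le> b \<and> K \<subseteq> ball x (\<delta> x)"
        if xK: "(x, K) \<in> \<D>" for x K
      proof -
        obtain u v where uv: "K = {u..v}" using tagged_division_ofD(4)[OF D xK] by auto
        moreover have "x \<in> K" "K \<subseteq> {a..b}" using tagged_division_ofD(2,3)[OF D xK] by auto
        moreover have "K \<subseteq> ball x (\<delta> x)" using fine xK by (auto simp: fine_def)
        ultimately show ?thesis by (intro exI[of _ u] exI[of _ v]) auto
      qed
      define A where "A = {(x, K) \<in> \<D>. x \<in> N}"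
      have A: "A \<subseteq> \<D>" by (auto simp: A_def)
      have "(\<Sum>(x, K)\<in>\<D>. measure lborel K *\<^sub>R h x) - (z b - z a) =
          (\<Sum>(x, K)\<in>\<D>. measure lborel K *\<^sub>R h x - (z (Sup K) - z (Inf K)))"
        using additive_tagged_division_1[OF ab D, of z] by (simp add: sum_subtractf case_prod_unfold)
      also have "\<dots> = (\<Sum>(x, K)\<in>A. measure lborel K *\<^sub>R h x - (z (Sup K) - z (Inf K))) +
          (\<Sum>(x, K)\<in>\<D> - A. measure lborel K *\<^sub>R h x - (z (Sup K) - z (Inf K)))"
        by (rule sum.subset_diff[OF A fin, THEN trans]) (rule add.commute)
      finally have eq: "norm ((\<Sum>(x, K)\<in>\<D>. measure lborel K *\<^sub>R h x) - (z b - z a)) \<le>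
          (\<Sum>(x, K)\<in>A. \<bar>measure lborel K *\<^sub>R h x - (z (Sup K) - z (Inf K))\<bar>) +
          (\<Sum>(x, K)\<in>\<D> - A. \<bar>measure lborel K *\<^sub>R h x - (z (Sup K) - z (Inf K))\<bar>)"
        by (auto simp: case_prod_unfold intro!: order_trans[OF abs_triangle_ineq] add_mono sum_abs)
      have "(\<Sum>(x, K)\<in>\<D> - A. \<bar>measure lborel K *\<^sub>R h x - (z (Sup K) - z (Inf K))\<bar>) \<le> (\<Sum>(x, K)\<in>\<D> - A. e' * measure lborel K)"
      proof (rule sum_mono, clarify)
        fix x K assume xK: "(x, K) \<in> \<D>" "(x, K) \<notin> A"
        obtain u v where uv: "u \<le> v" "K = {u..v}" "u \<le> x" "x \<le> v" "a \<le> u" "v \<le> b" "K \<subseteq> ball x (\<delta> x)"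
          using K[OF xK(1)] by blast
        have xN: "x \<in> {a..b} - N" using xK uv by (auto simp: A_def)
        have "u \<in> K" "v \<in> K" using uv by auto
        then have "u \<in> ball x (\<delta> x)" "v \<in> ball x (\<delta> x)" using uv(7) by blast+
        then have "\<bar>z v - z x - g x * (v - x)\<bar> \<le> e' * (v - x)" "\<bar>z u - z x - g x * (u - x)\<bar> \<le> e' * (x - u)"
          using \<delta>(3)[OF xN, of v] \<delta>(3)[OF xN, of u] uv by (auto simp: dist_real_def abs_minus_commute)
        then have "\<bar>(v - u) * g x - (z v - z u)\<bar> \<le> e' * (v - u)" by (simp add: abs_le_iff algebra_simps)
        then show "\<bar>measure lborel K *\<^sub>R h x - (z (Sup K) - z (Inf K))\<bar> \<le> e' * measure lborel K"
          using uv xN by (simp add: h_def)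
      qed
      also have "\<dots> \<le> (\<Sum>(x, K)\<in>\<D>. e' * measure lborel K)"
        by (rule sum_mono2) (use fin e' in auto)
      also have "\<dots> = e' * (b - a)"
        using additive_content_tagged_division[of \<D> a b] D ab by (simp add: case_prod_unfold sum_distrib_left[symmetric])
      also have "\<dots> < e / 2" by (rule e'(2))
      finally have 1: "(\<Sum>(x, K)\<in>\<D> - A. \<bar>measure lborel K *\<^sub>R h x - (z (Sup K) - z (Inf K))\<bar>) < e / 2" .
      have tA: "A tagged_division_of \<Union>(snd ` A)"
        by (rule tagged_partial_division_of_Union_self, rule tagged_partial_division_subset[OF _ A])
           (use D in \<open>auto simp: tagged_division_of_def\<close>)
      have dA: "snd ` A division_of \<Union>(snd ` A)" by (rule division_of_tagged_division[OF tA])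
      have "(\<Sum>(x, K)\<in>A. \<bar>measure lborel K *\<^sub>R h x - (z (Sup K) - z (Inf K))\<bar>) = (\<Sum>(x, K)\<in>A. \<bar>incr z K\<bar>)"
      proof (rule sum.cong, simp, clarify)
        fix x K assume xK: "(x, K) \<in> A"
        then have "x \<in> N" "K \<noteq> {}" using K[of x K] by (auto simp: A_def)
        then show "\<bar>measure lborel K *\<^sub>R h x - (z (Sup K) - z (Inf K))\<bar> = \<bar>incr z K\<bar>" by (simp add: h_def incr_def)
      qed
      also have "\<dots> = (\<Sum>K\<in>snd ` A. \<bar>incr z K\<bar>)"
      proof (rule sum.over_tagged_division_lemma[OF tA])
        fix u v :: real assume "box u v = {}"
        then have "v \<le> u" by simp
        then show "\<bar>incr z (cbox u v)\<bar> = 0" by (cases "u = v") (auto simp: incr_def)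
      qed
      also have "\<dots> < e / 2"
      proof (rule d(2)[OF dA])
        show "\<Union>(snd ` A) \<subseteq> {a..b}" using K A by fastforce
        have "sum (measure lborel) (snd ` A) = measure lebesgue (\<Union>(snd ` A))"
        proof -
          have "measure lebesgue (\<Union>(snd ` A)) = sum (measure lebesgue) (snd ` A)"
          proof (rule measure_negligible_finite_Union)
            show "finite (snd ` A)" using fin A finite_subset by blast
            show "S \<in> lmeasurable" if "S \<in> snd ` A" for S
              using division_ofD(4)[OF dA that] by auto
            show "pairwise (\<lambda>S T. negligible (S \<inter> T)) (snd ` A)"
            proof (rule pairwiseI)
              fix S T assume ST: "S \<in> snd ` A" "T \<in> snd ` A" "S \<noteq> T"
              obtain s1 s2 t1 t2 where "S = {s1..s2}" "T = {t1..t2}"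
                using division_ofD(4)[OF dA ST(1)] division_ofD(4)[OF dA ST(2)] by auto
              moreover have "interior S \<inter> interior T = {}" using division_ofD(5)[OF dA ST] .
              ultimately have *: "{max s1 t1<..<min s2 t2} = {}" "S \<inter> T = {max s1 t1..min s2 t2}" by auto
              from *(1) have "max s1 t1 \<ge> min s2 t2" by simp
              then have "S \<inter> T \<subseteq> {max s1 t1}" unfolding *(2) by auto
              then show "negligible (S \<inter> T)" using negligible_subset negligible_sing by blast
            qed
          qed
          also have "\<dots> = sum (measure lborel) (snd ` A)"
          proof (rule sum.cong)
            fix S assume "S \<in> snd ` A"
            then obtain u v where "S = cbox u v" using division_ofD(4)[OF dA] by blast
            then show "measure lebesgue S = measure lborel S" by simp
          qed simp
          finally show ?thesis by simp
        qed
        also have "\<dots> \<le> measure lebesgue T"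
        proof (rule measure_mono_fmeasurable[OF _ _ T(3)])
          show "\<Union>(snd ` A) \<subseteq> T" using K A \<delta>(2) by (fastforce simp: A_def)
          show "\<Union>(snd ` A) \<in> sets lebesgue"
          proof (rule sets.finite_Union)
            show "snd ` A \<subseteq> sets lebesgue"
            proof
              fix S assume "S \<in> snd ` A"
              then obtain u v where "S = cbox u v" using division_ofD(4)[OF dA] by blast
              then show "S \<in> sets lebesgue" by simp
            qed
          qed (rule division_ofD(1)[OF dA])
        qed
        also have "\<dots> < d" by (rule T(4))
        finally show "sum (measure lborel) (snd ` A) < d" .
      qed
      finally show "norm ((\<Sum>(x, K)\<in>\<D>. measure lborel K *\<^sub>R h x) - (z b - z a)) < e"
        using eq 1 by linarith
    qed
  qed
  then show ?thesis
    by (rule has_integral_spike[OF N, rotated]) (simp add: h_def)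
qed

section \<open>The variational form of the rate function\<close>

text \<open>A bound as a predicate instead of a supremum, so that no value has to be assigned to
  paths of infinite energy. Degenerate intervals contribute 0, because division by 0 yields
  0.\<close>

definition energy_le :: "real \<Rightarrow> (real \<Rightarrow> real) \<Rightarrow> bool" where
  "energy_le C z \<longleftrightarrow> (\<forall>(m::nat) l r. (\<forall>i<m. 0 \<le> l i \<and> l i \<le> r i \<and> r i \<le> 1) \<longrightarrow>
     disjoint_family_on (\<lambda>i. {l i<..<r i}) {..<m} \<longrightarrow>
     (\<Sum>i<m. (z (r i) - z (l i))\<^sup>2 / (r i - l i)) \<le> C)"

lemma energy_leD:
  fixes l r :: "nat \<Rightarrow> real"
  assumes "energy_le C z" "\<And>i. i < m \<Longrightarrow> 0 \<le> l i \<and> l i \<le> r i \<and> r i \<le> 1"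
    "disjoint_family_on (\<lambda>i. {l i<..<r i}) {..<m}"
  shows "(\<Sum>i<m. (z (r i) - z (l i))\<^sup>2 / (r i - l i)) \<le> C"
  using assms unfolding energy_le_def by blast

lemma energy_le_nonneg: "energy_le C z \<Longrightarrow> C \<ge> 0"
  using energy_leD[of C z 0 "\<lambda>_. 0" "\<lambda>_. 0"] by (simp add: disjoint_family_on_def)

lemma energy_le_increment:
  assumes "energy_le C z" "0 \<le> s" "s \<le> t" "t \<le> 1"
  shows "(z t - z s)\<^sup>2 \<le> C * (t - s)"
proof (cases "s = t")
  case False
  have "(z t - z s)\<^sup>2 / (t - s) \<le> C"
    using energy_leD[of C z 1 "\<lambda>_. s" "\<lambda>_. t"] assms by (simp add: disjoint_family_on_def)
  then show ?thesis using False assms by (simp add: field_simps)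
qed simp

text \<open>Cauchy-Schwarz, obtained by integrating
  \<open>2 * c * g x - c\<^sup>2 \<le> (g x)\<^sup>2\<close>, which is sharpest when
  \<open>c\<close> is the mean slope.\<close>

lemma square_increment_le_integral:
  fixes g :: "real \<Rightarrow> real"
  assumes "s \<le> t" "(g has_integral d) {s..t}" "(\<lambda>x. (g x)\<^sup>2) integrable_on {s..t}"
  shows "d\<^sup>2 / (t - s) \<le> integral {s..t} (\<lambda>x. (g x)\<^sup>2)"
proof (cases "s = t")
  case False
  define c where "c = d / (t - s)"
  have "((\<lambda>x. 2 * c * g x - c\<^sup>2) has_integral (2 * c * d - c\<^sup>2 * (t - s))) {s..t}"
    using has_integral_diff[OF has_integral_mult_right[OF assms(2), of "2 * c"] has_integral_const_real[of "c\<^sup>2" s t]] assms(1)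
    by (simp add: mult.commute)
  moreover have "2 * c * g x - c\<^sup>2 \<le> (g x)\<^sup>2" for x
    using zero_le_power2[of "g x - c"] by (simp add: power2_diff algebra_simps)
  ultimately have "2 * c * d - c\<^sup>2 * (t - s) \<le> integral {s..t} (\<lambda>x. (g x)\<^sup>2)"
    using has_integral_le integrable_integral[OF assms(3)] by blast
  moreover have "2 * c * d - c\<^sup>2 * (t - s) = d\<^sup>2 / (t - s)"
  proof -
    have "2 * (d / w) * d - (d / w)\<^sup>2 * w = d\<^sup>2 / w" if "w \<noteq> 0" for w
      using that by (simp add: power2_eq_square)
    from this[of "t - s"] show ?thesis using False by (simp add: c_def)
  qed
  ultimately show ?thesis by simp
qed (use assms in auto)

text \<open>Cauchy-Schwarz on every interval. The integrals are moved to the open intervals and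
  extended by 0, so that at each point at most one summand is nonzero and the sum is dominated by
  \<open>(g x)\<^sup>2\<close>.\<close>

lemma energy_le_integral:
  assumes rep: "\<And>s t. 0 \<le> s \<Longrightarrow> s \<le> t \<Longrightarrow> t \<le> 1 \<Longrightarrow> (g has_integral z t - z s) {s..t}"
    and sq: "(\<lambda>x. (g x)\<^sup>2) integrable_on {0..1}"
  shows "energy_le (integral {0..1} (\<lambda>x. (g x)\<^sup>2)) z"
  unfolding energy_le_def
proof (intro allI impI)
  fix m :: nat and l r :: "nat \<Rightarrow> real"
  assume lr: "\<forall>i<m. 0 \<le> l i \<and> l i \<le> r i \<and> r i \<le> 1" and disj: "disjoint_family_on (\<lambda>i. {l i<..<r i}) {..<m}"
  have sub: "(\<lambda>x. (g x)\<^sup>2) integrable_on {l i..r i}" if "i < m" for i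
    by (rule integrable_on_subinterval[OF sq]) (use lr that in auto)
  have "(\<Sum>i<m. (z (r i) - z (l i))\<^sup>2 / (r i - l i)) \<le> (\<Sum>i<m. integral {l i..r i} (\<lambda>x. (g x)\<^sup>2))"
    by (intro sum_mono square_increment_le_integral rep sub) (use lr in auto)
  also have "\<dots> \<le> integral {0..1} (\<lambda>x. (g x)\<^sup>2)"
  proof (rule has_integral_le)
    have "((\<lambda>x. if x \<in> {l i<..<r i} then (g x)\<^sup>2 else 0) has_integral integral {l i..r i} (\<lambda>x. (g x)\<^sup>2)) {0..1}"
      if "i < m" for i
    proof -
      have "((\<lambda>x. (g x)\<^sup>2) has_integral integral {l i..r i} (\<lambda>x. (g x)\<^sup>2)) {l i<..<r i}"
        using integrable_integral[OF sub[OF that]] by (simp add: has_integral_Icc_iff_Ioo)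
      moreover have "{l i<..<r i} \<subseteq> {0..1}" using lr that by fastforce
      ultimately show ?thesis by (simp only: has_integral_restrict)
    qed
    then show "((\<lambda>x. \<Sum>i<m. if x \<in> {l i<..<r i} then (g x)\<^sup>2 else 0) has_integral (\<Sum>i<m. integral {l i..r i} (\<lambda>x. (g x)\<^sup>2))) {0..1}"
      by (intro has_integral_sum) auto
    show "((\<lambda>x. (g x)\<^sup>2) has_integral integral {0..1} (\<lambda>x. (g x)\<^sup>2)) {0..1}"
      by (rule integrable_integral[OF sq])
    fix x :: real assume "x \<in> {0..1}"
    show "(\<Sum>i<m. if x \<in> {l i<..<r i} then (g x)\<^sup>2 else 0) \<le> (g x)\<^sup>2"
    proof (cases "\<exists>j<m. x \<in> {l j<..<r j}")
      case True
      then obtain j where j: "j < m" "x \<in> {l j<..<r j}" by blast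
      have uniq: "i = j" if i: "i < m" "x \<in> {l i<..<r i}" for i
      proof (rule ccontr)
        assume "i \<noteq> j"
        then have "{l i<..<r i} \<inter> {l j<..<r j} = {}" using disj i(1) j(1) by (simp add: disjoint_family_on_def)
        then show False using i(2) j(2) by blast
      qed
      have "(\<Sum>i<m. if x \<in> {l i<..<r i} then (g x)\<^sup>2 else 0) = (\<Sum>i<m. if i = j then (g x)\<^sup>2 else 0)"
      proof (rule sum.cong)
        fix i assume "i \<in> {..<m}"
        then have "x \<in> {l i<..<r i} \<longleftrightarrow> i = j" using uniq j by blast
        then show "(if x \<in> {l i<..<r i} then (g x)\<^sup>2 else 0) = (if i = j then (g x)\<^sup>2 else 0)" by (simp only:)
      qed simp
      then show ?thesis using j by simp
    next
      case False
      then have "(\<Sum>i<m. if x \<in> {l i<..<r i} then (g x)\<^sup>2 else 0) = 0" by (intro sum.neutral) auto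
      then show ?thesis by simp
    qed
  qed
  finally show "(\<Sum>i<m. (z (r i) - z (l i))\<^sup>2 / (r i - l i)) \<le> integral {0..1} (\<lambda>x. (g x)\<^sup>2)" .
qed

text \<open>Young's inequality \<open>d \<le> \<kappa> / 2 * (d\<^sup>2 / w) + 1 / (2 * \<kappa>) *
  w\<close> splits the variation into an energy part, below \<open>e / 2\<close> since
  \<open>\<kappa> * C < e\<close>, and a length part, at most \<open>e / 2\<close> for total length
  below \<open>e * \<kappa>\<close>.\<close>

lemma energy_le_abs_cont:
  assumes "energy_le C z"
  shows "abs_cont_on_Icc 0 1 z"
  unfolding abs_cont_on_Icc_def
proof (intro allI impI)
  fix e :: real assume e: "e > 0"
  have C: "C \<ge> 0" using energy_le_nonneg[OF assms] .
  define \<kappa> where "\<kappa> = e / (C + 1)"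
  have \<kappa>: "\<kappa> > 0" "\<kappa> * C < e" using e C by (auto simp: \<kappa>_def field_simps)
  show "\<exists>\<delta>>0. \<forall>(m::nat) l r. (\<forall>i<m. 0 \<le> l i \<and> l i \<le> r i \<and> r i \<le> 1) \<longrightarrow>
        disjoint_family_on (\<lambda>i. {l i<..<r i}) {..<m} \<longrightarrow>
        (\<Sum>i<m. r i - l i) < \<delta> \<longrightarrow> (\<Sum>i<m. \<bar>z (r i) - z (l i)\<bar>) < e"
  proof (intro exI[of _ "e * \<kappa>"] conjI allI impI)
    fix m :: nat and l r :: "nat \<Rightarrow> real"
    assume lr: "\<forall>i<m. 0 \<le> l i \<and> l i \<le> r i \<and> r i \<le> 1" and disj: "disjoint_family_on (\<lambda>i. {l i<..<r i}) {..<m}"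
      and small: "(\<Sum>i<m. r i - l i) < e * \<kappa>"
    have "(\<Sum>i<m. \<bar>z (r i) - z (l i)\<bar>) \<le>
        (\<Sum>i<m. \<kappa> / 2 * ((z (r i) - z (l i))\<^sup>2 / (r i - l i)) + 1 / (2 * \<kappa>) * (r i - l i))"
    proof (rule sum_mono)
      fix i assume "i \<in> {..<m}"
      then have i: "l i \<le> r i" using lr by auto
      show "\<bar>z (r i) - z (l i)\<bar> \<le> \<kappa> / 2 * ((z (r i) - z (l i))\<^sup>2 / (r i - l i)) + 1 / (2 * \<kappa>) * (r i - l i)"
      proof (cases "l i = r i")
        case False
        define w where "w = r i - l i"
        define d where "d = \<bar>z (r i) - z (l i)\<bar>"
        have w: "w > 0" using False i by (simp add: w_def)
        have "0 \<le> (\<kappa> * d - w)\<^sup>2" by simp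
        then have "2 * \<kappa> * d * w \<le> \<kappa>\<^sup>2 * d\<^sup>2 + w\<^sup>2" by (simp add: power2_eq_square algebra_simps)
        then have "d \<le> (\<kappa>\<^sup>2 * d\<^sup>2 + w\<^sup>2) / (2 * \<kappa> * w)" using w \<kappa> by (simp add: field_simps)
        also have "\<dots> = \<kappa> / 2 * (d\<^sup>2 / w) + 1 / (2 * \<kappa>) * w"
          using w \<kappa> by (simp add: field_simps power2_eq_square)
        finally show ?thesis by (simp add: d_def w_def)
      qed simp
    qed
    also have "\<dots> = \<kappa> / 2 * (\<Sum>i<m. (z (r i) - z (l i))\<^sup>2 / (r i - l i)) + 1 / (2 * \<kappa>) * (\<Sum>i<m. r i - l i)"
      by (simp only: sum.distrib sum_distrib_left)
    also have "\<dots> \<le> \<kappa> / 2 * C + 1 / (2 * \<kappa>) * (\<Sum>i<m. r i - l i)"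
      using energy_leD[OF assms _ disj] lr \<kappa> by (intro add_right_mono mult_left_mono) auto
    also have "\<dots> < e / 2 + 1 / (2 * \<kappa>) * (e * \<kappa>)"
    proof (rule add_less_le_mono)
      show "\<kappa> / 2 * C < e / 2" using \<kappa>(2) by simp
      show "1 / (2 * \<kappa>) * (\<Sum>i<m. r i - l i) \<le> 1 / (2 * \<kappa>) * (e * \<kappa>)"
        using small \<kappa>(1) by (intro mult_left_mono) auto
    qed
    also have "\<dots> = e" using \<kappa>(1) by simp
    finally show "(\<Sum>i<m. \<bar>z (r i) - z (l i)\<bar>) < e" .
  qed (use e \<kappa> in auto)
qed

section \<open>Interpolation on a uniform grid and the two descriptions of the rate\<close>

text \<open>The derivative of the piecewise linear interpolation of \<open>z\<close> at the points
  \<open>i / n\<close>, constant on half-open blocks.\<close>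

definition grid_slope :: "nat \<Rightarrow> (real \<Rightarrow> real) \<Rightarrow> real \<Rightarrow> real" where
  "grid_slope n z t = real n * (z (real_of_int (\<lfloor>real n * t\<rfloor> + 1) / real n) - z (real_of_int \<lfloor>real n * t\<rfloor> / real n))"

lemma grid_slope_eq:
  assumes "n > 0" "real i / real n \<le> t" "t < (real i + 1) / real n"
  shows "grid_slope n z t = real n * (z ((real i + 1) / real n) - z (real i / real n))"
proof -
  have "\<lfloor>real n * t\<rfloor> = int i" using assms by (intro floor_unique) (auto simp: field_simps)
  then show ?thesis by (simp add: grid_slope_def)
qed

lemma has_integral_step:
  fixes f \<phi> :: "_ \<Rightarrow> real"
  assumes n: "n > 0" and f: "\<And>i t. i < k \<Longrightarrow> real i / real n \<le> t \<Longrightarrow> t < (real i + 1) / real n \<Longrightarrow> f t = \<phi> i"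
  shows "(f has_integral (\<Sum>i<k. \<phi> i / real n)) {0..real k / real n}"
  using f
proof (induction k)
  case 0
  then show ?case by (simp add: has_integral_refl)
next
  case (Suc k)
  have "(f has_integral (\<Sum>i<k. \<phi> i / real n)) {0..real k / real n}"
    by (rule Suc.IH) (use Suc.prems in auto)
  moreover have "(f has_integral \<phi> k / real n) {real k / real n..real (Suc k) / real n}"
  proof (rule has_integral_spike_finite[of "{real (Suc k) / real n}"])
    show "((\<lambda>_. \<phi> k) has_integral \<phi> k / real n) {real k / real n..real (Suc k) / real n}"
      using has_integral_const_real[of "\<phi> k" "real k / real n" "real (Suc k) / real n"] n
      by (simp add: field_simps)
    fix t assume "t \<in> {real k / real n..real (Suc k) / real n} - {real (Suc k) / real n}"
    then show "f t = \<phi> k" using n by (intro Suc.prems) (auto simp: add.commute)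
  qed simp
  ultimately have "(f has_integral (\<Sum>i<k. \<phi> i / real n) + \<phi> k / real n) {0..real (Suc k) / real n}"
    by (rule has_integral_combine[rotated 2]) (use n in \<open>auto simp: divide_right_mono\<close>)
  then show ?case by simp
qed

lemma has_integral_grid_slope_square:
  assumes "n > 0"
  shows "((\<lambda>t. (grid_slope n z t)\<^sup>2) has_integral
     real n * (\<Sum>i<n. (z ((real i + 1) / real n) - z (real i / real n))\<^sup>2)) {0..1}"
proof -
  have "((\<lambda>t. (grid_slope n z t)\<^sup>2) has_integral
     (\<Sum>i<n. (real n * (z ((real i + 1) / real n) - z (real i / real n)))\<^sup>2 / real n)) {0..real n / real n}"
    using assms by (intro has_integral_step) (auto simp: grid_slope_eq)
  moreover have "(\<Sum>i<n. (real n * (z ((real i + 1) / real n) - z (real i / real n)))\<^sup>2 / real n) =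
     real n * (\<Sum>i<n. (z ((real i + 1) / real n) - z (real i / real n))\<^sup>2)"
    unfolding sum_distrib_left using assms by (intro sum.cong) (auto simp: power2_eq_square)
  ultimately show ?thesis using assms by simp
qed

lemma grid_energy_le:
  assumes "energy_le C z" "n > 0"
  shows "real n * (\<Sum>i<n. (z ((real i + 1) / real n) - z (real i / real n))\<^sup>2) \<le> C"
proof -
  have "(\<Sum>i<n. (z ((real i + 1) / real n) - z (real i / real n))\<^sup>2 / ((real i + 1) / real n - real i / real n)) \<le> C"
  proof (rule energy_leD[OF assms(1)])
    show "disjoint_family_on (\<lambda>i. {real i / real n<..<(real i + 1) / real n}) {..<n}"
      unfolding disjoint_family_on_def
    proof (intro ballI impI)
      fix i j :: nat assume "i \<noteq> j"
      have "(real i + 1) / real n \<le> real j / real n" if "i < j" for i j :: nat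
        using that by (intro divide_right_mono) auto
      from this[of i j] this[of j i] \<open>i \<noteq> j\<close>
      show "{real i / real n<..<(real i + 1) / real n} \<inter> {real j / real n<..<(real j + 1) / real n} = {}"
        by (cases i j rule: linorder_cases) auto
    qed
  qed (use assms(2) in \<open>auto simp: divide_right_mono\<close>)
  also have "(\<Sum>i<n. (z ((real i + 1) / real n) - z (real i / real n))\<^sup>2 / ((real i + 1) / real n - real i / real n)) =
      real n * (\<Sum>i<n. (z ((real i + 1) / real n) - z (real i / real n))\<^sup>2)"
    unfolding sum_distrib_left using assms(2) by (intro sum.cong) (auto simp: diff_divide_distrib[symmetric])
  finally show ?thesis .
qed

text \<open>The difference quotient is taken over an interval that contains \<open>u\<close> and
  shrinks to it, so comparing both ends with \<open>z u\<close> suffices.\<close>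

lemma grid_slope_tendsto:
  assumes z: "(z has_real_derivative D) (at u)" and u: "0 < u"
  shows "(\<lambda>n. grid_slope (Suc n) z u) \<longlonglongrightarrow> D"
proof (rule LIMSEQ_I)
  fix e :: real assume e: "e > 0"
  have "(z has_derivative (*) D) (at u)" using z by (simp add: has_field_derivative_def)
  then obtain d where d: "d > 0" "\<And>y. \<bar>y - u\<bar> < d \<Longrightarrow> \<bar>z y - z u - D * (y - u)\<bar> \<le> e / 2 * \<bar>y - u\<bar>"
    using e unfolding has_derivative_at_alt by (metis half_gt_zero real_norm_def)
  obtain N where N: "inverse (real (Suc N)) < d" using d(1) reals_Archimedean by blast
  have "norm (grid_slope (Suc n) z u - D) < e" if "n \<ge> N" for n
  proof -
    define m where "m = real (Suc n)"
    have m: "m > 0" "1 / m < d"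
    proof -
      have "1 / m \<le> inverse (real (Suc N))" using \<open>n \<ge> N\<close> by (auto simp: m_def divide_inverse le_imp_inverse_le)
      then show "1 / m < d" using N by simp
    qed (simp add: m_def)
    define l r where "l = real_of_int \<lfloor>m * u\<rfloor> / m" and "r = real_of_int (\<lfloor>m * u\<rfloor> + 1) / m"
    have lr: "l \<le> u" "u < r" "r - l = 1 / m"
      using m(1) by (auto simp: l_def r_def field_simps) linarith
    have "\<bar>z r - z u - D * (r - u)\<bar> \<le> e / 2 * (r - u)" "\<bar>z l - z u - D * (l - u)\<bar> \<le> e / 2 * (u - l)"
      using d(2)[of r] d(2)[of l] lr m(2) by auto
    then have "\<bar>z r - z u - D * (r - u)\<bar> + \<bar>z l - z u - D * (l - u)\<bar> \<le> e / 2 * (r - l)"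
      by (simp add: right_diff_distrib)
    moreover have "z r - z l - D * (r - l) = (z r - z u - D * (r - u)) - (z l - z u - D * (l - u))"
      by (simp add: algebra_simps)
    ultimately have "\<bar>z r - z l - D * (r - l)\<bar> \<le> e / 2 * (r - l)" by linarith
    then have 1: "\<bar>z r - z l - D * (1 / m)\<bar> \<le> e / 2 * (1 / m)" by (simp only: lr(3))
    have "grid_slope (Suc n) z u - D = m * (z r - z l - D * (1 / m))"
      using m(1) by (simp add: grid_slope_def l_def r_def m_def field_simps)
    then have "\<bar>grid_slope (Suc n) z u - D\<bar> = m * \<bar>z r - z l - D * (1 / m)\<bar>"
      using m(1) by (simp add: abs_mult)
    also have "\<dots> \<le> m * (e / 2 * (1 / m))" using 1 m(1) by (intro mult_left_mono) auto
    also have "\<dots> < e" using m(1) e by simp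
    finally show ?thesis by simp
  qed
  then show "\<exists>no. \<forall>n\<ge>no. norm (grid_slope (Suc n) z u - D) < e" by blast
qed

lemma borel_measurable_grid_slope [measurable]: "grid_slope n z \<in> borel_measurable borel"
proof -
  have "(\<lambda>t. (\<lambda>j. real n * (z (real_of_int (j + 1) / real n) - z (real_of_int j / real n))) \<lfloor>real n * t\<rfloor>) \<in> borel_measurable borel"
    by (rule measurable_compose[of _ _ "count_space UNIV"]) auto
  then show ?thesis by (simp add: grid_slope_def[abs_def])
qed

lemma AE_lebesgue_differentiable:
  assumes "abs_cont_on_Icc 0 1 z"
  shows "AE u in lebesgue. u \<in> {0..1} \<longrightarrow> 0 < u \<and> u < 1 \<and> (z has_real_derivative deriv z u) (at u)"
proof (rule AE_I')
  let ?N = "{x \<in> {0<..<1}. \<not> (\<exists>D. (z has_real_derivative D) (at x))} \<union> {0, 1}"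
  have "negligible ?N"
    using abs_cont_differentiable_ae[OF assms] by (intro negligible_Un) auto
  then show "?N \<in> null_sets lebesgue" by (simp add: negligible_iff_null_sets)
  show "{u \<in> space lebesgue. \<not> (u \<in> {0..1} \<longrightarrow> 0 < u \<and> u < 1 \<and> (z has_real_derivative deriv z u) (at u))} \<subseteq> ?N"
    by (auto dest: DERIV_imp_deriv)
qed

text \<open>Fatou's lemma along the grids with \<open>Suc n\<close> blocks: the squared slopes
  converge almost everywhere to the squared derivative, while their integrals are grid energies and
  hence at most \<open>C\<close>.\<close>

theorem rate_fn_le_energy:
  assumes z: "energy_le C z" "z 0 = 0"
  shows "rate_fn z \<le> ereal (C / 2)"
proof -
  have ac: "abs_cont_on_Icc 0 1 z" by (rule energy_le_abs_cont[OF z(1)])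
  have C: "C \<ge> 0" using energy_le_nonneg[OF z(1)] .
  define f where "f n u = ennreal ((grid_slope (Suc n) z u)\<^sup>2) * indicator {0..1} u" for n and u :: real
  have f_meas: "f n \<in> borel_measurable lebesgue" for n
    by (rule measurable_completion) (simp add: f_def[abs_def])
  have f_int: "(\<integral>\<^sup>+u. f n u \<partial>lebesgue) \<le> ennreal C" for n
  proof -
    have "(\<integral>\<^sup>+u. f n u \<partial>lebesgue) =
        ennreal (real (Suc n) * (\<Sum>i<Suc n. (z ((real i + 1) / real (Suc n)) - z (real i / real (Suc n)))\<^sup>2))"
      unfolding nn_integral_completion f_def
      by (rule nn_integral_has_integral_lebesgue'[OF _ has_integral_grid_slope_square]) auto
    then show ?thesis using grid_energy_le[OF z(1), of "Suc n"] by (simp del: of_nat_Suc add: ennreal_leI)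
  qed
  have "AE u in lebesgue. ennreal ((deriv z u)\<^sup>2) * indicator {0..1} u = liminf (\<lambda>n. f n u)"
    using AE_lebesgue_differentiable[OF ac]
  proof eventually_elim
    case (elim u)
    have "(\<lambda>n. f n u) \<longlonglongrightarrow> ennreal ((deriv z u)\<^sup>2) * indicator {0..1} u"
    proof (cases "u \<in> {0..1}")
      case True
      then have "(\<lambda>n. ennreal ((grid_slope (Suc n) z u)\<^sup>2)) \<longlonglongrightarrow> ennreal ((deriv z u)\<^sup>2)"
        using elim by (intro tendsto_ennrealI tendsto_power grid_slope_tendsto) auto
      then show ?thesis using True by (simp add: f_def)
    qed (simp add: f_def)
    then show ?case by (simp add: lim_imp_Liminf)
  qed
  then have "(\<integral>\<^sup>+u\<in>{0..1}. ennreal ((deriv z u)\<^sup>2) \<partial>lebesgue) = (\<integral>\<^sup>+u. liminf (\<lambda>n. f n u) \<partial>lebesgue)"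
    by (rule nn_integral_cong_AE)
  also have "\<dots> \<le> liminf (\<lambda>n. \<integral>\<^sup>+u. f n u \<partial>lebesgue)"
    by (rule nn_integral_liminf) (rule f_meas)
  also have "\<dots> \<le> ennreal C"
    using f_int by (intro Liminf_le) auto
  finally have "enn2ereal (\<integral>\<^sup>+u\<in>{0..1}. ennreal ((deriv z u)\<^sup>2) \<partial>lebesgue) \<le> enn2ereal (ennreal C)"
    by (simp add: less_eq_ennreal.rep_eq)
  then have "ereal (1/2) * enn2ereal (\<integral>\<^sup>+u\<in>{0..1}. ennreal ((deriv z u)\<^sup>2) \<partial>lebesgue) \<le> ereal (1/2) * ereal C"
    using C by (intro ereal_mult_left_mono) (auto simp: enn2ereal_ennreal)
  then show ?thesis using ac z(2) by (simp add: rate_fn_def)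
qed

text \<open>A finite rate forces absolute continuity, and the fundamental theorem then makes
  \<open>z\<close> the integral of \<open>deriv z\<close>. The Lebesgue integral in the rate is
  transferred to the gauge integral, in which the energy estimates are stated.\<close>

theorem rate_fn_leD:
  assumes "rate_fn z \<le> ereal \<alpha>"
  shows "z 0 = 0" "\<And>s t. 0 \<le> s \<Longrightarrow> s \<le> t \<Longrightarrow> t \<le> 1 \<Longrightarrow> (deriv z has_integral z t - z s) {s..t}"
    "(\<lambda>u. (deriv z u)\<^sup>2) integrable_on {0..1}" "integral {0..1} (\<lambda>u. (deriv z u)\<^sup>2) \<le> 2 * \<alpha>"
proof -
  have fin: "z 0 = 0 \<and> abs_cont_on_Icc 0 1 z" using assms by (auto simp: rate_fn_def split: if_splits)
  then show "z 0 = 0" by simp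
  have ac: "abs_cont_on_Icc 0 1 z" using fin by simp
  define X where "X = (\<integral>\<^sup>+u\<in>{0..1}. ennreal ((deriv z u)\<^sup>2) \<partial>lebesgue)"
  have X: "ereal (1/2) * enn2ereal X \<le> ereal \<alpha>" using assms fin by (simp add: rate_fn_def X_def)
  then have "X \<noteq> \<infinity>" by auto
  then obtain x where x: "X = ennreal x" "x \<ge> 0" by (cases X rule: ennreal_cases) auto
  have x\<alpha>: "x \<le> 2 * \<alpha>" using X x by (simp add: enn2ereal_ennreal)
  \<comment> \<open>The endpoints join the exceptional set because differentiability is only known
    almost everywhere in the open interval.\<close>
  let ?N = "{x \<in> {0<..<1}. \<not> (\<exists>D. (z has_real_derivative D) (at x))} \<union> {0, 1}"
  have N: "negligible ?N"
    using abs_cont_differentiable_ae[OF ac] by (intro negligible_Un) auto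
  show rep: "(deriv z has_integral z t - z s) {s..t}" if st: "0 \<le> s" "s \<le> t" "t \<le> 1" for s t
  proof (rule abs_cont_fundamental_theorem[OF _ st(2) N])
    show "abs_cont_on_Icc s t z"
      unfolding abs_cont_on_Icc_def
    proof (intro allI impI)
      fix e :: real assume "e > 0"
      then obtain d where d: "d > 0" "\<And>(m::nat) (l::nat \<Rightarrow> real) (r::nat \<Rightarrow> real).
        (\<forall>i<m. 0 \<le> l i \<and> l i \<le> r i \<and> r i \<le> 1) \<Longrightarrow>
        disjoint_family_on (\<lambda>i. {l i<..<r i}) {..<m} \<Longrightarrow>
        (\<Sum>i<m. r i - l i) < d \<Longrightarrow> (\<Sum>i<m. \<bar>z (r i) - z (l i)\<bar>) < e"
        using ac unfolding abs_cont_on_Icc_def by meson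
      show "\<exists>\<delta>>0. \<forall>(m::nat) l r. (\<forall>i<m. s \<le> l i \<and> l i \<le> r i \<and> r i \<le> t) \<longrightarrow>
        disjoint_family_on (\<lambda>i. {l i<..<r i}) {..<m} \<longrightarrow>
        (\<Sum>i<m. r i - l i) < \<delta> \<longrightarrow> (\<Sum>i<m. \<bar>z (r i) - z (l i)\<bar>) < e"
        by (intro exI[of _ d] conjI allI impI d) (use st in fastforce)+
    qed
    show "(z has_real_derivative deriv z x) (at x)" if "x \<in> {s..t} - ?N" for x
      using that st by (auto dest: DERIV_imp_deriv)
  qed
  have "deriv z integrable_on {0..1}" using rep[of 0 1] by (auto simp: integrable_on_def)
  then have "deriv z \<in> borel_measurable (lebesgue_on {0..1})" by (rule integrable_imp_measurable)
  then have "(\<lambda>u. (deriv z u)\<^sup>2) \<in> borel_measurable (lebesgue_on {0..1})" by measurable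
  then have meas: "(\<lambda>u. if u \<in> {0..1} then (deriv z u)\<^sup>2 else 0) \<in> borel_measurable lebesgue"
    by (rule borel_measurable_if_I) auto
  have Xeq: "(\<integral>\<^sup>+u. ennreal (if u \<in> {0..1} then (deriv z u)\<^sup>2 else 0) \<partial>lebesgue) = ennreal x"
    unfolding x(1)[symmetric] X_def by (intro nn_integral_cong) (auto simp: indicator_def)
  have int: "integrable lebesgue (\<lambda>u. if u \<in> {0..1} then (deriv z u)\<^sup>2 else 0)"
    by (rule integrableI_nonneg[OF meas]) (simp_all only: Xeq, simp_all)
  have "((\<lambda>u. if u \<in> {0..1} then (deriv z u)\<^sup>2 else 0) has_integral (\<integral>u. (if u \<in> {0..1} then (deriv z u)\<^sup>2 else 0) \<partial>lebesgue)) UNIV"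
    by (rule has_integral_integral_lebesgue[OF int])
  then have hi: "((\<lambda>u. (deriv z u)\<^sup>2) has_integral (\<integral>u. (if u \<in> {0..1} then (deriv z u)\<^sup>2 else 0) \<partial>lebesgue)) {0..1}"
    by (subst (asm) has_integral_restrict) auto
  have "(\<integral>u. (if u \<in> {0..1} then (deriv z u)\<^sup>2 else 0) \<partial>lebesgue) =
      enn2real (\<integral>\<^sup>+u. ennreal (if u \<in> {0..1} then (deriv z u)\<^sup>2 else 0) \<partial>lebesgue)"
    by (rule integral_eq_nn_integral[OF meas]) auto
  then have "(\<integral>u. (if u \<in> {0..1} then (deriv z u)\<^sup>2 else 0) \<partial>lebesgue) = x"
    unfolding Xeq using x(2) by simp
  then show "(\<lambda>u. (deriv z u)\<^sup>2) integrable_on {0..1}" "integral {0..1} (\<lambda>u. (deriv z u)\<^sup>2) \<le> 2 * \<alpha>"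
    using hi x\<alpha> by (auto simp: integrable_on_def dest: integral_unique)
qed

lemma energy_le_mono: "energy_le C z \<Longrightarrow> C \<le> C' \<Longrightarrow> energy_le C' z"
  unfolding energy_le_def by (meson order_trans)

text \<open>Each energy condition involves finitely many values of \<open>z\<close>, so a level set
  described in this form is stable under pointwise limits.\<close>

corollary rate_fn_le_iff_energy:
  "rate_fn z \<le> ereal \<alpha> \<longleftrightarrow> z 0 = 0 \<and> energy_le (2 * \<alpha>) z"
proof
  assume r: "rate_fn z \<le> ereal \<alpha>"
  have "energy_le (integral {0..1} (\<lambda>x. (deriv z x)\<^sup>2)) z"
    by (rule energy_le_integral) (use rate_fn_leD[OF r] in auto)
  then show "z 0 = 0 \<and> energy_le (2 * \<alpha>) z"
    using rate_fn_leD[OF r] energy_le_mono by blast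
qed (use rate_fn_le_energy[of "2 * \<alpha>" z] in auto)

section \<open>Paths built by integrating a modified slope\<close>

lemma continuous_cadlag01:
  assumes f: "continuous_on {0..1} f"
  shows "restrict f {0..1} \<in> cadlag01"
proof -
  have "(restrict f {0..1} \<longlongrightarrow> restrict f {0..1} t) (at_right t)" if t: "t \<in> {0..<1}" for t
  proof -
    have "(f \<longlongrightarrow> f t) (at_right t)"
      by (rule continuous_on_Icc_at_rightD[of t 1]) (use t f in \<open>auto intro: continuous_on_subset\<close>)
    moreover have "eventually (\<lambda>u. u \<in> {t<..<1}) (at_right t)"
      using t by (intro eventually_at_right_real) auto
    then have "eventually (\<lambda>u. f u = restrict f {0..1} u) (at_right t)"
      by eventually_elim (use t in auto)
    ultimately have "(restrict f {0..1} \<longlongrightarrow> f t) (at_right t)" by (rule Lim_transform_eventually)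
    then show ?thesis using t by simp
  qed
  moreover have "(restrict f {0..1} \<longlongrightarrow> f t) (at_left t)" if t: "t \<in> {0<..1}" for t
  proof -
    have "(f \<longlongrightarrow> f t) (at_left t)"
      by (rule continuous_on_Icc_at_leftD[of 0 t]) (use t f in \<open>auto intro: continuous_on_subset\<close>)
    moreover have "eventually (\<lambda>u. u \<in> {0<..<t}) (at_left t)"
      using t by (intro eventually_at_left_real) auto
    then have "eventually (\<lambda>u. f u = restrict f {0..1} u) (at_left t)"
      by eventually_elim (use t in auto)
    ultimately show ?thesis by (rule Lim_transform_eventually)
  qed
  ultimately show ?thesis unfolding cadlag01_def by blast
qed

text \<open>For the interpolation of a path that may jump. The factor 2 consists of one \<delta>
  between \<open>x\<close> and its value at the left grid point and one between that value and
  \<open>y\<close>, since inside a block \<open>y\<close> moves by a fraction of the block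
  increment.\<close>

lemma grid_interpolation:
  assumes n: "n > 0" and x0: "x 0 = 0"
    and osc: "\<And>i t. i < n \<Longrightarrow> real i / real n \<le> t \<Longrightarrow> t \<le> (real i + 1) / real n \<Longrightarrow> \<bar>x t - x (real i / real n)\<bar> \<le> \<delta>"
  obtains y where "y \<in> cadlag01" "\<And>t. t \<in> {0..1} \<Longrightarrow> \<bar>y t - x t\<bar> \<le> 2 * \<delta>"
    "rate_fn y \<le> ereal (real n / 2 * (\<Sum>i<n. (x ((real i + 1) / real n) - x (real i / real n))\<^sup>2))"
proof -
  let ?g = "grid_slope n x"
  let ?E = "real n * (\<Sum>i<n. (x ((real i + 1) / real n) - x (real i / real n))\<^sup>2)"
  define y where "y t = integral {0..t} ?g" for t
  have grid: "(?g has_integral x (real k / real n)) {0..real k / real n}" if "k \<le> n" for k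
  proof -
    have "(?g has_integral (\<Sum>i<k. real n * (x ((real i + 1) / real n) - x (real i / real n)) / real n)) {0..real k / real n}"
      using n by (intro has_integral_step) (auto simp: grid_slope_eq)
    also have "(\<Sum>i<k. real n * (x ((real i + 1) / real n) - x (real i / real n)) / real n) =
        (\<Sum>i<k. x (real (Suc i) / real n) - x (real i / real n))"
      using n by (intro sum.cong) (auto simp: add.commute)
    also have "\<dots> = x (real k / real n)" using x0 sum_lessThan_telescope[of "\<lambda>i. x (real i / real n)" k] by simp
    finally show ?thesis .
  qed
  have int: "?g integrable_on {0..1}" using grid[of n] n by (auto simp: integrable_on_def)
  have int': "?g integrable_on {s..t}" if "0 \<le> s" "t \<le> 1" for s t
    by (rule integrable_on_subinterval[OF int]) (use that in auto)
  have rep: "(?g has_integral y t - y s) {s..t}" if "0 \<le> s" "s \<le> t" "t \<le> 1" for s t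
  proof -
    have "y t = y s + integral {s..t} ?g"
      unfolding y_def using that int' by (intro Henstock_Kurzweil_Integration.integral_combine[symmetric]) auto
    then show ?thesis using integrable_integral[OF int'[of s t]] that by simp
  qed
  have y_grid: "y (real k / real n) = x (real k / real n)" if "k \<le> n" for k
    unfolding y_def by (rule integral_unique[OF grid[OF that]])
  have y0: "y 0 = 0" by (simp add: y_def)
  have cont: "continuous_on {0..1} y"
    unfolding y_def by (rule indefinite_integral_continuous_1[OF int])
  let ?y = "restrict y {0..1}"
  have sq: "((\<lambda>t. (?g t)\<^sup>2) has_integral ?E) {0..1}" by (rule has_integral_grid_slope_square[OF n])
  have "energy_le (integral {0..1} (\<lambda>t. (?g t)\<^sup>2)) ?y"
    by (rule energy_le_integral) (use rep sq in \<open>auto simp: integrable_on_def\<close>)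
  then have "energy_le ?E ?y" using sq by (simp add: integral_unique)
  then have "rate_fn ?y \<le> ereal (?E / 2)" by (rule rate_fn_le_energy) (simp add: y0)
  moreover have "\<bar>?y t - x t\<bar> \<le> 2 * \<delta>" if t: "t \<in> {0..1}" for t
  proof (cases "t = 1")
    case True
    then have "?y t = x t" using y_grid[of n] n by simp
    then show ?thesis using osc[of 0 0] n by simp
  next
    case False
    define i where "i = nat \<lfloor>real n * t\<rfloor>"
    have i: "real i \<le> real n * t" "real n * t < real i + 1"
      using t by (auto simp: i_def)
    have "real n * t < real n" using t False n by simp
    then have "i < n" using i(1) by linarith
    have it: "real i / real n \<le> t" "t < (real i + 1) / real n" using i n by (auto simp: field_simps)
    define \<Delta> where "\<Delta> = x ((real i + 1) / real n) - x (real i / real n)"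
    have \<Delta>: "\<bar>\<Delta>\<bar> \<le> \<delta>" using osc[OF \<open>i < n\<close>, of "(real i + 1) / real n"] n by (simp add: \<Delta>_def divide_right_mono)
    have "(?g has_integral y t - y (real i / real n)) {real i / real n..t}"
      using it t by (intro rep) auto
    moreover have "(?g has_integral (real n * \<Delta>) * (t - real i / real n)) {real i / real n..t}"
    proof (rule has_integral_eq)
      show "((\<lambda>_. real n * \<Delta>) has_integral (real n * \<Delta>) * (t - real i / real n)) {real i / real n..t}"
        using has_integral_const_real[of "real n * \<Delta>" "real i / real n" t] it by (simp add: mult.commute)
      show "real n * \<Delta> = ?g s" if "s \<in> {real i / real n..t}" for s
        using that it n by (subst grid_slope_eq[of n i]) (auto simp: \<Delta>_def)
    qed
    ultimately have "y t - x (real i / real n) = (real n * t - real i) * \<Delta>"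
      using y_grid[of i] \<open>i < n\<close> n by (simp add: has_integral_unique algebra_simps has_integral_iff)
    then have "\<bar>y t - x (real i / real n)\<bar> = (real n * t - real i) * \<bar>\<Delta>\<bar>" using i by (simp add: abs_mult)
    also have "\<dots> \<le> 1 * \<delta>" using i \<Delta> by (intro mult_mono) auto
    finally have "\<bar>y t - x (real i / real n)\<bar> \<le> \<delta>" by simp
    moreover have "\<bar>x t - x (real i / real n)\<bar> \<le> \<delta>" using osc[OF \<open>i < n\<close>] it by simp
    ultimately show ?thesis using t by simp
  qed
  ultimately show ?thesis using that[of ?y] continuous_cadlag01[OF cont] by simp
qed

text \<open>The derivative is replaced by 0 wherever it exceeds \<open>R\<close> in absolute value.
  This does not raise the energy, and what is removed is pointwise at most the squared derivative
  divided by \<open>R\<close>, so the uniform error is at most \<open>A / R\<close>.\<close>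

lemma Lipschitz_approximation:
  assumes z: "rate_fn z \<le> ereal \<alpha>" and \<delta>: "\<delta> > 0"
  obtains y R where "R > 0" "y 0 = 0" "energy_le (2 * \<alpha>) y"
    "\<And>s t. 0 \<le> s \<Longrightarrow> s \<le> t \<Longrightarrow> t \<le> 1 \<Longrightarrow> \<bar>y t - y s\<bar> \<le> R * (t - s)"
    "\<And>t. t \<in> {0..1} \<Longrightarrow> \<bar>y t - z t\<bar> \<le> \<delta>"
proof -
  let ?g = "deriv z"
  have z0: "z 0 = 0" and rep: "\<And>s t. 0 \<le> s \<Longrightarrow> s \<le> t \<Longrightarrow> t \<le> 1 \<Longrightarrow> (?g has_integral z t - z s) {s..t}"
    and sq: "(\<lambda>u. (?g u)\<^sup>2) integrable_on {0..1}" and sq\<alpha>: "integral {0..1} (\<lambda>u. (?g u)\<^sup>2) \<le> 2 * \<alpha>"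
    using rate_fn_leD[OF z] by auto
  define A where "A = integral {0..1} (\<lambda>u. (?g u)\<^sup>2)"
  have A: "A \<ge> 0" unfolding A_def by (rule integral_nonneg[OF sq]) simp
  define R where "R = (A + 1) / \<delta>"
  have R: "R > 0" "A / R \<le> \<delta>" using A \<delta> by (auto simp: R_def field_simps)
  define h where "h u = (if \<bar>?g u\<bar> \<le> R then ?g u else 0)" for u
  have gm: "?g \<in> borel_measurable (lebesgue_on {0..1})"
    by (rule integrable_imp_measurable) (use rep[of 0 1] in \<open>auto simp: integrable_on_def\<close>)
  have hm: "h \<in> borel_measurable (lebesgue_on {0..1})"
    unfolding h_def[abs_def] using gm by measurable
  have hint: "h integrable_on {0..1}"
    by (rule measurable_bounded_by_integrable_imp_integrable[OF hm, of "\<lambda>_. R"]) (use R in \<open>auto simp: h_def\<close>)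
  have hint': "h integrable_on {s..t}" if "0 \<le> s" "t \<le> 1" for s t
    by (rule integrable_on_subinterval[OF hint]) (use that in auto)
  have "(\<lambda>u. (h u)\<^sup>2) \<in> borel_measurable (lebesgue_on {0..1})" using hm by measurable
  then have hsq: "(\<lambda>u. (h u)\<^sup>2) integrable_on {0..1}"
    by (rule measurable_bounded_by_integrable_imp_integrable[OF _ sq]) (auto simp: h_def)
  define y where "y t = integral {0..t} h" for t
  have yrep: "(h has_integral y t - y s) {s..t}" if "0 \<le> s" "s \<le> t" "t \<le> 1" for s t
  proof -
    have "y t = y s + integral {s..t} h"
      unfolding y_def using that hint' by (intro Henstock_Kurzweil_Integration.integral_combine[symmetric]) auto
    then show ?thesis using integrable_integral[OF hint'[of s t]] that by simp
  qed
  have "energy_le (integral {0..1} (\<lambda>u. (h u)\<^sup>2)) y" by (rule energy_le_integral[OF yrep hsq])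
  moreover have "integral {0..1} (\<lambda>u. (h u)\<^sup>2) \<le> integral {0..1} (\<lambda>u. (?g u)\<^sup>2)"
    by (rule integral_le[OF hsq sq]) (auto simp: h_def)
  ultimately have "energy_le (integral {0..1} (\<lambda>u. (?g u)\<^sup>2)) y" by (rule energy_le_mono)
  then have "energy_le (2 * \<alpha>) y" by (rule energy_le_mono) (rule sq\<alpha>)
  moreover have "\<bar>y t - y s\<bar> \<le> R * (t - s)" if "0 \<le> s" "s \<le> t" "t \<le> 1" for s t
    using has_integral_bound_real[OF _ finite.emptyI yrep[OF that], of R] that R by (auto simp: h_def)
  moreover have "\<bar>y t - z t\<bar> \<le> \<delta>" if t: "t \<in> {0..1}" for t
  proof -
    have "((\<lambda>u. ?g u - h u) has_integral (z t - z 0) - (y t - y 0)) {0..t}"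
      using t by (intro has_integral_diff rep yrep) auto
    then have d: "((\<lambda>u. ?g u - h u) has_integral z t - y t) {0..t}" by (simp add: z0 y_def)
    have sqt: "(\<lambda>u. (?g u)\<^sup>2) integrable_on {0..t}" by (rule integrable_on_subinterval[OF sq]) (use t in auto)
    have "norm (integral {0..t} (\<lambda>u. ?g u - h u)) \<le> integral {0..t} (\<lambda>u. (?g u)\<^sup>2 / R)"
    proof (rule integral_norm_bound_integral)
      show "(\<lambda>u. ?g u - h u) integrable_on {0..t}" using d by (auto simp: integrable_on_def)
      show "(\<lambda>u. (?g u)\<^sup>2 / R) integrable_on {0..t}" using sqt by (rule integrable_on_divide)
      show "norm (?g u - h u) \<le> (?g u)\<^sup>2 / R" for u
      proof (cases "\<bar>?g u\<bar> \<le> R")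
        case False
        then have "R * \<bar>?g u\<bar> \<le> \<bar>?g u\<bar> * \<bar>?g u\<bar>" by (intro mult_right_mono) auto
        then show ?thesis using False R(1) by (simp add: h_def field_simps power2_eq_square)
      qed (use R(1) in \<open>auto simp: h_def\<close>)
    qed
    also have "\<dots> = integral {0..t} (\<lambda>u. (?g u)\<^sup>2) / R" by simp
    also have "\<dots> \<le> A / R"
      unfolding A_def using R(1) t by (intro divide_right_mono integral_subset_le sqt sq) auto
    finally show ?thesis using R(2) d by (simp add: integral_unique)
  qed
  moreover have "y 0 = 0" by (simp add: y_def)
  ultimately show ?thesis using that R(1) by blast
qed

section \<open>The uniform topology and random step functions\<close>

lemma abs_diff_le_mdist_D01:
  assumes "x \<in> cadlag01" "y \<in> cadlag01" "t \<in> {0..1}"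
  shows "\<bar>x t - y t\<bar> \<le> mdist D01_metric x y"
proof -
  obtain A B where AB: "\<forall>t\<in>{0..1}. \<bar>x t\<bar> \<le> A" "\<forall>t\<in>{0..1}. \<bar>y t\<bar> \<le> B"
    using assms(1,2) cadlag01_bounded by meson
  have "bdd_above ((\<lambda>t. \<bar>x t - y t\<bar>) ` {0..1})"
  proof (rule bdd_aboveI2)
    fix t :: real assume "t \<in> {0..1}"
    then show "\<bar>x t - y t\<bar> \<le> A + B" using AB by (smt (verit))
  qed
  then show ?thesis unfolding mdist_D01_metric[OF assms(1,2)] by (rule cSUP_upper[OF assms(3)])
qed

lemma mdist_D01_le:
  assumes "x \<in> cadlag01" "y \<in> cadlag01" "\<And>t. t \<in> {0..1} \<Longrightarrow> \<bar>x t - y t\<bar> \<le> \<delta>"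
  shows "mdist D01_metric x y \<le> \<delta>"
  unfolding mdist_D01_metric[OF assms(1,2)] by (rule cSUP_least) (use assms(3) in auto)

interpretation D01: Metric_space cadlag01 "mdist D01_metric"
  rewrites "D01.mtopology = D01_topology"
proof -
  show "Metric_space cadlag01 (mdist D01_metric)"
    using Metric_space_mspace_mdist[of D01_metric] by simp
  then show "Metric_space.mtopology cadlag01 (mdist D01_metric) = D01_topology"
    by (simp add: D01_topology_def mtopology_of_def)
qed

lemma openin_D01_uniform_nbhd:
  assumes "openin D01_topology U" "z \<in> U"
  obtains \<delta> where "\<delta> > 0" "\<And>y. y \<in> cadlag01 \<Longrightarrow> (\<And>t. t \<in> {0..1} \<Longrightarrow> \<bar>y t - z t\<bar> \<le> \<delta>) \<Longrightarrow> y \<in> U"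
proof -
  obtain r where r: "r > 0" "D01.mball z r \<subseteq> U" using assms D01.openin_mtopology by meson
  have zD: "z \<in> cadlag01" using assms openin_subset by fastforce
  show ?thesis
  proof (rule that[of "r / 2"])
    fix y assume y: "y \<in> cadlag01" "\<And>t. t \<in> {0..1} \<Longrightarrow> \<bar>y t - z t\<bar> \<le> r / 2"
    have "mdist D01_metric z y \<le> r / 2"
      by (rule mdist_D01_le[OF zD y(1)]) (use y(2) in \<open>simp add: abs_minus_commute\<close>)
    then have "y \<in> D01.mball z r" using r(1) zD y(1) by simp
    then show "y \<in> U" using r(2) by blast
  qed (use r in simp)
qed

lemma closure_of_D01I:
  assumes "z \<in> cadlag01" "\<Gamma> \<subseteq> cadlag01"
    "\<And>\<delta>. \<delta> > 0 \<Longrightarrow> \<exists>y\<in>\<Gamma>. \<forall>t\<in>{0..1}. \<bar>y t - z t\<bar> \<le> \<delta>"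
  shows "z \<in> D01_topology closure_of \<Gamma>"
  unfolding D01.metric_closure_of_alt
proof (intro CollectI conjI allI impI)
  fix r :: real assume "r > 0"
  then obtain y where y: "y \<in> \<Gamma>" "\<forall>t\<in>{0..1}. \<bar>y t - z t\<bar> \<le> r" using assms(3) by blast
  have "mdist D01_metric z y \<le> r"
    by (rule mdist_D01_le) (use y assms(1,2) in \<open>auto simp: abs_minus_commute\<close>)
  then show "\<exists>y\<in>\<Gamma>. y \<in> D01.mcball z r" using y(1) assms(1,2) by (auto simp: D01.mcball_def)
qed (rule assms(1))

section \<open>Compact level sets and the uniform gap\<close>

lemma energy_le_pointwise_limit:
  assumes "\<And>n. energy_le C (\<sigma> n)" "\<And>t. t \<in> {0..1} \<Longrightarrow> (\<lambda>n. \<sigma> n t) \<longlonglongrightarrow> x t"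
  shows "energy_le C x"
  unfolding energy_le_def
proof (intro allI impI)
  fix m :: nat and l r :: "nat \<Rightarrow> real"
  assume lr: "\<forall>i<m. 0 \<le> l i \<and> l i \<le> r i \<and> r i \<le> 1" and disj: "disjoint_family_on (\<lambda>i. {l i<..<r i}) {..<m}"
  have lim: "(\<lambda>n. \<Sum>i<m. (\<sigma> n (r i) - \<sigma> n (l i))\<^sup>2 / (r i - l i)) \<longlonglongrightarrow>
      (\<Sum>i<m. (x (r i) - x (l i))\<^sup>2 / (r i - l i))"
    unfolding divide_inverse
  proof (intro tendsto_sum tendsto_mult_right tendsto_power tendsto_diff)
    fix i assume "i \<in> {..<m}"
    then show "(\<lambda>n. \<sigma> n (r i)) \<longlonglongrightarrow> x (r i)" "(\<lambda>n. \<sigma> n (l i)) \<longlonglongrightarrow> x (l i)"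
      using lr by (auto intro!: assms(2) order_trans[of 0 "l i" "r i"] order_trans[of "l i" "r i" 1])
  qed
  show "(\<Sum>i<m. (x (r i) - x (l i))\<^sup>2 / (r i - l i)) \<le> C"
    by (rule LIMSEQ_le_const2[OF lim]) (use energy_leD[OF assms(1) _ disj] lr in auto)
qed

text \<open>The energy bound is a common Hoelder modulus of exponent 1/2, so Arzela-Ascoli yields a
  uniformly convergent subsequence, and \<open>energy_le_pointwise_limit\<close> keeps its limit in
  the level set.\<close>

lemma rate_fn_level_compact:
  "compactin D01_topology {x \<in> cadlag01. rate_fn x \<le> ereal \<alpha>}"
  unfolding D01.compactin_sequentially
proof (intro conjI allI impI)
  fix \<sigma> :: "nat \<Rightarrow> real \<Rightarrow> real" assume "range \<sigma> \<subseteq> {x \<in> cadlag01. rate_fn x \<le> ereal \<alpha>}"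
  then have \<sigma>: "\<sigma> n \<in> cadlag01" "\<sigma> n 0 = 0" "energy_le (2 * \<alpha>) (\<sigma> n)" for n
    by (auto simp: rate_fn_le_iff_energy)
  have \<alpha>: "2 * \<alpha> \<ge> 0" by (rule energy_le_nonneg[OF \<sigma>(3)])
  have inc: "\<bar>\<sigma> n t - \<sigma> n s\<bar> \<le> sqrt (2 * \<alpha> * \<bar>t - s\<bar>)" if "s \<in> {0..1}" "t \<in> {0..1}" for n s t
  proof -
    have "(\<sigma> n t - \<sigma> n s)\<^sup>2 \<le> 2 * \<alpha> * \<bar>t - s\<bar>"
      using energy_le_increment[OF \<sigma>(3), of s t n] energy_le_increment[OF \<sigma>(3), of t s n] that
      by (cases "s \<le> t") (auto simp: power2_commute)
    then show ?thesis using real_sqrt_le_mono by fastforce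
  qed
  obtain g k where g: "continuous_on {0..1} g" "strict_mono (k :: nat \<Rightarrow> nat)"
      "\<And>e. 0 < e \<Longrightarrow> \<exists>N. \<forall>n x. n \<ge> N \<and> x \<in> {0..1} \<longrightarrow> norm (\<sigma> (k n) x - g x) < e"
  proof (rule Arzela_Ascoli[of "{0..1::real}" \<sigma> "sqrt (2 * \<alpha>)"])
    show "norm (\<sigma> n x) \<le> sqrt (2 * \<alpha>)" if "x \<in> {0..1}" for n x
    proof -
      have "sqrt (2 * \<alpha> * \<bar>x - 0\<bar>) \<le> sqrt (2 * \<alpha>)"
        using that \<alpha> by (intro real_sqrt_le_mono mult_left_le) auto
      moreover have "\<bar>\<sigma> n x\<bar> \<le> sqrt (2 * \<alpha> * \<bar>x - 0\<bar>)"
        using inc[of 0 x n] that \<sigma>(2)[of n] by simp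
      ultimately show ?thesis unfolding real_norm_def by linarith
    qed
    show "\<exists>d>0. \<forall>n y. y \<in> {0..1} \<and> norm (x - y) < d \<longrightarrow> norm (\<sigma> n x - \<sigma> n y) < e"
      if x: "x \<in> {0..1}" "0 < e" for x e
    \<comment> \<open>The \<open>+ 1\<close> keeps the modulus positive when \<alpha> = 0.\<close>
    proof (intro exI[of _ "e\<^sup>2 / (2 * \<alpha> + 1)"] conjI allI impI)
      show "e\<^sup>2 / (2 * \<alpha> + 1) > 0" using x \<alpha> by simp
      fix n y assume y: "y \<in> {0..1} \<and> norm (x - y) < e\<^sup>2 / (2 * \<alpha> + 1)"
      have "2 * \<alpha> * \<bar>x - y\<bar> \<le> (2 * \<alpha> + 1) * \<bar>x - y\<bar>" by (intro mult_right_mono) auto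
      also have "\<dots> < e\<^sup>2" using y \<alpha> by (simp add: field_simps)
      finally have "sqrt (2 * \<alpha> * \<bar>x - y\<bar>) < e" using x(2) real_sqrt_less_mono by fastforce
      then show "norm (\<sigma> n x - \<sigma> n y) < e" using inc[of y x n] x y by simp
    qed
  qed auto
  define l where "l = restrict g {0..1}"
  have l: "l \<in> cadlag01" unfolding l_def by (rule continuous_cadlag01[OF g(1)])
  have conv: "\<exists>N. \<forall>n\<ge>N. \<forall>t\<in>{0..1}. \<bar>\<sigma> (k n) t - l t\<bar> < e" if e: "e > 0" for e
  proof -
    obtain N where "\<forall>n x. n \<ge> N \<and> x \<in> {0..1} \<longrightarrow> norm (\<sigma> (k n) x - g x) < e" using g(3)[OF e] by blast
    then show ?thesis by (intro exI[of _ N]) (auto simp: l_def)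
  qed
  have pt: "(\<lambda>n. \<sigma> (k n) t) \<longlonglongrightarrow> l t" if "t \<in> {0..1}" for t
    by (rule LIMSEQ_I) (use conv that in force)
  have "energy_le (2 * \<alpha>) l" by (rule energy_le_pointwise_limit[of _ "\<lambda>n. \<sigma> (k n)"]) (use \<sigma> pt in auto)
  moreover have "l 0 = 0" using pt[of 0] \<sigma>(2) LIMSEQ_unique[of "\<lambda>_. 0" 0 "l 0"] by simp
  moreover have "limitin D01_topology (\<sigma> \<circ> k) l sequentially"
    unfolding D01.limitin_metric
  proof (intro conjI allI impI l)
    fix e :: real assume "e > 0"
    then obtain N where N: "\<forall>n\<ge>N. \<forall>t\<in>{0..1}. \<bar>\<sigma> (k n) t - l t\<bar> < e / 2" using conv[of "e / 2"] by auto
    have "mdist D01_metric (\<sigma> (k n)) l < e" if "n \<ge> N" for n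
    proof -
      have "mdist D01_metric (\<sigma> (k n)) l \<le> e / 2"
        by (rule mdist_D01_le[OF \<sigma>(1) l]) (use N that in \<open>auto intro: less_imp_le\<close>)
      then show ?thesis using \<open>e > 0\<close> by simp
    qed
    then show "\<forall>\<^sub>F n in sequentially. (\<sigma> \<circ> k) n \<in> cadlag01 \<and> mdist D01_metric ((\<sigma> \<circ> k) n) l < e"
      using \<sigma>(1) by (auto simp: eventually_sequentially)
  qed
  ultimately show "\<exists>l r. l \<in> {x \<in> cadlag01. rate_fn x \<le> ereal \<alpha>} \<and> strict_mono r \<and> limitin D01_topology (\<sigma> \<circ> r) l sequentially"
    using l g(2) by (auto simp: rate_fn_le_iff_energy)
qed auto

lemma rate_fn_good:
  assumes "\<alpha> < \<infinity>"
  shows "compactin D01_topology {x \<in> cadlag01. rate_fn x \<le> \<alpha>}"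
proof (cases \<alpha>)
  case (real r)
  then show ?thesis by (simp add: rate_fn_level_compact)
next
  case MInf
  have "\<not> rate_fn x \<le> -\<infinity>" for x
  proof
    assume "rate_fn x \<le> -\<infinity>"
    then have "rate_fn x \<le> ereal (-1)" by simp
    then show False using energy_le_nonneg[of "2 * (-1)" x] by (simp only: rate_fn_le_iff_energy) simp
  qed
  then show ?thesis using MInf by simp
qed (use assms in auto)

text \<open>If no \<delta> worked, there would be paths of rate at most \<beta> arbitrarily close to
  \<Gamma>. By compactness a subsequence converges, and its limit lies in the closure of \<Gamma>
  with rate at most \<beta>.\<close>

lemma rate_fn_gap:
  assumes \<Gamma>: "\<Gamma> \<subseteq> cadlag01" and gap: "\<And>z. z \<in> D01_topology closure_of \<Gamma> \<Longrightarrow> rate_fn z > ereal \<beta>"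
  obtains \<delta> where "\<delta> > 0" "\<And>x y. x \<in> \<Gamma> \<Longrightarrow> y \<in> cadlag01 \<Longrightarrow> (\<And>t. t \<in> {0..1} \<Longrightarrow> \<bar>y t - x t\<bar> \<le> \<delta>) \<Longrightarrow> rate_fn y > ereal \<beta>"
proof (rule ccontr)
  assume "\<not> thesis"
  then have "\<exists>x y. x \<in> \<Gamma> \<and> y \<in> cadlag01 \<and> (\<forall>t\<in>{0..1}. \<bar>y t - x t\<bar> \<le> inverse (real (Suc n))) \<and> rate_fn y \<le> ereal \<beta>" for n
    using that[of "inverse (real (Suc n))"] by (meson inverse_positive_iff_positive not_le of_nat_0_less_iff zero_less_Suc)
  then obtain X Y where XY: "\<And>n. X n \<in> \<Gamma>" "\<And>n. Y n \<in> cadlag01" "\<And>n t. t \<in> {0..1} \<Longrightarrow> \<bar>Y n t - X n t\<bar> \<le> inverse (real (Suc n))"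
      "\<And>n. rate_fn (Y n) \<le> ereal \<beta>" by metis
  have "range Y \<subseteq> {x \<in> cadlag01. rate_fn x \<le> ereal \<beta>}" using XY by auto
  then obtain l r where l: "l \<in> cadlag01" "rate_fn l \<le> ereal \<beta>" and r: "strict_mono (r :: nat \<Rightarrow> nat)"
      and lim: "limitin D01_topology (Y \<circ> r) l sequentially"
    using rate_fn_level_compact[of \<beta>] unfolding D01.compactin_sequentially by blast
  have "l \<in> D01_topology closure_of \<Gamma>"
  proof (rule closure_of_D01I[OF l(1) \<Gamma>])
    fix \<delta> :: real assume \<delta>: "\<delta> > 0"
    have "\<forall>\<^sub>F n in sequentially. (Y \<circ> r) n \<in> cadlag01 \<and> mdist D01_metric ((Y \<circ> r) n) l < \<delta> / 2"
      using lim \<delta> unfolding D01.limitin_metric by (meson half_gt_zero)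
    then have "\<forall>\<^sub>F n in sequentially. mdist D01_metric ((Y \<circ> r) n) l < \<delta> / 2"
      by (rule eventually_mono) simp
    moreover have "\<forall>\<^sub>F n in sequentially. inverse (real (Suc n)) < \<delta> / 2"
      using LIMSEQ_inverse_real_of_nat \<delta> by (intro order_tendstoD) auto
    ultimately have "\<forall>\<^sub>F n in sequentially. mdist D01_metric ((Y \<circ> r) n) l < \<delta> / 2 \<and> inverse (real (Suc n)) < \<delta> / 2"
      by (rule eventually_conj)
    then obtain n where n: "mdist D01_metric (Y (r n)) l < \<delta> / 2" "inverse (real (Suc n)) < \<delta> / 2"
      by (auto simp: eventually_sequentially)
    have "inverse (real (Suc (r n))) \<le> inverse (real (Suc n))"
      using seq_suble[OF r, of n] by (intro le_imp_inverse_le) auto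
    then have "\<bar>X (r n) t - l t\<bar> \<le> \<delta>" if "t \<in> {0..1}" for t
      using XY(3)[OF that, of "r n"] abs_diff_le_mdist_D01[OF XY(2)[of "r n"] l(1) that] n by linarith
    then show "\<exists>y\<in>\<Gamma>. \<forall>t\<in>{0..1}. \<bar>y t - l t\<bar> \<le> \<delta>" using XY(1) by blast
  qed
  then show False using gap l(2) by (simp add: not_less[symmetric])
qed

section \<open>The step process: index, regularity, measurability\<close>

text \<open>Counting yields the largest index whose time is at most \<open>t\<close>, also when
  vanishing coefficients make several times coincide.\<close>

definition W_index :: "(nat \<Rightarrow> nat) \<Rightarrow> (nat \<Rightarrow> nat \<Rightarrow> real) \<Rightarrow> real \<Rightarrow> nat \<Rightarrow> real \<Rightarrow> nat" where
  "W_index k c \<sigma> n t = card {i \<in> {1..k n}. s_sq \<sigma> c n i / s_sq \<sigma> c n (k n) \<le> t}"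

lemma W_index_props:
  assumes pos: "s_sq \<sigma> c n (k n) > 0" and t: "0 \<le> t" "t \<le> 1"
  shows "W_index k c \<sigma> n t \<le> k n" "s_sq \<sigma> c n (W_index k c \<sigma> n t) / s_sq \<sigma> c n (k n) \<le> t"
    "W_index k c \<sigma> n t < k n \<Longrightarrow> t < s_sq \<sigma> c n (Suc (W_index k c \<sigma> n t)) / s_sq \<sigma> c n (k n)"
    "t = 1 \<Longrightarrow> W_index k c \<sigma> n t = k n" "t < 1 \<Longrightarrow> W_index k c \<sigma> n t < k n"
proof -
  define T where "T = (\<lambda>j. s_sq \<sigma> c n j / s_sq \<sigma> c n (k n))"
  have mono: "T j \<le> T j'" if "j \<le> j'" for j j'
    unfolding T_def using that pos by (intro divide_right_mono s_sq_mono) auto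
  have T0: "T 0 = 0" "T (k n) = 1" using pos by (auto simp: T_def s_sq_def)
  let ?A = "{i \<in> {1..k n}. T i \<le> t}"
  have idx: "W_index k c \<sigma> n t = card ?A" by (simp add: W_index_def T_def)
  have "\<exists>m\<le>k n. ?A = {1..m} \<and> T m \<le> t \<and> (m < k n \<longrightarrow> t < T (Suc m))"
  proof (cases "\<exists>i\<in>{1..k n}. t < T i")
    case False
    then have "T i \<le> t" if "i \<in> {1..k n}" for i using that by force
    moreover have "T (k n) \<le> t" using calculation[of "k n"] T0 t by (cases "k n = 0") auto
    ultimately show ?thesis by (intro exI[of _ "k n"]) auto
  next
    case True
    define p where "p = (LEAST i. i \<in> {1..k n} \<and> t < T i)"
    have "\<exists>i. i \<in> {1..k n} \<and> t < T i" using True by blast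
    then have "p \<in> {1..k n} \<and> t < T p" unfolding p_def by (rule LeastI_ex)
    then have p: "p \<in> {1..k n}" "t < T p" by simp_all
    have less: "T i \<le> t" if "i \<in> {1..k n}" "i < p" for i
      using not_less_Least[of i "\<lambda>i. i \<in> {1..k n} \<and> t < T i"] that by (auto simp: p_def)
    have "T (p - 1) \<le> t"
    proof (cases "p = 1")
      case True
      then show ?thesis using T0 t by simp
    next
      case False
      then show ?thesis using p(1) by (intro less) auto
    qed
    moreover have "?A = {1..p - 1}"
    proof (intro set_eqI iffI)
      fix i assume i: "i \<in> ?A"
      have "\<not> p \<le> i" using mono[of p i] p(2) i by auto
      then show "i \<in> {1..p - 1}" using i by auto
    next
      fix i assume "i \<in> {1..p - 1}"
      then have "i \<in> {1..k n}" "i < p" using p(1) by auto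
      then show "i \<in> ?A" using less by simp
    qed
    moreover have "p - 1 \<le> k n" "Suc (p - 1) = p" using p(1) by auto
    ultimately show ?thesis using p(2) by (intro exI[of _ "p - 1"]) simp
  qed
  then obtain m where m: "m \<le> k n" "?A = {1..m}" "T m \<le> t" "m < k n \<Longrightarrow> t < T (Suc m)" by blast
  have im: "W_index k c \<sigma> n t = m" unfolding idx m(2) by simp
  show "W_index k c \<sigma> n t \<le> k n" "s_sq \<sigma> c n (W_index k c \<sigma> n t) / s_sq \<sigma> c n (k n) \<le> t"
    "W_index k c \<sigma> n t < k n \<Longrightarrow> t < s_sq \<sigma> c n (Suc (W_index k c \<sigma> n t)) / s_sq \<sigma> c n (k n)"
    unfolding im using m by (simp_all add: T_def)
  show "W_index k c \<sigma> n t = k n" if "t = 1"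
  proof -
    have "T i \<le> 1" if "i \<le> k n" for i using mono[OF that] T0 by simp
    then have "?A = {1..k n}" using \<open>t = 1\<close> by auto
    then show ?thesis unfolding idx by simp
  qed
  show "W_index k c \<sigma> n t < k n" if "t < 1"
    unfolding im using m(1,3) T0 \<open>t < 1\<close> by (cases "m = k n") auto
qed

text \<open>One formula includes \<open>t = 1\<close>: every time is at most 1, so the count there
  is \<open>k n\<close>.\<close>

lemma W_proc_eq_index:
  assumes pos: "s_sq \<sigma> c n (k n) > 0" and t: "t \<in> {0..1}"
  shows "W_proc k c \<sigma> \<xi> n \<omega> t = partial_sum c \<xi> n (W_index k c \<sigma> n t) \<omega> / sqrt (s_sq \<sigma> c n (k n))"
proof (cases "t = 1")
  case True
  then show ?thesis using W_proc_1[where c = c and k = k, OF pos] W_index_props(4)[where c = c and k = k, OF pos, of t] by simp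
next
  case False
  note P = W_index_props[where c = c and k = k, OF pos, of t]
  have "Suc (W_index k c \<sigma> n t) \<in> {1..k n}" using P(5) t False by auto
  from W_proc_eq[where c = c and k = k, OF pos this, of t] P t False show ?thesis by simp
qed

text \<open>The value at \<open>u\<close> is a function of the finite set of indices with time at
  most \<open>u\<close>. This set is eventually constant on either side of \<open>t\<close>; from
  the left it is the set of indices with time strictly below \<open>t\<close>.\<close>

lemma W_proc_cadlag01:
  assumes pos: "s_sq \<sigma> c n (k n) > 0"
  shows "W_proc k c \<sigma> \<xi> n \<omega> \<in> cadlag01"
proof -
  define T where "T = (\<lambda>j. s_sq \<sigma> c n j / s_sq \<sigma> c n (k n))"
  let ?W = "W_proc k c \<sigma> \<xi> n \<omega>"
  define f where "f A = partial_sum c \<xi> n (card A) \<omega> / sqrt (s_sq \<sigma> c n (k n))" for A :: "nat set"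
  have W: "?W t = f {i \<in> {1..k n}. T i \<le> t}" if "t \<in> {0..1}" for t
    using W_proc_eq_index[where c = c and k = k, OF pos that] by (simp add: f_def W_index_def T_def)
  have "(?W \<longlongrightarrow> ?W t) (at_right t)" if t: "t \<in> {0..<1}" for t
  proof -
    have "\<forall>\<^sub>F u in at_right t. \<forall>i\<in>{1..k n}. T i \<le> u \<longleftrightarrow> T i \<le> t"
    proof (rule eventually_ball_finite)
      show "\<forall>i\<in>{1..k n}. \<forall>\<^sub>F u in at_right t. (T i \<le> u) = (T i \<le> t)"
      proof
        fix i
        show "\<forall>\<^sub>F u in at_right t. (T i \<le> u) = (T i \<le> t)"
        proof (cases "T i \<le> t")
          case True
          have "\<forall>\<^sub>F u in at_right t. u \<in> {t<..<t + 1}" by (intro eventually_at_right_real) auto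
          then show ?thesis by eventually_elim (use True in auto)
        next
          case False
          then have "\<forall>\<^sub>F u in at_right t. u \<in> {t<..<T i}" by (intro eventually_at_right_real) auto
          then show ?thesis by eventually_elim (use False in auto)
        qed
      qed
    qed simp
    moreover have "\<forall>\<^sub>F u in at_right t. u \<in> {t<..<1}" using t by (intro eventually_at_right_real) auto
    ultimately have "\<forall>\<^sub>F u in at_right t. ?W t = ?W u"
    proof eventually_elim
      case (elim u)
      then have "{i \<in> {1..k n}. T i \<le> u} = {i \<in> {1..k n}. T i \<le> t}" by auto
      then show ?case using W[of u] W[of t] elim t by auto
    qed
    then show ?thesis by (rule Lim_transform_eventually[OF tendsto_const])
  qed
  moreover have "(?W \<longlongrightarrow> f {i \<in> {1..k n}. T i < t}) (at_left t)" if t: "t \<in> {0<..1}" for t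
  proof -
    have "\<forall>\<^sub>F u in at_left t. \<forall>i\<in>{1..k n}. T i \<le> u \<longleftrightarrow> T i < t"
    proof (rule eventually_ball_finite)
      show "\<forall>i\<in>{1..k n}. \<forall>\<^sub>F u in at_left t. (T i \<le> u) = (T i < t)"
      proof
        fix i
        show "\<forall>\<^sub>F u in at_left t. (T i \<le> u) = (T i < t)"
        proof (cases "T i < t")
          case True
          then have "\<forall>\<^sub>F u in at_left t. u \<in> {T i<..<t}" by (intro eventually_at_left_real) auto
          then show ?thesis by eventually_elim (use True in auto)
        next
          case False
          have "\<forall>\<^sub>F u in at_left t. u \<in> {t - 1<..<t}" by (intro eventually_at_left_real) auto
          then show ?thesis by eventually_elim (use False in auto)
        qed
      qed
    qed simp
    moreover have "\<forall>\<^sub>F u in at_left t. u \<in> {0<..<t}" using t by (intro eventually_at_left_real) auto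
    ultimately have "\<forall>\<^sub>F u in at_left t. f {i \<in> {1..k n}. T i < t} = ?W u"
    proof eventually_elim
      case (elim u)
      then have "{i \<in> {1..k n}. T i \<le> u} = {i \<in> {1..k n}. T i < t}" by auto
      then show ?case using W[of u] elim t by auto
    qed
    then show ?thesis by (rule Lim_transform_eventually[OF tendsto_const])
  qed
  moreover have "?W \<in> extensional {0..1}" by (simp add: W_proc_def)
  ultimately show ?thesis unfolding cadlag01_def by blast
qed

text \<open>Measurability of the coordinates would not suffice for these Borel sets. Instead the
  path is a function \<Phi> of finitely many variables, Lipschitz into the uniform metric, so
  preimages of open sets are open in the product topology of the sequence space.\<close>

lemma W_proc_measurable:
  assumes pos: "s_sq \<sigma> c n (k n) > 0" and \<xi>: "\<And>j. \<xi> j \<in> borel_measurable M"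
  shows "W_proc k c \<sigma> \<xi> n \<in> M \<rightarrow>\<^sub>M D01_borel"
proof (rule measurable_sigma_sets[OF sets_D01_borel])
  define \<Phi> where "\<Phi> v = W_proc k c \<sigma> (\<lambda>j v. v (nat j)) n v" for v :: "nat \<Rightarrow> real"
  define s where "s = sqrt (s_sq \<sigma> c n (k n))"
  have s: "s > 0" using pos by (simp add: s_def)
  have W: "W_proc k c \<sigma> \<xi> n \<omega> = \<Phi> (\<lambda>j. \<xi> (int j) \<omega>)" for \<omega>
    by (simp add: \<Phi>_def W_proc_def partial_sum_def)
  have \<Phi>: "\<Phi> v \<in> cadlag01" for v
    unfolding \<Phi>_def by (rule W_proc_cadlag01[where c = c and k = k, OF pos])
  have diff: "\<bar>\<Phi> v t - \<Phi> w t\<bar> \<le> (\<Sum>j=1..k n. \<bar>c n j\<bar> * \<bar>v j - w j\<bar>) / s" if t: "t \<in> {0..1}" for v w t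
  proof -
    let ?i = "W_index k c \<sigma> n t"
    have "\<Phi> v t - \<Phi> w t = (\<Sum>j=1..?i. c n j * (v j - w j)) / s"
      unfolding \<Phi>_def W_proc_eq_index[where c = c and k = k, OF pos t]
      by (simp add: partial_sum_def s_def diff_divide_distrib[symmetric] sum_subtractf[symmetric] right_diff_distrib)
    also have "\<bar>\<dots>\<bar> \<le> (\<Sum>j=1..?i. \<bar>c n j * (v j - w j)\<bar>) / s"
      using s by (simp add: divide_right_mono)
    also have "\<dots> \<le> (\<Sum>j=1..k n. \<bar>c n j\<bar> * \<bar>v j - w j\<bar>) / s"
    proof (rule divide_right_mono)
      show "(\<Sum>j=1..?i. \<bar>c n j * (v j - w j)\<bar>) \<le> (\<Sum>j=1..k n. \<bar>c n j\<bar> * \<bar>v j - w j\<bar>)"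
        unfolding abs_mult using W_index_props(1)[where c = c and k = k, OF pos, of t] t
        by (intro sum_mono2) auto
    qed (use s in simp)
    finally show ?thesis .
  qed
  have op: "open (\<Phi> -` U)" if U: "openin D01_topology U" for U
    unfolding open_subopen[of "\<Phi> -` U"]
  proof
    fix v assume "v \<in> \<Phi> -` U"
    then obtain \<delta> where \<delta>: "\<delta> > 0" "\<And>y. y \<in> cadlag01 \<Longrightarrow> (\<And>t. t \<in> {0..1} \<Longrightarrow> \<bar>y t - \<Phi> v t\<bar> \<le> \<delta>) \<Longrightarrow> y \<in> U"
      using openin_D01_uniform_nbhd[OF U, of "\<Phi> v"] by auto
    let ?V = "{w. (\<Sum>j=1..k n. \<bar>c n j\<bar> * \<bar>w j - v j\<bar>) / s < \<delta>}"
    have "open ?V"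
      by (intro open_Collect_less continuous_intros continuous_on_product_coordinates) (use s in auto)
    moreover have "v \<in> ?V" using \<delta> by simp
    moreover have "?V \<subseteq> \<Phi> -` U"
    proof
      fix w assume "w \<in> ?V"
      then have "\<Phi> w \<in> U" using diff[of _ w v] by (intro \<delta>(2) \<Phi>) fastforce
      then show "w \<in> \<Phi> -` U" by simp
    qed
    ultimately show "\<exists>T. open T \<and> v \<in> T \<and> T \<subseteq> \<Phi> -` U" by blast
  qed
  show "{U. openin D01_topology U} \<subseteq> Pow cadlag01" using openin_subset[of D01_topology] by auto
  show "W_proc k c \<sigma> \<xi> n \<in> space M \<rightarrow> cadlag01" using W_proc_cadlag01[where c = c and k = k, OF pos] by auto
  fix U assume "U \<in> {U. openin D01_topology U}"
  then have "open (\<Phi> -` U)" using op by simp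
  moreover have "(\<lambda>\<omega> j. \<xi> (int j) \<omega>) \<in> borel_measurable M"
    by (rule measurable_coordinatewise_then_product) (rule \<xi>)
  ultimately have "(\<lambda>\<omega> j. \<xi> (int j) \<omega>) -` (\<Phi> -` U) \<inter> space M \<in> sets M"
    by (meson borel_open measurable_sets)
  also have "(\<lambda>\<omega> j. \<xi> (int j) \<omega>) -` (\<Phi> -` U) \<inter> space M = W_proc k c \<sigma> \<xi> n -` U \<inter> space M"
    by (auto simp: W)
  finally show "W_proc k c \<sigma> \<xi> n -` U \<inter> space M \<in> sets M" .
qed

text \<open>Moves the factor into the variables, so that the lemmas on \<open>W_proc\<close> apply
  to the scaled path.\<close>

lemma W_proc_scale:
  "(\<lambda>t\<in>{0..1}. b * W_proc k c \<sigma> \<xi> n \<omega> t) = W_proc k c \<sigma> (\<lambda>j \<omega>. b * \<xi> j \<omega>) n \<omega>"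
proof -
  have "partial_sum c (\<lambda>j \<omega>. b * \<xi> j \<omega>) n i \<omega> = b * partial_sum c \<xi> n i \<omega>" for i
    by (simp add: partial_sum_def sum_distrib_left mult_ac)
  then show ?thesis
    by (simp add: W_proc_def Let_def sum_distrib_left algebra_simps cong: restrict_cong)
qed

section \<open>Independent sums, tilted measures and moment generating functions\<close>

lemma (in prob_space) indep_vars_reindex_inj:
  assumes "inj f" "indep_vars (\<lambda>_. N) X UNIV"
  shows "indep_vars (\<lambda>_. N) (\<lambda>i. X (f i)) UNIV"
  unfolding indep_vars_def2
proof (intro conjI)
  show "\<forall>i\<in>UNIV. random_variable N (X (f i))" using assms(2) by (auto simp: indep_vars_def2)
  let ?F = "\<lambda>i. {X i -` A \<inter> space M |A. A \<in> sets N}"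
  have F: "indep_sets ?F UNIV" using assms(2) by (simp add: indep_vars_def2)
  show "indep_sets (\<lambda>i. ?F (f i)) UNIV"
  proof (rule indep_setsI)
    show "?F (f i) \<subseteq> events" for i using F by (auto simp: indep_sets_def)
    fix A J assume J: "J \<noteq> {}" "finite J" "\<forall>j\<in>J. A j \<in> ?F (f j)"
    define A' where "A' i = A (the_inv f i)" for i
    have A': "A' (f j) = A j" for j using assms(1) by (simp add: A'_def the_inv_f_f)
    have inj: "inj_on f J" using assms(1) inj_on_subset by blast
    have "prob (\<Inter>i\<in>f ` J. A' i) = (\<Prod>i\<in>f ` J. prob (A' i))"
      by (rule indep_setsD[OF F]) (use J A' in auto)
    then show "prob (\<Inter>j\<in>J. A j) = (\<Prod>j\<in>J. prob (A j))"
      by (simp add: A' prod.reindex[OF inj])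
  qed
qed

text \<open>Centring is not required, so the same inequality serves under the original and under the tilted law.\<close>

theorem (in prob_space) Etemadi_inequality:
  fixes X :: "nat \<Rightarrow> 'a \<Rightarrow> real"
  assumes indep: "indep_vars (\<lambda>_. borel) X {1..n}"
    and p: "\<And>l. l \<le> n \<Longrightarrow> prob {\<omega> \<in> space M. x \<le> \<bar>\<Sum>j=1..l. X j \<omega>\<bar>} \<le> p"
  shows "prob {\<omega> \<in> space M. \<exists>l\<le>n. 3 * x \<le> \<bar>\<Sum>j=1..l. X j \<omega>\<bar>} \<le> 3 * p"
proof -
  have rv: "X j \<in> borel_measurable M" if "j \<in> {1..n}" for j
    using indep that by (auto simp: indep_vars_def2)
  define S where "S l \<omega> = (\<Sum>j=1..l. X j \<omega>)" for l \<omega>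
  have S[measurable]: "S l \<in> borel_measurable M" if "l \<le> n" for l
    unfolding S_def[abs_def] by (intro borel_measurable_sum rv) (use that in auto)
  \<comment> \<open>The level \<open>3 * x\<close> is reached at time \<open>l\<close> for the first
    time. This event depends only on the first \<open>l\<close> variables, hence is independent of
    \<open>S n - S l\<close>.\<close>
  define A where "A l = {\<omega> \<in> space M. 3 * x \<le> \<bar>S l \<omega>\<bar> \<and> (\<forall>i<l. \<bar>S i \<omega>\<bar> < 3 * x)}" for l
  have A_meas: "A l \<in> events" if "l \<le> n" for l
  proof -
    have "S i \<in> borel_measurable M" if "i \<le> l" for i using S \<open>l \<le> n\<close> that by auto
    then show ?thesis unfolding A_def by measurable
  qed
  have A_disj: "disjoint_family_on A {..n}"
    unfolding disjoint_family_on_def A_def by (auto simp: not_less dest!: linorder_neq_iff[THEN iffD1])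
  let ?U = "{\<omega> \<in> space M. \<exists>l\<le>n. 3 * x \<le> \<bar>S l \<omega>\<bar>}"
  have U: "?U = (\<Union>l\<in>{..n}. A l)"
  proof (intro set_eqI iffI)
    fix \<omega> assume \<omega>: "\<omega> \<in> ?U"
    define l where "l = (LEAST l. 3 * x \<le> \<bar>S l \<omega>\<bar>)"
    have "\<exists>l. 3 * x \<le> \<bar>S l \<omega>\<bar>" using \<omega> by blast
    then have 1: "3 * x \<le> \<bar>S l \<omega>\<bar>" unfolding l_def by (rule LeastI_ex)
    have 2: "\<bar>S i \<omega>\<bar> < 3 * x" if "i < l" for i
      using not_less_Least[of i "\<lambda>l. 3 * x \<le> \<bar>S l \<omega>\<bar>"] that by (auto simp: l_def)
    have "l \<le> n" using \<omega> Least_le[of "\<lambda>l. 3 * x \<le> \<bar>S l \<omega>\<bar>"] unfolding l_def by fastforce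
    then show "\<omega> \<in> (\<Union>l\<in>{..n}. A l)" using \<omega> 1 2 by (auto simp: A_def)
  qed (auto simp: A_def)
  have p': "prob {\<omega> \<in> space M. x \<le> \<bar>S l \<omega>\<bar>} \<le> p" if "l \<le> n" for l using p[OF that] by (simp add: S_def)
  have p0: "p \<ge> 0" using p'[of 0] measure_nonneg order_trans by blast
  \<comment> \<open>After \<open>3 * x\<close> has been reached at time \<open>l\<close>, either the
    final sum is still at least \<open>x\<close> in absolute value or it differs from
    \<open>S l\<close> by more than \<open>2 * x\<close>.\<close>
  let ?B = "\<lambda>l. {\<omega> \<in> space M. 2 * x < \<bar>S n \<omega> - S l \<omega>\<bar>}"
  have B: "prob (A l \<inter> ?B l) \<le> prob (A l) * (2 * p)" if l: "l \<le> n" for l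
  proof -
    let ?V = "\<lambda>J \<omega>. restrict (\<lambda>i. X i \<omega>) J"
    have iv: "indep_var (PiM {1..l} (\<lambda>_. borel)) (?V {1..l}) (PiM {Suc l..n} (\<lambda>_. borel)) (?V {Suc l..n})"
      by (rule indep_var_restrict[OF indep]) (use l in auto)
    define A' where "A' = {v \<in> space (PiM {1..l} (\<lambda>_. borel :: real measure)).
        3 * x \<le> \<bar>\<Sum>j=1..l. v j\<bar> \<and> (\<forall>i<l. \<bar>\<Sum>j=1..i. v j\<bar> < 3 * x)}"
    define B' where "B' = {v \<in> space (PiM {Suc l..n} (\<lambda>_. borel :: real measure)). 2 * x < \<bar>\<Sum>j=Suc l..n. v j\<bar>}"
    have m1: "(\<lambda>v. \<Sum>j=1..i. v j) \<in> borel_measurable (PiM {1..l} (\<lambda>_. borel :: real measure))" if "i \<le> l" for i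
      by (intro borel_measurable_sum measurable_component_singleton) (use that in auto)
    have "A' \<in> sets (PiM {1..l} (\<lambda>_. borel))" unfolding A'_def using m1 by measurable
    moreover have "(\<lambda>v. \<Sum>j=Suc l..n. v j) \<in> borel_measurable (PiM {Suc l..n} (\<lambda>_. borel :: real measure))"
      by (intro borel_measurable_sum measurable_component_singleton) auto
    then have "B' \<in> sets (PiM {Suc l..n} (\<lambda>_. borel))" unfolding B'_def by measurable
    ultimately have "prob ((\<lambda>\<omega>. (?V {1..l} \<omega>, ?V {Suc l..n} \<omega>)) -` (A' \<times> B') \<inter> space M) =
        prob (?V {1..l} -` A' \<inter> space M) * prob (?V {Suc l..n} -` B' \<inter> space M)"
      by (rule indep_varD[OF iv])
    moreover have eA: "?V {1..l} -` A' \<inter> space M = A l"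
      by (auto simp: A'_def A_def S_def space_PiM)
    moreover have eB: "?V {Suc l..n} -` B' \<inter> space M = ?B l"
    proof -
      have "S n \<omega> - S l \<omega> = (\<Sum>j=Suc l..n. X j \<omega>)" for \<omega>
        unfolding S_def using sum.ub_add_nat[of 1 l "\<lambda>j. X j \<omega>" "n - l"] l by simp
      then show ?thesis by (auto simp: B'_def space_PiM)
    qed
    moreover have "(\<lambda>\<omega>. (?V {1..l} \<omega>, ?V {Suc l..n} \<omega>)) -` (A' \<times> B') \<inter> space M = A l \<inter> ?B l"
      unfolding eA[symmetric] eB[symmetric] by auto
    ultimately have "prob (A l \<inter> ?B l) = prob (A l) * prob (?B l)" by simp
    \<comment> \<open>A difference above \<open>2 * x\<close> forces one of the two sums to be at
      least \<open>x\<close> in absolute value.\<close>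
    moreover have "prob (?B l) \<le> 2 * p"
    proof -
      have "prob (?B l) \<le> prob ({\<omega> \<in> space M. x \<le> \<bar>S n \<omega>\<bar>} \<union> {\<omega> \<in> space M. x \<le> \<bar>S l \<omega>\<bar>})"
        using S l by (intro finite_measure_mono) auto
      also have "\<dots> \<le> prob {\<omega> \<in> space M. x \<le> \<bar>S n \<omega>\<bar>} + prob {\<omega> \<in> space M. x \<le> \<bar>S l \<omega>\<bar>}"
        using S l by (intro measure_Un_le) auto
      finally show ?thesis using p'[of n] p'[OF l] by simp
    qed
    ultimately show ?thesis by (simp add: mult_left_mono)
  qed
  have "prob ?U \<le> prob ({\<omega> \<in> space M. x \<le> \<bar>S n \<omega>\<bar>} \<union> (\<Union>l\<in>{..n}. A l \<inter> ?B l))"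
  proof (rule finite_measure_mono)
    show "?U \<subseteq> {\<omega> \<in> space M. x \<le> \<bar>S n \<omega>\<bar>} \<union> (\<Union>l\<in>{..n}. A l \<inter> ?B l)"
      unfolding U by (auto simp: A_def)
    show "{\<omega> \<in> space M. x \<le> \<bar>S n \<omega>\<bar>} \<union> (\<Union>l\<in>{..n}. A l \<inter> ?B l) \<in> events"
      using S A_meas by (intro sets.Un sets.finite_UN sets.Int) auto
  qed
  also have "\<dots> \<le> prob {\<omega> \<in> space M. x \<le> \<bar>S n \<omega>\<bar>} + prob (\<Union>l\<in>{..n}. A l \<inter> ?B l)"
    using S A_meas by (intro measure_Un_le sets.finite_UN sets.Int) auto
  also have "prob (\<Union>l\<in>{..n}. A l \<inter> ?B l) \<le> (\<Sum>l\<in>{..n}. prob (A l \<inter> ?B l))"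
    using S A_meas by (intro finite_measure_subadditive_finite) auto
  also have "\<dots> \<le> (\<Sum>l\<in>{..n}. prob (A l) * (2 * p))" by (intro sum_mono B) auto
  also have "\<dots> = prob (\<Union>l\<in>{..n}. A l) * (2 * p)"
    using A_meas A_disj by (subst finite_measure_finite_Union) (auto simp: sum_distrib_right)
  also have "\<dots> \<le> 1 * (2 * p)" using p0 by (intro mult_right_mono) auto
  finally show ?thesis using p'[of n] by (simp add: S_def)
qed

text \<open>Second moments of independent centred variables add, because the mixed term factors into
  vanishing means. Bounds \<open>v i\<close> in place of exact values suit the tilted law.\<close>

lemma (in prob_space) indep_centered_sum_Chebyshev:
  fixes X :: "'i \<Rightarrow> 'a \<Rightarrow> real"
  assumes I: "finite I" and indep: "indep_vars (\<lambda>_. borel) X I"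
    and X: "\<And>i. i \<in> I \<Longrightarrow> integrable M (X i)" "\<And>i. i \<in> I \<Longrightarrow> integrable M (\<lambda>\<omega>. (X i \<omega>)\<^sup>2)"
      "\<And>i. i \<in> I \<Longrightarrow> expectation (X i) = 0" "\<And>i. i \<in> I \<Longrightarrow> expectation (\<lambda>\<omega>. (X i \<omega>)\<^sup>2) \<le> v i"
    and t: "t > 0"
  shows "prob {\<omega> \<in> space M. t \<le> \<bar>\<Sum>i\<in>I. X i \<omega>\<bar>} \<le> (\<Sum>i\<in>I. v i) / t\<^sup>2"
proof -
  have "integrable M (\<lambda>\<omega>. (\<Sum>i\<in>I. X i \<omega>)\<^sup>2) \<and> expectation (\<lambda>\<omega>. (\<Sum>i\<in>I. X i \<omega>)\<^sup>2) \<le> (\<Sum>i\<in>I. v i)"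
    using I indep X
  proof (induction I)
    case (insert i I)
    let ?S = "\<lambda>\<omega>. \<Sum>i\<in>I. X i \<omega>"
    have "indep_vars (\<lambda>_. borel) X I" using indep_vars_subset[OF insert.prems(1), of I] by auto
    then have IH: "integrable M (\<lambda>\<omega>. (?S \<omega>)\<^sup>2)" "expectation (\<lambda>\<omega>. (?S \<omega>)\<^sup>2) \<le> (\<Sum>i\<in>I. v i)"
      using insert.IH insert.prems by auto
    have iv: "indep_var borel (X i) borel ?S"
      using insert by (intro indep_vars_sum) auto
    have Sint: "integrable M ?S" using insert.prems by (intro Bochner_Integration.integrable_sum) auto
    have XS: "integrable M (\<lambda>\<omega>. X i \<omega> * ?S \<omega>)" "expectation (\<lambda>\<omega>. X i \<omega> * ?S \<omega>) = 0"
      using indep_var_integrable[OF iv _ Sint] indep_var_lebesgue_integral[OF iv _ Sint] insert.prems by auto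
    have eq: "(\<Sum>i\<in>insert i I. X i \<omega>)\<^sup>2 = (X i \<omega>)\<^sup>2 + 2 * (X i \<omega> * ?S \<omega>) + (?S \<omega>)\<^sup>2" for \<omega>
      using insert.hyps by (simp add: power2_eq_square algebra_simps)
    have Xi: "integrable M (\<lambda>\<omega>. (X i \<omega>)\<^sup>2)" "expectation (\<lambda>\<omega>. (X i \<omega>)\<^sup>2) \<le> v i" using insert.prems by auto
    have "expectation (\<lambda>\<omega>. (X i \<omega>)\<^sup>2 + 2 * (X i \<omega> * ?S \<omega>) + (?S \<omega>)\<^sup>2) =
        expectation (\<lambda>\<omega>. (X i \<omega>)\<^sup>2) + 2 * expectation (\<lambda>\<omega>. X i \<omega> * ?S \<omega>) + expectation (\<lambda>\<omega>. (?S \<omega>)\<^sup>2)"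
      using XS(1) IH(1) Xi(1) by simp
    then show ?case unfolding eq using XS IH Xi insert.hyps by simp
  qed simp
  then have int: "integrable M (\<lambda>\<omega>. (\<Sum>i\<in>I. X i \<omega>)\<^sup>2)" and le: "expectation (\<lambda>\<omega>. (\<Sum>i\<in>I. X i \<omega>)\<^sup>2) \<le> (\<Sum>i\<in>I. v i)" by auto
  have "prob {\<omega> \<in> space M. t \<le> \<bar>\<Sum>i\<in>I. X i \<omega>\<bar>} = prob {\<omega> \<in> space M. t\<^sup>2 \<le> (\<Sum>i\<in>I. X i \<omega>)\<^sup>2}"
    using t by (intro arg_cong[where f = prob] Collect_cong conj_cong refl) (metis abs_le_square_iff abs_of_pos)
  also have "\<dots> \<le> expectation (\<lambda>\<omega>. (\<Sum>i\<in>I. X i \<omega>)\<^sup>2) / t\<^sup>2"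
    using t by (intro integral_Markov_inequality_measure[OF int, of "{}"]) auto
  also have "\<dots> \<le> (\<Sum>i\<in>I. v i) / t\<^sup>2" using le by (intro divide_right_mono) auto
  finally show ?thesis .
qed

section \<open>Product change of measure\<close>

text \<open>A density on the original sample space: the events and the variables are kept and only
  their probabilities change.\<close>

definition tilted :: "'a measure \<Rightarrow> ('i \<Rightarrow> 'a \<Rightarrow> real) \<Rightarrow> ('i \<Rightarrow> real \<Rightarrow> real) \<Rightarrow> 'i set \<Rightarrow> 'a measure" where
  "tilted M X f I = density M (\<lambda>\<omega>. ennreal (\<Prod>i\<in>I. f i (X i \<omega>)))"

context prob_space
begin

context
  fixes X :: "'i \<Rightarrow> 'a \<Rightarrow> real" and f :: "'i \<Rightarrow> real \<Rightarrow> real" and I :: "'i set"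
  assumes I: "finite I" and indep: "indep_vars (\<lambda>_. borel) X I"
    and f_meas: "\<And>i. i \<in> I \<Longrightarrow> f i \<in> borel_measurable borel" and f_nonneg: "\<And>i x. i \<in> I \<Longrightarrow> 0 \<le> f i x"
    and f_int: "\<And>i. i \<in> I \<Longrightarrow> (\<integral>\<^sup>+\<omega>. ennreal (f i (X i \<omega>)) \<partial>M) = 1"
begin

lemma tilted_variable_measurable: "i \<in> I \<Longrightarrow> X i \<in> borel_measurable M"
  using indep by (auto simp: indep_vars_def2)

lemma tilting_factor_measurable: "i \<in> I \<Longrightarrow> (\<lambda>\<omega>. f i (X i \<omega>)) \<in> borel_measurable M"
  using tilted_variable_measurable f_meas by (rule measurable_compose)

lemma sets_tilted [measurable_cong]: "sets (tilted M X f I) = sets M" by (simp add: tilted_def)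

lemma tilting_density_measurable: "(\<lambda>\<omega>. ennreal (\<Prod>i\<in>I. f i (X i \<omega>))) \<in> borel_measurable M"
  by (intro measurable_compose[OF _ measurable_ennreal] borel_measurable_prod tilting_factor_measurable)

text \<open>The computation behind the next three lemmas: with all \<open>g i\<close> equal to 1 it
  gives total mass 1, with one nonconstant factor the marginal laws, with indicators
  independence.\<close>

lemma nn_integral_tilted_prod:
  assumes g: "\<And>i. i \<in> I \<Longrightarrow> g i \<in> borel_measurable borel"
  shows "(\<integral>\<^sup>+\<omega>. (\<Prod>i\<in>I. g i (X i \<omega>)) \<partial>(tilted M X f I)) = (\<Prod>i\<in>I. \<integral>\<^sup>+\<omega>. ennreal (f i (X i \<omega>)) * g i (X i \<omega>) \<partial>M)"
proof -
  have gm: "(\<lambda>\<omega>. g i (X i \<omega>)) \<in> borel_measurable M" if "i \<in> I" for i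
    using tilted_variable_measurable[OF that] g[OF that] by (rule measurable_compose)
  have "(\<integral>\<^sup>+\<omega>. (\<Prod>i\<in>I. g i (X i \<omega>)) \<partial>(tilted M X f I)) =
      (\<integral>\<^sup>+\<omega>. ennreal (\<Prod>i\<in>I. f i (X i \<omega>)) * (\<Prod>i\<in>I. g i (X i \<omega>)) \<partial>M)"
    unfolding tilted_def by (intro nn_integral_density tilting_density_measurable borel_measurable_prod_ennreal gm)
  also have "\<dots> = (\<integral>\<^sup>+\<omega>. (\<Prod>i\<in>I. ennreal (f i (X i \<omega>)) * g i (X i \<omega>)) \<partial>M)"
    using f_nonneg by (simp add: prod_ennreal[symmetric] prod.distrib)
  also have "\<dots> = (\<Prod>i\<in>I. \<integral>\<^sup>+\<omega>. ennreal (f i (X i \<omega>)) * g i (X i \<omega>) \<partial>M)"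
  proof (rule indep_vars_nn_integral[OF I])
    show "indep_vars (\<lambda>_. borel) (\<lambda>i \<omega>. ennreal (f i (X i \<omega>)) * g i (X i \<omega>)) I"
    proof (rule indep_vars_compose2[OF indep, of "\<lambda>i x. ennreal (f i x) * g i x"])
      fix i assume "i \<in> I"
      then show "(\<lambda>x. ennreal (f i x) * g i x) \<in> borel \<rightarrow>\<^sub>M borel" using f_meas g by simp
    qed
  qed auto
  finally show ?thesis .
qed

lemma prob_space_tilted: "prob_space (tilted M X f I)"
proof
  have "emeasure (tilted M X f I) (space (tilted M X f I)) = (\<integral>\<^sup>+\<omega>. 1 \<partial>(tilted M X f I))" by simp
  also have "\<dots> = (\<Prod>i\<in>I. \<integral>\<^sup>+\<omega>. ennreal (f i (X i \<omega>)) * 1 \<partial>M)"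
    using nn_integral_tilted_prod[of "\<lambda>_ _. 1"] by simp
  also have "\<dots> = 1" using f_int by simp
  finally show "emeasure (tilted M X f I) (space (tilted M X f I)) = 1" .
qed

lemma nn_integral_tilted:
  assumes j: "j \<in> I" and g: "g \<in> borel_measurable borel"
  shows "(\<integral>\<^sup>+\<omega>. g (X j \<omega>) \<partial>(tilted M X f I)) = (\<integral>\<^sup>+\<omega>. ennreal (f j (X j \<omega>)) * g (X j \<omega>) \<partial>M)"
proof -
  have "(\<integral>\<^sup>+\<omega>. (\<Prod>i\<in>I. (if i = j then g else (\<lambda>_. 1)) (X i \<omega>)) \<partial>(tilted M X f I)) =
      (\<Prod>i\<in>I. \<integral>\<^sup>+\<omega>. ennreal (f i (X i \<omega>)) * (if i = j then g else (\<lambda>_. 1)) (X i \<omega>) \<partial>M)"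
    by (rule nn_integral_tilted_prod) (use g in auto)
  also have "\<dots> = (\<Prod>i\<in>I. if i = j then \<integral>\<^sup>+\<omega>. ennreal (f j (X j \<omega>)) * g (X j \<omega>) \<partial>M else 1)"
    using f_int by (intro prod.cong) auto
  also have "\<dots> = (\<integral>\<^sup>+\<omega>. ennreal (f j (X j \<omega>)) * g (X j \<omega>) \<partial>M)" using I j by simp
  also have "(\<integral>\<^sup>+\<omega>. (\<Prod>i\<in>I. (if i = j then g else (\<lambda>_. 1)) (X i \<omega>)) \<partial>(tilted M X f I)) =
      (\<integral>\<^sup>+\<omega>. (\<Prod>i\<in>I. if i = j then g (X j \<omega>) else 1) \<partial>(tilted M X f I))"
    by (intro nn_integral_cong prod.cong) auto
  also have "\<dots> = (\<integral>\<^sup>+\<omega>. g (X j \<omega>) \<partial>(tilted M X f I))" using I j by simp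
  finally show ?thesis .
qed

lemma indep_vars_tilted: "prob_space.indep_vars (tilted M X f I) (\<lambda>_. borel) X I"
proof -
  interpret Q: prob_space "tilted M X f I" by (rule prob_space_tilted)
  have Qrv: "X i \<in> borel_measurable (tilted M X f I)" if "i \<in> I" for i using tilted_variable_measurable[OF that] by simp
  show ?thesis
    unfolding Q.indep_vars_def2
  proof (intro conjI)
    show "\<forall>i\<in>I. X i \<in> borel_measurable (tilted M X f I)" using Qrv by blast
    show "Q.indep_sets (\<lambda>i. {X i -` A \<inter> space (tilted M X f I) |A. A \<in> sets borel}) I"
    proof (rule Q.indep_setsI)
      show "{X i -` A \<inter> space (tilted M X f I) |A. A \<in> sets borel} \<subseteq> Q.events" if "i \<in> I" for i
        using measurable_sets[OF Qrv[OF that]] by auto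
      fix A J assume J: "J \<noteq> {}" "J \<subseteq> I" "finite J" "\<forall>j\<in>J. A j \<in> {X j -` A \<inter> space (tilted M X f I) |A. A \<in> sets borel}"
      then obtain B where B: "\<And>j. j \<in> J \<Longrightarrow> A j = X j -` B j \<inter> space (tilted M X f I) \<and> B j \<in> sets borel"
        by simp metis
      have Am: "A j \<in> Q.events" if "j \<in> J" for j using B[OF that] measurable_sets[OF Qrv] J(2) that by auto
      \<comment> \<open>Indicators on \<open>J\<close> and the constant 1 elsewhere, so that the
        product over \<open>I\<close> is the indicator of the intersection.\<close>
      define g where "g i = (if i \<in> J then indicator (B i) else (\<lambda>_. 1 :: ennreal))" for i
      have gm: "g i \<in> borel_measurable borel" if "i \<in> I" for i
      proof (cases "i \<in> J")
        case True
        then have "B i \<in> sets borel" using B by blast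
        then have "(indicator (B i) :: real \<Rightarrow> ennreal) \<in> borel_measurable borel"
          by (rule borel_measurable_indicator)
        then show ?thesis using True by (simp add: g_def)
      qed (simp add: g_def)
      have single: "(\<integral>\<^sup>+\<omega>. ennreal (f i (X i \<omega>)) * g i (X i \<omega>) \<partial>M) = (if i \<in> J then emeasure (tilted M X f I) (A i) else 1)"
        if i: "i \<in> I" for i
      proof -
        have "(\<integral>\<^sup>+\<omega>. ennreal (f i (X i \<omega>)) * g i (X i \<omega>) \<partial>M) = (\<integral>\<^sup>+\<omega>. g i (X i \<omega>) \<partial>(tilted M X f I))"
          using nn_integral_tilted[OF i gm[OF i]] by simp
        also have "\<dots> = (if i \<in> J then emeasure (tilted M X f I) (A i) else 1)"
        proof (cases "i \<in> J")
          case True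
          have "(\<integral>\<^sup>+\<omega>. g i (X i \<omega>) \<partial>(tilted M X f I)) = (\<integral>\<^sup>+\<omega>. indicator (A i) \<omega> \<partial>(tilted M X f I))"
            using B[OF True] True by (intro nn_integral_cong) (auto simp: g_def indicator_def)
          then show ?thesis using Am[OF True] True by simp
        next
          case False
          then show ?thesis using Q.emeasure_space_1 by (simp add: g_def)
        qed
        finally show ?thesis .
      qed
      have "emeasure (tilted M X f I) (\<Inter>j\<in>J. A j) = (\<integral>\<^sup>+\<omega>. indicator (\<Inter>j\<in>J. A j) \<omega> \<partial>(tilted M X f I))"
        using Am J(1,3) by (intro nn_integral_indicator[symmetric] sets.finite_INT) auto
      also have "\<dots> = (\<integral>\<^sup>+\<omega>. (\<Prod>i\<in>I. g i (X i \<omega>)) \<partial>(tilted M X f I))"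
      proof (rule nn_integral_cong)
        fix \<omega> assume \<omega>: "\<omega> \<in> space (tilted M X f I)"
        have "(\<Prod>i\<in>I. g i (X i \<omega>)) = (\<Prod>i\<in>J. g i (X i \<omega>))"
          using J(2) I by (intro prod.mono_neutral_right) (auto simp: g_def)
        also have "\<dots> = (\<Prod>i\<in>J. indicator (A i) \<omega>)"
          using B \<omega> by (intro prod.cong) (auto simp: g_def indicator_def)
        also have "\<dots> = indicator (\<Inter>j\<in>J. A j) \<omega>"
        proof (cases "\<forall>j\<in>J. \<omega> \<in> A j")
          case False
          then obtain j where "j \<in> J" "\<omega> \<notin> A j" by blast
          then have "(\<Prod>i\<in>J. indicator (A i) \<omega> :: ennreal) = 0"
            using J(3) by (intro prod_zero bexI[of _ j]) (auto simp: indicator_def)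
          then show ?thesis using False by (simp add: indicator_def)
        qed simp
        finally show "indicator (\<Inter>j\<in>J. A j) \<omega> = (\<Prod>i\<in>I. g i (X i \<omega>))" by simp
      qed
      also have "\<dots> = (\<Prod>i\<in>I. if i \<in> J then emeasure (tilted M X f I) (A i) else 1)"
      proof -
        have "(\<integral>\<^sup>+\<omega>. (\<Prod>i\<in>I. g i (X i \<omega>)) \<partial>(tilted M X f I)) = (\<Prod>i\<in>I. \<integral>\<^sup>+\<omega>. ennreal (f i (X i \<omega>)) * g i (X i \<omega>) \<partial>M)"
          by (rule nn_integral_tilted_prod) (rule gm)
        also have "\<dots> = (\<Prod>i\<in>I. if i \<in> J then emeasure (tilted M X f I) (A i) else 1)"
          by (rule prod.cong) (use single in auto)
        finally show ?thesis .
      qed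
      also have "\<dots> = (\<Prod>i\<in>J. emeasure (tilted M X f I) (A i))"
        using I J(2) by (simp add: prod.If_cases Int_absorb1)
      finally have "ennreal (Q.prob (\<Inter>j\<in>J. A j)) = ennreal (\<Prod>j\<in>J. Q.prob (A j))"
        by (simp add: Q.emeasure_eq_measure prod_ennreal)
      then show "Q.prob (\<Inter>j\<in>J. A j) = (\<Prod>j\<in>J. Q.prob (A j))"
        by (simp add: prod_nonneg)
    qed
  qed
qed

end

end

section \<open>Exponential moments of a single variable\<close>

lemma power_le_fact_exp:
  fixes y :: real
  assumes "y \<ge> 0"
  shows "y ^ p \<le> fact p * exp y"
proof -
  have "(\<lambda>n. y ^ n /\<^sub>R fact n) sums exp y" by (rule exp_converges)
  then have "y ^ p /\<^sub>R fact p \<le> exp y"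
    using sum_le_suminf[of "\<lambda>n. y ^ n /\<^sub>R fact n" "{p}"] assms by (auto simp: sums_iff)
  then show ?thesis by (simp add: field_simps)
qed

locale subexponential_law = prob_space M for M :: "'w measure" +
  fixes Z :: "'w \<Rightarrow> real" and \<sigma> K :: real
  assumes Z_rv [measurable]: "Z \<in> borel_measurable M"
    and Z_int: "integrable M Z" and Z_centered: "expectation Z = 0"
    and Z2_int: "integrable M (\<lambda>\<omega>. (Z \<omega>)\<^sup>2)" and Z_var: "expectation (\<lambda>\<omega>. (Z \<omega>)\<^sup>2) = \<sigma>\<^sup>2" and \<sigma>_pos: "\<sigma>\<^sup>2 > 0"
    and K_pos: "K > 0"
    and Z_moments: "\<And>m::nat. (\<integral>\<^sup>+\<omega>. ennreal (\<bar>Z \<omega>\<bar> ^ m) \<partial>M) \<le> ennreal (fact m * K ^ m)"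
begin

definition mgf :: "real \<Rightarrow> real" where
  "mgf \<theta> = expectation (\<lambda>\<omega>. exp (\<theta> * Z \<omega>))"

text \<open>Half of the radius \<open>1 / K\<close> within which the moment bound makes the
  exponential series converge; the dominating geometric series then has ratio 1/2.\<close>

definition rad :: real where "rad = 1 / (2 * K)"

lemma rad_pos: "rad > 0" using K_pos by (simp add: rad_def)

text \<open>The factorials in the moment bound cancel those of the exponential series, which leaves
  the geometric series with sum 2.\<close>

lemma exp_abs_integrable:
  "integrable M (\<lambda>\<omega>. exp (rad * \<bar>Z \<omega>\<bar>))" "expectation (\<lambda>\<omega>. exp (rad * \<bar>Z \<omega>\<bar>)) \<le> 2"
proof -
  have "(\<integral>\<^sup>+\<omega>. ennreal (exp (rad * \<bar>Z \<omega>\<bar>)) \<partial>M) = (\<integral>\<^sup>+\<omega>. (\<Sum>m. ennreal (rad ^ m / fact m) * ennreal (\<bar>Z \<omega>\<bar> ^ m)) \<partial>M)"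
  proof (rule nn_integral_cong)
    fix \<omega>
    have s: "(\<lambda>m. (rad * \<bar>Z \<omega>\<bar>) ^ m /\<^sub>R fact m) sums exp (rad * \<bar>Z \<omega>\<bar>)" by (rule exp_converges)
    have "ennreal (exp (rad * \<bar>Z \<omega>\<bar>)) = (\<Sum>m. ennreal ((rad * \<bar>Z \<omega>\<bar>) ^ m /\<^sub>R fact m))"
      using s rad_pos by (subst suminf_ennreal2) (auto simp: sums_iff)
    also have "\<dots> = (\<Sum>m. ennreal (rad ^ m / fact m) * ennreal (\<bar>Z \<omega>\<bar> ^ m))"
      using rad_pos by (intro suminf_cong) (simp add: ennreal_mult[symmetric] power_mult_distrib divide_inverse mult_ac)
    finally show "ennreal (exp (rad * \<bar>Z \<omega>\<bar>)) = (\<Sum>m. ennreal (rad ^ m / fact m) * ennreal (\<bar>Z \<omega>\<bar> ^ m))" .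
  qed
  also have "\<dots> = (\<Sum>m. ennreal (rad ^ m / fact m) * (\<integral>\<^sup>+\<omega>. ennreal (\<bar>Z \<omega>\<bar> ^ m) \<partial>M))"
    by (subst nn_integral_suminf) (simp_all add: nn_integral_cmult)
  also have "\<dots> \<le> (\<Sum>m. ennreal ((1/2) ^ m))"
  proof (rule suminf_le)
    fix m
    have "ennreal (rad ^ m / fact m) * (\<integral>\<^sup>+\<omega>. ennreal (\<bar>Z \<omega>\<bar> ^ m) \<partial>M) \<le>
        ennreal (rad ^ m / fact m) * ennreal (fact m * K ^ m)"
      by (intro mult_left_mono Z_moments) auto
    also have "\<dots> = ennreal ((rad * K) ^ m)"
      using rad_pos K_pos by (simp add: ennreal_mult[symmetric] power_mult_distrib)
    also have "rad * K = 1/2" using K_pos by (simp add: rad_def)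
    finally show "ennreal (rad ^ m / fact m) * (\<integral>\<^sup>+\<omega>. ennreal (\<bar>Z \<omega>\<bar> ^ m) \<partial>M) \<le> ennreal ((1/2) ^ m)" .
  qed auto
  also have "\<dots> = ennreal (\<Sum>m. (1/2) ^ m)" by (rule suminf_ennreal2) auto
  also have "(\<Sum>m. (1/2 :: real) ^ m) = 2" by (subst suminf_geometric) auto
  finally have le: "(\<integral>\<^sup>+\<omega>. ennreal (exp (rad * \<bar>Z \<omega>\<bar>)) \<partial>M) \<le> ennreal 2" .
  show int: "integrable M (\<lambda>\<omega>. exp (rad * \<bar>Z \<omega>\<bar>))"
    by (rule integrableI_nonneg) (use le_less_trans[OF le ennreal_less_top] in auto)
  show "expectation (\<lambda>\<omega>. exp (rad * \<bar>Z \<omega>\<bar>)) \<le> 2"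
  proof -
    have "(\<integral>\<^sup>+\<omega>. ennreal (exp (rad * \<bar>Z \<omega>\<bar>)) \<partial>M) = ennreal (expectation (\<lambda>\<omega>. exp (rad * \<bar>Z \<omega>\<bar>)))"
      by (rule nn_integral_eq_integral[OF int]) simp
    then have "ennreal (expectation (\<lambda>\<omega>. exp (rad * \<bar>Z \<omega>\<bar>))) \<le> ennreal 2" using le by (simp only:)
    then show ?thesis by (subst (asm) ennreal_le_iff) simp_all
  qed
qed

text \<open>Half of \<open>rad\<close> absorbs the power of \<open>z\<close>, the other half the
  exponential with parameter \<theta>.\<close>

lemma power_exp_bound:
  assumes "\<bar>\<theta>\<bar> \<le> rad / 2"
  shows "\<bar>z\<bar> ^ p * exp (\<bar>\<theta>\<bar> * \<bar>z\<bar>) \<le> fact p * (2 / rad) ^ p * exp (rad * \<bar>z\<bar>)"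
proof -
  have "(rad / 2 * \<bar>z\<bar>) ^ p \<le> fact p * exp (rad / 2 * \<bar>z\<bar>)"
    using rad_pos by (intro power_le_fact_exp) auto
  then have "(2 / rad) ^ p * (rad / 2 * \<bar>z\<bar>) ^ p \<le> (2 / rad) ^ p * (fact p * exp (rad / 2 * \<bar>z\<bar>))"
    using rad_pos by (intro mult_left_mono) auto
  also have "(2 / rad) ^ p * (rad / 2 * \<bar>z\<bar>) ^ p = \<bar>z\<bar> ^ p"
    using rad_pos by (simp add: power_mult_distrib[symmetric])
  finally have 1: "\<bar>z\<bar> ^ p \<le> fact p * (2 / rad) ^ p * exp (rad / 2 * \<bar>z\<bar>)" by (simp add: mult_ac)
  have 2: "exp (\<bar>\<theta>\<bar> * \<bar>z\<bar>) \<le> exp (rad / 2 * \<bar>z\<bar>)" using mult_right_mono[OF assms, of "\<bar>z\<bar>"] by simp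
  have "\<bar>z\<bar> ^ p * exp (\<bar>\<theta>\<bar> * \<bar>z\<bar>) \<le> (fact p * (2 / rad) ^ p * exp (rad / 2 * \<bar>z\<bar>)) * exp (rad / 2 * \<bar>z\<bar>)"
    using rad_pos by (intro mult_mono 1 2) auto
  also have "\<dots> = fact p * (2 / rad) ^ p * (exp (rad / 2 * \<bar>z\<bar>) * exp (rad / 2 * \<bar>z\<bar>))" by (simp only: mult.assoc)
  also have "exp (rad / 2 * \<bar>z\<bar>) * exp (rad / 2 * \<bar>z\<bar>) = exp (rad * \<bar>z\<bar>)"
    by (simp add: exp_add[symmetric])
  finally show ?thesis .
qed

text \<open>The sum of the bounds \<open>2 * (fact p * (2 / rad) ^ p)\<close> of
  \<open>dominated_integrable\<close> for \<open>p = 3\<close> and \<open>p = 2\<close>, so that one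
  constant serves all estimates.\<close>

definition cum :: real where "cum = 12 * (2 / rad) ^ 3 + 4 * (2 / rad) ^ 2"

lemma cum_pos: "cum > 0" using rad_pos by (auto simp: cum_def intro!: add_pos_pos)

lemma dominated_integrable:
  assumes \<theta>: "\<bar>\<theta>\<bar> \<le> rad / 2" and g: "g \<in> borel_measurable M" "\<And>\<omega>. \<bar>g \<omega>\<bar> \<le> \<bar>Z \<omega>\<bar> ^ p * exp (\<bar>\<theta>\<bar> * \<bar>Z \<omega>\<bar>)"
  shows "integrable M g" "\<bar>expectation g\<bar> \<le> 2 * (fact p * (2 / rad) ^ p)"
proof -
  have le: "\<bar>g \<omega>\<bar> \<le> fact p * (2 / rad) ^ p * exp (rad * \<bar>Z \<omega>\<bar>)" for \<omega>
    using g(2)[of \<omega>] power_exp_bound[OF \<theta>, of "Z \<omega>" p] by (rule order_trans)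
  have int: "integrable M (\<lambda>\<omega>. fact p * (2 / rad) ^ p * exp (rad * \<bar>Z \<omega>\<bar>))"
    using exp_abs_integrable(1) by simp
  show gi: "integrable M g"
    by (rule Bochner_Integration.integrable_bound[OF int g(1)]) (use le rad_pos in auto)
  have "\<bar>expectation g\<bar> \<le> expectation (\<lambda>\<omega>. \<bar>g \<omega>\<bar>)" by (rule integral_abs_bound)
  also have "\<dots> \<le> expectation (\<lambda>\<omega>. fact p * (2 / rad) ^ p * exp (rad * \<bar>Z \<omega>\<bar>))"
    using gi int le by (intro integral_mono) auto
  also have "\<dots> = fact p * (2 / rad) ^ p * expectation (\<lambda>\<omega>. exp (rad * \<bar>Z \<omega>\<bar>))" by simp
  also have "\<dots> \<le> fact p * (2 / rad) ^ p * 2"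
    using exp_abs_integrable(2) rad_pos by (intro mult_left_mono) auto
  finally show "\<bar>expectation g\<bar> \<le> 2 * (fact p * (2 / rad) ^ p)" by simp
qed

lemma mult_le_abs_mult: "\<theta> * z \<le> \<bar>\<theta>\<bar> * \<bar>z\<bar>" for z \<theta> :: real
  by (metis abs_ge_self abs_mult)

text \<open>Each Taylor remainder is divided by its power of \<theta> before the expectation is
  taken, so that \<open>dominated_integrable\<close> bounds it uniformly in \<theta>. At \<theta> =
  0 these quotients are 0 and the claims are checked directly.\<close>

lemma mgf_estimates:
  assumes \<theta>: "\<bar>\<theta>\<bar> \<le> rad / 2"
  shows "integrable M (\<lambda>\<omega>. exp (\<theta> * Z \<omega>))" "integrable M (\<lambda>\<omega>. Z \<omega> * exp (\<theta> * Z \<omega>))"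
    "integrable M (\<lambda>\<omega>. (Z \<omega>)\<^sup>2 * exp (\<theta> * Z \<omega>))"
    "\<bar>mgf \<theta> - 1 - \<sigma>\<^sup>2 * \<theta>\<^sup>2 / 2\<bar> \<le> cum * \<bar>\<theta>\<bar> ^ 3"
    "\<bar>expectation (\<lambda>\<omega>. Z \<omega> * exp (\<theta> * Z \<omega>)) - \<sigma>\<^sup>2 * \<theta>\<bar> \<le> cum * \<theta>\<^sup>2"
    "expectation (\<lambda>\<omega>. (Z \<omega>)\<^sup>2 * exp (\<theta> * Z \<omega>)) \<le> cum"
proof -
  show i0: "integrable M (\<lambda>\<omega>. exp (\<theta> * Z \<omega>))"
    by (rule dominated_integrable(1)[OF \<theta>, of _ 0]) (auto simp: mult_le_abs_mult)
  show i1: "integrable M (\<lambda>\<omega>. Z \<omega> * exp (\<theta> * Z \<omega>))"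
    by (rule dominated_integrable(1)[OF \<theta>, of _ 1]) (auto simp: abs_mult mult_le_abs_mult intro!: mult_left_mono)
  show i2: "integrable M (\<lambda>\<omega>. (Z \<omega>)\<^sup>2 * exp (\<theta> * Z \<omega>))"
    by (rule dominated_integrable(1)[OF \<theta>, of _ 2]) (auto simp: abs_mult mult_le_abs_mult intro!: mult_left_mono)
  have "\<bar>expectation (\<lambda>\<omega>. (Z \<omega>)\<^sup>2 * exp (\<theta> * Z \<omega>))\<bar> \<le> 2 * (fact 2 * (2 / rad) ^ 2)"
    by (rule dominated_integrable(2)[OF \<theta>]) (auto simp: abs_mult mult_le_abs_mult intro!: mult_left_mono)
  also have "\<dots> \<le> cum" using rad_pos by (simp add: cum_def)
  finally show "expectation (\<lambda>\<omega>. (Z \<omega>)\<^sup>2 * exp (\<theta> * Z \<omega>)) \<le> cum" by simp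
  have c3: "2 * (fact 3 * (2 / rad) ^ 3) \<le> cum" using rad_pos by (simp add: cum_def fact_numeral)
  have t2: "\<bar>exp x - (1 + x + x\<^sup>2 / 2)\<bar> \<le> \<bar>x\<bar> ^ 3 * exp \<bar>x\<bar>" for x :: real
  proof -
    have "\<bar>exp x - (1 + x + x\<^sup>2 / 2)\<bar> \<le> exp \<bar>x\<bar> * \<bar>x\<bar> ^ 3 / 2"
      using Taylor_exp_field[of x 2] by (simp add: eval_nat_numeral)
    then show ?thesis by (simp add: mult.commute) (smt (verit) exp_gt_zero mult_nonneg_nonneg zero_le_power_abs)
  qed
  have t1: "\<bar>exp x - (1 + x)\<bar> \<le> \<bar>x\<bar> ^ 2 * exp \<bar>x\<bar>" for x :: real
    using Taylor_exp_field[of x 1] by (simp add: eval_nat_numeral mult.commute)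
  have "\<bar>expectation (\<lambda>\<omega>. (exp (\<theta> * Z \<omega>) - (1 + \<theta> * Z \<omega> + (\<theta> * Z \<omega>)\<^sup>2 / 2)) / \<bar>\<theta>\<bar> ^ 3)\<bar> \<le> 2 * (fact 3 * (2 / rad) ^ 3)"
  proof (rule dominated_integrable(2)[OF \<theta>])
    fix \<omega>
    show "\<bar>(exp (\<theta> * Z \<omega>) - (1 + \<theta> * Z \<omega> + (\<theta> * Z \<omega>)\<^sup>2 / 2)) / \<bar>\<theta>\<bar> ^ 3\<bar> \<le> \<bar>Z \<omega>\<bar> ^ 3 * exp (\<bar>\<theta>\<bar> * \<bar>Z \<omega>\<bar>)"
    proof (cases "\<theta> = 0")
      case False
      have "\<bar>exp (\<theta> * Z \<omega>) - (1 + \<theta> * Z \<omega> + (\<theta> * Z \<omega>)\<^sup>2 / 2)\<bar> \<le> \<bar>\<theta>\<bar> ^ 3 * (\<bar>Z \<omega>\<bar> ^ 3 * exp (\<bar>\<theta>\<bar> * \<bar>Z \<omega>\<bar>))"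
        using t2[of "\<theta> * Z \<omega>"] by (simp add: abs_mult power_mult_distrib mult_ac)
      then show ?thesis using False by (simp add: field_simps)
    qed simp
  qed measurable
  moreover have "expectation (\<lambda>\<omega>. (exp (\<theta> * Z \<omega>) - (1 + \<theta> * Z \<omega> + (\<theta> * Z \<omega>)\<^sup>2 / 2)) / \<bar>\<theta>\<bar> ^ 3) =
      (mgf \<theta> - 1 - \<sigma>\<^sup>2 * \<theta>\<^sup>2 / 2) / \<bar>\<theta>\<bar> ^ 3"
  proof -
    have "expectation (\<lambda>\<omega>. exp (\<theta> * Z \<omega>) - (1 + \<theta> * Z \<omega> + \<theta>\<^sup>2 / 2 * (Z \<omega>)\<^sup>2)) = mgf \<theta> - 1 - \<sigma>\<^sup>2 * \<theta>\<^sup>2 / 2"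
      using i0 Z_int Z2_int by (simp add: mgf_def Z_centered Z_var prob_space)
    then show ?thesis by (simp add: power_mult_distrib)
  qed
  ultimately have "\<bar>(mgf \<theta> - 1 - \<sigma>\<^sup>2 * \<theta>\<^sup>2 / 2) / \<bar>\<theta>\<bar> ^ 3\<bar> \<le> 2 * (fact 3 * (2 / rad) ^ 3)" by (simp only:)
  then have "\<bar>mgf \<theta> - 1 - \<sigma>\<^sup>2 * \<theta>\<^sup>2 / 2\<bar> / \<bar>\<theta>\<bar> ^ 3 \<le> cum" using order_trans[OF _ c3] by (simp add: abs_divide)
  then show "\<bar>mgf \<theta> - 1 - \<sigma>\<^sup>2 * \<theta>\<^sup>2 / 2\<bar> \<le> cum * \<bar>\<theta>\<bar> ^ 3"
    by (cases "\<theta> = 0") (simp_all add: field_simps mgf_def prob_space)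
  have "\<bar>expectation (\<lambda>\<omega>. Z \<omega> * (exp (\<theta> * Z \<omega>) - (1 + \<theta> * Z \<omega>)) / \<theta>\<^sup>2)\<bar> \<le> 2 * (fact 3 * (2 / rad) ^ 3)"
  proof (rule dominated_integrable(2)[OF \<theta>])
    fix \<omega>
    show "\<bar>Z \<omega> * (exp (\<theta> * Z \<omega>) - (1 + \<theta> * Z \<omega>)) / \<theta>\<^sup>2\<bar> \<le> \<bar>Z \<omega>\<bar> ^ 3 * exp (\<bar>\<theta>\<bar> * \<bar>Z \<omega>\<bar>)"
    proof (cases "\<theta> = 0")
      case False
      have "\<bar>Z \<omega>\<bar> * \<bar>exp (\<theta> * Z \<omega>) - (1 + \<theta> * Z \<omega>)\<bar> \<le> \<bar>Z \<omega>\<bar> * (\<bar>\<theta> * Z \<omega>\<bar> ^ 2 * exp \<bar>\<theta> * Z \<omega>\<bar>)"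
        by (intro mult_left_mono t1) auto
      also have "\<dots> = \<theta>\<^sup>2 * (\<bar>Z \<omega>\<bar> ^ 3 * exp (\<bar>\<theta>\<bar> * \<bar>Z \<omega>\<bar>))"
        by (simp add: abs_mult power_mult_distrib power3_eq_cube power2_eq_square mult_ac)
      finally have "\<bar>Z \<omega> * (exp (\<theta> * Z \<omega>) - (1 + \<theta> * Z \<omega>))\<bar> \<le> \<theta>\<^sup>2 * (\<bar>Z \<omega>\<bar> ^ 3 * exp (\<bar>\<theta>\<bar> * \<bar>Z \<omega>\<bar>))"
        by (simp only: abs_mult)
      moreover have "\<bar>d / w\<bar> \<le> e" if "\<bar>d\<bar> \<le> w * e" "w > 0" for d w e :: real
        using that by (simp add: pos_divide_le_eq mult.commute)
      ultimately show ?thesis using False by simp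
    qed simp
  qed measurable
  moreover have "expectation (\<lambda>\<omega>. Z \<omega> * (exp (\<theta> * Z \<omega>) - (1 + \<theta> * Z \<omega>)) / \<theta>\<^sup>2) =
      (expectation (\<lambda>\<omega>. Z \<omega> * exp (\<theta> * Z \<omega>)) - \<sigma>\<^sup>2 * \<theta>) / \<theta>\<^sup>2"
  proof -
    have "expectation (\<lambda>\<omega>. Z \<omega> * exp (\<theta> * Z \<omega>) - (Z \<omega> + \<theta> * (Z \<omega>)\<^sup>2)) = expectation (\<lambda>\<omega>. Z \<omega> * exp (\<theta> * Z \<omega>)) - \<sigma>\<^sup>2 * \<theta>"
      using i1 Z_int Z2_int by (simp add: Z_centered Z_var mult.commute)
    moreover have "Z \<omega> * (exp (\<theta> * Z \<omega>) - (1 + \<theta> * Z \<omega>)) = Z \<omega> * exp (\<theta> * Z \<omega>) - (Z \<omega> + \<theta> * (Z \<omega>)\<^sup>2)" for \<omega>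
      by (simp add: algebra_simps power2_eq_square)
    ultimately show ?thesis by simp
  qed
  ultimately have "\<bar>(expectation (\<lambda>\<omega>. Z \<omega> * exp (\<theta> * Z \<omega>)) - \<sigma>\<^sup>2 * \<theta>) / \<theta>\<^sup>2\<bar> \<le> 2 * (fact 3 * (2 / rad) ^ 3)" by (simp only:)
  then have "\<bar>expectation (\<lambda>\<omega>. Z \<omega> * exp (\<theta> * Z \<omega>)) - \<sigma>\<^sup>2 * \<theta>\<bar> / \<theta>\<^sup>2 \<le> cum" using order_trans[OF _ c3] by (simp add: abs_divide)
  then show "\<bar>expectation (\<lambda>\<omega>. Z \<omega> * exp (\<theta> * Z \<omega>)) - \<sigma>\<^sup>2 * \<theta>\<bar> \<le> cum * \<theta>\<^sup>2"
    by (cases "\<theta> = 0") (simp_all add: field_simps Z_centered)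
qed

text \<open>To second order the moment generating function is that of a centred normal variable with
  the same variance; near 0 the higher order error fits into the margin \<eta>. The last estimate
  says that tilting by \<theta> moves the mean to about
  \<open>\<sigma>\<^sup>2 * \<theta>\<close>.\<close>

proposition Gaussian_comparison:
  assumes \<eta>: "0 < \<eta>" "\<eta> \<le> 1"
  obtains \<theta>0 where "\<theta>0 > 0" "\<theta>0 \<le> rad / 2"
    "\<And>\<theta>. \<bar>\<theta>\<bar> \<le> \<theta>0 \<Longrightarrow> mgf \<theta> \<le> exp ((1 + \<eta>) / 2 * (\<sigma>\<^sup>2 * \<theta>\<^sup>2))"
    "\<And>\<theta>. \<bar>\<theta>\<bar> \<le> \<theta>0 \<Longrightarrow> mgf \<theta> \<ge> exp ((1 - \<eta>) / 2 * (\<sigma>\<^sup>2 * \<theta>\<^sup>2))"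
    "\<And>\<theta>. \<bar>\<theta>\<bar> \<le> \<theta>0 \<Longrightarrow> \<bar>expectation (\<lambda>\<omega>. Z \<omega> * exp (\<theta> * Z \<omega>)) / mgf \<theta> - \<sigma>\<^sup>2 * \<theta>\<bar> \<le> \<eta> * (\<sigma>\<^sup>2 * \<bar>\<theta>\<bar>)"
proof -
  \<comment> \<open>\<open>rad / 2\<close> gives access to \<open>mgf_estimates\<close>. With
    \<open>v = \<sigma>\<^sup>2 * \<theta>\<^sup>2\<close>, the entry
    \<open>\<eta> * \<sigma>\<^sup>2 / (4 * cum)\<close> makes the cubic error at most
    \<open>\<eta> / 4 * v\<close>, and 1 together with \<open>\<eta> / \<sigma>\<^sup>2\<close>
    yields \<open>v \<le> \<eta>\<close>.\<close>
  define \<theta>0 where "\<theta>0 = Min {rad / 2, 1, \<eta> * \<sigma>\<^sup>2 / (4 * cum), \<eta> / \<sigma>\<^sup>2, \<eta> / (2 * (\<sigma>\<^sup>2 + cum))}"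
  have \<theta>0: "\<theta>0 > 0" "\<theta>0 \<le> rad / 2" "\<theta>0 \<le> 1" "\<theta>0 \<le> \<eta> * \<sigma>\<^sup>2 / (4 * cum)" "\<theta>0 \<le> \<eta> / \<sigma>\<^sup>2" "\<theta>0 \<le> \<eta> / (2 * (\<sigma>\<^sup>2 + cum))"
  proof -
    show "\<theta>0 > 0" unfolding \<theta>0_def
      using rad_pos \<eta> \<sigma>_pos cum_pos by (subst Min_gr_iff) (auto intro!: divide_pos_pos mult_pos_pos add_pos_pos)
    have "\<theta>0 \<le> x" if "x \<in> {rad / 2, 1, \<eta> * \<sigma>\<^sup>2 / (4 * cum), \<eta> / \<sigma>\<^sup>2, \<eta> / (2 * (\<sigma>\<^sup>2 + cum))}" for x
      unfolding \<theta>0_def by (rule Min_le) (use that in auto)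
    then show "\<theta>0 \<le> rad / 2" "\<theta>0 \<le> 1" "\<theta>0 \<le> \<eta> * \<sigma>\<^sup>2 / (4 * cum)" "\<theta>0 \<le> \<eta> / \<sigma>\<^sup>2" "\<theta>0 \<le> \<eta> / (2 * (\<sigma>\<^sup>2 + cum))"
      by blast+
  qed
  {
    fix \<theta> :: real assume \<theta>: "\<bar>\<theta>\<bar> \<le> \<theta>0"
    define v where "v = \<sigma>\<^sup>2 * \<theta>\<^sup>2"
    have v: "v \<ge> 0" by (simp add: v_def)
    note E = mgf_estimates[OF order_trans[OF \<theta> \<theta>0(2)]]
    have l2: "\<bar>\<theta>\<bar> * \<bar>\<theta>\<bar> = \<theta>\<^sup>2" by (simp add: power2_eq_square)
    have c1: "cum * \<bar>\<theta>\<bar> \<le> \<eta> * \<sigma>\<^sup>2 / 4"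
      using mult_left_mono[OF order_trans[OF \<theta> \<theta>0(4)], of cum] cum_pos by (simp add: field_simps)
    have c3: "cum * \<bar>\<theta>\<bar> ^ 3 \<le> \<eta> / 4 * v"
    proof -
      have "cum * \<bar>\<theta>\<bar> ^ 3 = (cum * \<bar>\<theta>\<bar>) * \<theta>\<^sup>2" by (simp add: power3_eq_cube power2_eq_square mult_ac)
      also have "\<dots> \<le> (\<eta> * \<sigma>\<^sup>2 / 4) * \<theta>\<^sup>2" using c1 by (intro mult_right_mono) auto
      finally show ?thesis by (simp add: v_def mult_ac)
    qed
    have "\<sigma>\<^sup>2 * \<bar>\<theta>\<bar> \<le> \<eta>"
      using mult_left_mono[OF order_trans[OF \<theta> \<theta>0(5)], of "\<sigma>\<^sup>2"] \<sigma>_pos by (simp add: field_simps)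
    then have v\<eta>: "v \<le> \<eta>"
      using mult_mono[of "\<sigma>\<^sup>2 * \<bar>\<theta>\<bar>" \<eta> "\<bar>\<theta>\<bar>" 1] \<theta> \<theta>0(3) \<eta> by (simp add: v_def mult_ac l2[symmetric])
    from order_trans[OF E(4) c3] have E4: "\<bar>mgf \<theta> - 1 - v / 2\<bar> \<le> \<eta> / 4 * v" by (simp only: v_def)
    have \<eta>v: "0 \<le> \<eta> * v" using \<eta> v by simp
    have "(1 + \<eta>) / 2 * v = v / 2 + \<eta> * v / 2" by (simp add: field_simps)
    then have up: "mgf \<theta> \<le> 1 + (1 + \<eta>) / 2 * v" using E4 \<eta>v by linarith
    also have "\<dots> \<le> exp ((1 + \<eta>) / 2 * v)" by (rule exp_ge_add_one_self)
    finally have r1: "mgf \<theta> \<le> exp ((1 + \<eta>) / 2 * (\<sigma>\<^sup>2 * \<theta>\<^sup>2))" by (simp add: v_def)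
    define w where "w = (1 - \<eta>) / 2 * v"
    have w: "0 \<le> w" "w \<le> v / 2"  using \<eta> v mult_right_mono[of "1 - \<eta>" 1 v] by (auto simp: w_def)
    have "w \<le> 1" using w v\<eta> \<eta> by simp
    \<comment> \<open>The margin \<open>\<eta> * v / 2\<close> by which \<open>w\<close> falls short
      of \<open>v / 2\<close> pays in equal parts for this square and for the cubic error.\<close>
    then have "exp w \<le> 1 + w + w\<^sup>2" using w(1) by (intro exp_bound) auto
    also have "w\<^sup>2 \<le> \<eta> / 4 * v"
    proof -
      have "w\<^sup>2 \<le> (v / 2)\<^sup>2" using w by (intro power_mono) auto
      also have "\<dots> = v * v / 4" by (simp add: power2_eq_square)
      also have "\<dots> \<le> \<eta> * v / 4" using v\<eta> v by (intro divide_right_mono mult_right_mono) auto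
      finally show ?thesis by simp
    qed
    also have "1 + w + \<eta> / 4 * v \<le> mgf \<theta>"
    proof -
      have "w = v / 2 - \<eta> * v / 2" by (simp add: w_def field_simps)
      then show ?thesis using E4 by linarith
    qed
    finally have r2: "exp w \<le> mgf \<theta>" by simp
    have ge1: "mgf \<theta> \<ge> 1" using r2 w(1) one_le_exp_iff[of w] by linarith
    have "\<bar>expectation (\<lambda>\<omega>. Z \<omega> * exp (\<theta> * Z \<omega>)) / mgf \<theta> - \<sigma>\<^sup>2 * \<theta>\<bar> = \<bar>expectation (\<lambda>\<omega>. Z \<omega> * exp (\<theta> * Z \<omega>)) - \<sigma>\<^sup>2 * \<theta> * mgf \<theta>\<bar> / mgf \<theta>"
      using ge1 by (simp add: abs_divide[symmetric] field_simps)
    also have "\<dots> \<le> \<bar>expectation (\<lambda>\<omega>. Z \<omega> * exp (\<theta> * Z \<omega>)) - \<sigma>\<^sup>2 * \<theta> * mgf \<theta>\<bar> / 1"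
      using ge1 by (intro divide_left_mono) auto
    also have "\<dots> \<le> cum * \<theta>\<^sup>2 + \<sigma>\<^sup>2 * \<bar>\<theta>\<bar> * \<bar>mgf \<theta> - 1\<bar>"
    proof -
      have "expectation (\<lambda>\<omega>. Z \<omega> * exp (\<theta> * Z \<omega>)) - \<sigma>\<^sup>2 * \<theta> * mgf \<theta> =
          (expectation (\<lambda>\<omega>. Z \<omega> * exp (\<theta> * Z \<omega>)) - \<sigma>\<^sup>2 * \<theta>) - \<sigma>\<^sup>2 * \<theta> * (mgf \<theta> - 1)" by (simp add: algebra_simps)
      also have "\<bar>\<dots>\<bar> \<le> \<bar>expectation (\<lambda>\<omega>. Z \<omega> * exp (\<theta> * Z \<omega>)) - \<sigma>\<^sup>2 * \<theta>\<bar> + \<bar>\<sigma>\<^sup>2 * \<theta> * (mgf \<theta> - 1)\<bar>" by (rule abs_triangle_ineq4)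
      finally show ?thesis using E(5) by (simp add: abs_mult)
    qed
    also have "\<dots> \<le> \<eta> * (\<sigma>\<^sup>2 * \<bar>\<theta>\<bar>)"
    proof -
      have "cum * \<theta>\<^sup>2 \<le> \<eta> * \<sigma>\<^sup>2 / 4 * \<bar>\<theta>\<bar>"
        using mult_right_mono[OF c1, of "\<bar>\<theta>\<bar>"] by (simp add: power2_eq_square mult.assoc)
      moreover have "\<bar>mgf \<theta> - 1\<bar> \<le> 3 / 4 * \<eta>"
      proof -
        have "mgf \<theta> - 1 \<le> v / 2 + \<eta> / 4 * v" using E4 by linarith
        also have "\<dots> \<le> \<eta> / 2 + 1 / 4 * \<eta>"
        proof -
          have "\<eta> * v \<le> 1 * \<eta>" using v\<eta> v \<eta> by (intro mult_mono) auto
          then show ?thesis using v\<eta> by linarith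
        qed
        finally show ?thesis using ge1 by simp
      qed
      then have "\<sigma>\<^sup>2 * \<bar>\<theta>\<bar> * \<bar>mgf \<theta> - 1\<bar> \<le> \<sigma>\<^sup>2 * \<bar>\<theta>\<bar> * (3 / 4 * \<eta>)" by (intro mult_left_mono) auto
      ultimately show ?thesis by (simp add: algebra_simps)
    qed
    finally have r3: "\<bar>expectation (\<lambda>\<omega>. Z \<omega> * exp (\<theta> * Z \<omega>)) / mgf \<theta> - \<sigma>\<^sup>2 * \<theta>\<bar> \<le> \<eta> * (\<sigma>\<^sup>2 * \<bar>\<theta>\<bar>)" .
    note r1 r2[unfolded w_def v_def] r3
  }
  then show ?thesis using that[OF \<theta>0(1,2)] by blast
qed

end

section \<open>Weighted sums of independent copies\<close>

locale iid_subexponential = subexponential_law M Z \<sigma> K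
  for M :: "'w measure" and Z :: "'w \<Rightarrow> real" and \<sigma> K :: real +
  fixes X :: "nat \<Rightarrow> 'w \<Rightarrow> real"
  assumes X_indep: "indep_vars (\<lambda>_. borel) X UNIV"
    and X_distr: "\<And>j. distr M borel (X j) = distr M borel Z"
begin

lemma X_measurable [measurable]: "X j \<in> borel_measurable M"
  using X_indep by (auto simp: indep_vars_def2)

lemma nn_integral_X: "g \<in> borel_measurable borel \<Longrightarrow> (\<integral>\<^sup>+\<omega>. g (X j \<omega>) \<partial>M) = (\<integral>\<^sup>+\<omega>. g (Z \<omega>) \<partial>M)"
  using nn_integral_distr[of "X j" M borel g] nn_integral_distr[of Z M borel g] by (simp add: X_distr)

lemma integrable_X: "g \<in> borel_measurable borel \<Longrightarrow> integrable M (\<lambda>\<omega>. g (X j \<omega>) :: real) \<longleftrightarrow> integrable M (\<lambda>\<omega>. g (Z \<omega>))"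
  using integrable_distr_eq[of "X j" M borel g] integrable_distr_eq[of Z M borel g] by (simp add: X_distr)

lemma expectation_X: "g \<in> borel_measurable borel \<Longrightarrow> expectation (\<lambda>\<omega>. g (X j \<omega>) :: real) = expectation (\<lambda>\<omega>. g (Z \<omega>))"
  using integral_distr[of "X j" M borel g] integral_distr[of Z M borel g] by (simp add: X_distr)

text \<open>Markov's inequality for the exponential of the sum; the free parameter of the usual
  bound is contained in the weights \<theta>.\<close>

lemma Chernoff_bound:
  assumes J: "finite J" and \<theta>0: "\<theta>0 \<le> rad / 2"
    and mgf_le: "\<And>\<theta>. \<bar>\<theta>\<bar> \<le> \<theta>0 \<Longrightarrow> mgf \<theta> \<le> exp ((1 + \<eta>) / 2 * (\<sigma>\<^sup>2 * \<theta>\<^sup>2))"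
    and \<theta>: "\<And>j. j \<in> J \<Longrightarrow> \<bar>\<theta> j\<bar> \<le> \<theta>0"
  shows "prob {\<omega> \<in> space M. x \<le> (\<Sum>j\<in>J. \<theta> j * X j \<omega>)} \<le> exp ((1 + \<eta>) / 2 * (\<sigma>\<^sup>2 * (\<Sum>j\<in>J. (\<theta> j)\<^sup>2)) - x)"
proof -
  have int: "integrable M (\<lambda>\<omega>. exp (\<theta> j * X j \<omega>))" if "j \<in> J" for j
    using integrable_X[of "\<lambda>z. exp (\<theta> j * z)" j] mgf_estimates(1)[of "\<theta> j"] \<theta>[OF that] \<theta>0 by simp
  have ind: "indep_vars (\<lambda>_. borel) (\<lambda>j \<omega>. exp (\<theta> j * X j \<omega>)) J"
    by (rule indep_vars_compose2[OF indep_vars_subset[OF X_indep], of J "\<lambda>j z. exp (\<theta> j * z)"]) auto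
  have eq: "exp (\<Sum>j\<in>J. \<theta> j * X j \<omega>) = (\<Prod>j\<in>J. exp (\<theta> j * X j \<omega>))" for \<omega>
    using J by (rule exp_sum)
  have "prob {\<omega> \<in> space M. x \<le> (\<Sum>j\<in>J. \<theta> j * X j \<omega>)} =
      prob {\<omega> \<in> space M. exp x \<le> (\<Prod>j\<in>J. exp (\<theta> j * X j \<omega>))}"
    unfolding eq[symmetric] by simp
  also have "\<dots> \<le> expectation (\<lambda>\<omega>. \<Prod>j\<in>J. exp (\<theta> j * X j \<omega>)) / exp x"
    by (rule integral_Markov_inequality_measure[OF indep_vars_integrable[OF J ind int], of "{}"])
       (auto intro!: prod_nonneg AE_I2)
  also have "expectation (\<lambda>\<omega>. \<Prod>j\<in>J. exp (\<theta> j * X j \<omega>)) = (\<Prod>j\<in>J. mgf (\<theta> j))"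
  proof -
    have "expectation (\<lambda>\<omega>. \<Prod>j\<in>J. exp (\<theta> j * X j \<omega>)) = (\<Prod>j\<in>J. expectation (\<lambda>\<omega>. exp (\<theta> j * X j \<omega>)))"
      by (rule indep_vars_lebesgue_integral[OF J ind int])
    also have "\<dots> = (\<Prod>j\<in>J. mgf (\<theta> j))"
      unfolding mgf_def by (intro prod.cong refl expectation_X) auto
    finally show ?thesis .
  qed
  also have "(\<Prod>j\<in>J. mgf (\<theta> j)) \<le> (\<Prod>j\<in>J. exp ((1 + \<eta>) / 2 * (\<sigma>\<^sup>2 * (\<theta> j)\<^sup>2)))"
    by (intro prod_mono conjI mgf_le \<theta>) (auto simp: mgf_def)
  also have "(\<Prod>j\<in>J. exp ((1 + \<eta>) / 2 * (\<sigma>\<^sup>2 * (\<theta> j)\<^sup>2))) = exp ((1 + \<eta>) / 2 * (\<sigma>\<^sup>2 * (\<Sum>j\<in>J. (\<theta> j)\<^sup>2)))"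
    using J by (simp add: exp_sum[symmetric] sum_distrib_left)
  finally show ?thesis by (simp add: exp_diff divide_right_mono)
qed

text \<open>Tilting by \<open>h j * b j / a\<close> moves the mean of \<open>b j * X j\<close> to
  about \<open>h j * (\<sigma>\<^sup>2 * (b j)\<^sup>2 / a)\<close>. Consider the event that the
  path is close to this drift and the exponent of the density close to its mean. Its tilted
  probability is at least 1/2: the two terms of \<open>var\<close> bound the failure of the first
  and of the second requirement. On it the density is bounded, which transfers the estimate to the
  original law.\<close>

theorem tilted_lower_bound:
  fixes b h :: "nat \<Rightarrow> real"
  assumes a: "a > 0" and b: "\<sigma>\<^sup>2 * (\<Sum>j=1..N. (b j)\<^sup>2) = a" and h: "\<And>j. \<bar>h j\<bar> \<le> H"
    and \<eta>: "0 < \<eta>" "\<eta> \<le> 1" "\<eta> * H \<le> \<delta> / 2" "\<eta> * H\<^sup>2 \<le> \<delta> / 2" and \<delta>: "\<delta> > 0"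
    and \<theta>0: "\<theta>0 \<le> rad / 2"
    and mgf_ge: "\<And>\<theta>. \<bar>\<theta>\<bar> \<le> \<theta>0 \<Longrightarrow> mgf \<theta> \<ge> exp ((1 - \<eta>) / 2 * (\<sigma>\<^sup>2 * \<theta>\<^sup>2))"
    and mean: "\<And>\<theta>. \<bar>\<theta>\<bar> \<le> \<theta>0 \<Longrightarrow> \<bar>expectation (\<lambda>\<omega>. Z \<omega> * exp (\<theta> * Z \<omega>)) / mgf \<theta> - \<sigma>\<^sup>2 * \<theta>\<bar> \<le> \<eta> * (\<sigma>\<^sup>2 * \<bar>\<theta>\<bar>)"
    and small: "\<And>j. j \<in> {1..N} \<Longrightarrow> \<bar>h j * b j / a\<bar> \<le> \<theta>0"
    and var: "3 * (cum * a / \<sigma>\<^sup>2 / (\<delta> / 6)\<^sup>2) + H\<^sup>2 * cum * a / \<sigma>\<^sup>2 / (\<delta> / 2)\<^sup>2 \<le> 1 / 2"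
  defines "A \<equiv> (\<Sum>j=1..N. (h j)\<^sup>2 * (\<sigma>\<^sup>2 * (b j)\<^sup>2 / a))"
  shows "prob {\<omega> \<in> space M. \<forall>l\<le>N. \<bar>(\<Sum>j=1..l. b j * X j \<omega>) - (\<Sum>j=1..l. h j * (\<sigma>\<^sup>2 * (b j)\<^sup>2 / a))\<bar> < \<delta>}
    \<ge> 1 / 2 * exp (- ((1 + \<eta>) / 2 * A + \<delta>) / a)"
proof -
  define \<theta> where "\<theta> j = h j * b j / a" for j
  have \<theta>: "\<bar>\<theta> j\<bar> \<le> \<theta>0" if "j \<in> {1..N}" for j using small[OF that] by (simp add: \<theta>_def)
  have mgf1: "mgf (\<theta> j) \<ge> 1" if "j \<in> {1..N}" for j
  proof -
    have "0 \<le> (1 - \<eta>) / 2 * (\<sigma>\<^sup>2 * (\<theta> j)\<^sup>2)" using \<eta> by simp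
    then have "1 \<le> exp ((1 - \<eta>) / 2 * (\<sigma>\<^sup>2 * (\<theta> j)\<^sup>2))" by simp
    then show ?thesis using mgf_ge[OF \<theta>[OF that]] by linarith
  qed
  define f where "f j z = exp (\<theta> j * z) / mgf (\<theta> j)" for j z
  have f_meas [measurable]: "f j \<in> borel_measurable borel" for j by (simp add: f_def[abs_def])
  have f_nonneg: "0 \<le> f j z" if "j \<in> {1..N}" for j z using mgf1[OF that] by (simp add: f_def)
  have indI: "indep_vars (\<lambda>_. borel) X {1..N}" by (rule indep_vars_subset[OF X_indep]) simp
  have est: "integrable M (\<lambda>\<omega>. exp (\<theta> j * Z \<omega>))" "integrable M (\<lambda>\<omega>. Z \<omega> * exp (\<theta> j * Z \<omega>))"
      "integrable M (\<lambda>\<omega>. (Z \<omega>)\<^sup>2 * exp (\<theta> j * Z \<omega>))" "expectation (\<lambda>\<omega>. (Z \<omega>)\<^sup>2 * exp (\<theta> j * Z \<omega>)) \<le> cum"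
    if "j \<in> {1..N}" for j using mgf_estimates[OF order_trans[OF \<theta>[OF that] \<theta>0]] by auto
  have f_int: "(\<integral>\<^sup>+\<omega>. ennreal (f j (X j \<omega>)) \<partial>M) = 1" if j: "j \<in> {1..N}" for j
  proof -
    have "(\<integral>\<^sup>+\<omega>. ennreal (f j (X j \<omega>)) \<partial>M) = (\<integral>\<^sup>+\<omega>. ennreal (f j (Z \<omega>)) \<partial>M)"
      by (rule nn_integral_X) measurable
    also have "\<dots> = ennreal (expectation (\<lambda>\<omega>. f j (Z \<omega>)))"
      by (rule nn_integral_eq_integral) (use est(1)[OF j] f_nonneg[OF j] in \<open>auto simp: f_def\<close>)
    also have "expectation (\<lambda>\<omega>. f j (Z \<omega>)) = 1"
      using mgf1[OF j] by (simp add: f_def mgf_def)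
    finally show ?thesis by simp
  qed
  define Q where "Q = tilted M X f {1..N}"
  note ctx = finite_atLeastAtMost[of 1 N] indI f_meas f_nonneg f_int
  have spQ: "space Q = space M" and setsQ [measurable_cong]: "sets Q = sets M" by (simp_all add: Q_def tilted_def)
  interpret Q: prob_space Q unfolding Q_def by (rule prob_space_tilted[OF ctx])
  have indQ: "Q.indep_vars (\<lambda>_. borel) X {1..N}" unfolding Q_def by (rule indep_vars_tilted[OF ctx])
  \<comment> \<open>Moments under the tilted law are computed from the reweighted law of one
    variable, hence from expectations of \<open>Z\<close>.\<close>
  have distrQ: "distr Q borel (X j) = density (distr M borel Z) (\<lambda>z. ennreal (f j z))" if j: "j \<in> {1..N}" for j
  proof (rule measure_eqI)
    fix B assume "B \<in> sets (distr Q borel (X j))"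
    then have B[measurable]: "B \<in> sets borel" by simp
    have "emeasure (distr Q borel (X j)) B = (\<integral>\<^sup>+z. indicator B z \<partial>distr Q borel (X j))" by simp
    also have "\<dots> = (\<integral>\<^sup>+\<omega>. indicator B (X j \<omega>) \<partial>Q)" by (rule nn_integral_distr) measurable
    also have "\<dots> = (\<integral>\<^sup>+\<omega>. ennreal (f j (X j \<omega>)) * indicator B (X j \<omega>) \<partial>M)"
      unfolding Q_def by (rule nn_integral_tilted[OF ctx j, of "indicator B"]) measurable
    also have "\<dots> = (\<integral>\<^sup>+z. ennreal (f j z) * indicator B z \<partial>distr M borel (X j))"
      by (rule nn_integral_distr[symmetric]) measurable
    also have "\<dots> = emeasure (density (distr M borel Z) (\<lambda>z. ennreal (f j z))) B"
      unfolding X_distr by (rule emeasure_density[symmetric]) measurable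
    finally show "emeasure (distr Q borel (X j)) B = emeasure (density (distr M borel Z) (\<lambda>z. ennreal (f j z))) B" .
  qed simp
  have Q_integrable: "integrable Q (\<lambda>\<omega>. g (X j \<omega>)) \<longleftrightarrow> integrable M (\<lambda>\<omega>. f j (Z \<omega>) * g (Z \<omega>))"
    and Q_expectation: "Q.expectation (\<lambda>\<omega>. g (X j \<omega>)) = expectation (\<lambda>\<omega>. f j (Z \<omega>) * g (Z \<omega>))"
    if j: "j \<in> {1..N}" and g[measurable]: "g \<in> borel_measurable borel" for j and g :: "real \<Rightarrow> real"
  proof -
    have "integrable Q (\<lambda>\<omega>. g (X j \<omega>)) \<longleftrightarrow> integrable (distr Q borel (X j)) g"
      by (rule integrable_distr_eq[symmetric]) measurable
    also have "\<dots> \<longleftrightarrow> integrable (distr M borel Z) (\<lambda>z. f j z * g z)"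
      unfolding distrQ[OF j] using f_nonneg[OF j] by (subst integrable_density) auto
    also have "\<dots> \<longleftrightarrow> integrable M (\<lambda>\<omega>. f j (Z \<omega>) * g (Z \<omega>))"
      by (rule integrable_distr_eq) measurable
    finally show "integrable Q (\<lambda>\<omega>. g (X j \<omega>)) \<longleftrightarrow> integrable M (\<lambda>\<omega>. f j (Z \<omega>) * g (Z \<omega>))" .
    have "Q.expectation (\<lambda>\<omega>. g (X j \<omega>)) = integral\<^sup>L (distr Q borel (X j)) g"
      by (rule integral_distr[symmetric]) measurable
    also have "\<dots> = integral\<^sup>L (distr M borel Z) (\<lambda>z. f j z * g z)"
      unfolding distrQ[OF j] using f_nonneg[OF j] by (subst integral_density) auto
    also have "\<dots> = expectation (\<lambda>\<omega>. f j (Z \<omega>) * g (Z \<omega>))"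
      by (rule integral_distr) measurable
    finally show "Q.expectation (\<lambda>\<omega>. g (X j \<omega>)) = expectation (\<lambda>\<omega>. f j (Z \<omega>) * g (Z \<omega>))" .
  qed
  define \<mu> where "\<mu> j = expectation (\<lambda>\<omega>. Z \<omega> * exp (\<theta> j * Z \<omega>)) / mgf (\<theta> j)" for j
  have X1: "integrable Q (X j)" "Q.expectation (X j) = \<mu> j" if j: "j \<in> {1..N}" for j
    using Q_integrable[OF j, of "\<lambda>z. z"] Q_expectation[OF j, of "\<lambda>z. z"] est(2)[OF j]
    by (simp_all add: f_def \<mu>_def mult.commute)
  have X2: "integrable Q (\<lambda>\<omega>. (X j \<omega>)\<^sup>2)" "Q.expectation (\<lambda>\<omega>. (X j \<omega>)\<^sup>2) \<le> cum" if j: "j \<in> {1..N}" for j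
  proof -
    show "integrable Q (\<lambda>\<omega>. (X j \<omega>)\<^sup>2)"
      using Q_integrable[OF j, of "\<lambda>z. z\<^sup>2"] est(3)[OF j] by (simp add: f_def mult.commute)
    have "Q.expectation (\<lambda>\<omega>. (X j \<omega>)\<^sup>2) = expectation (\<lambda>\<omega>. (Z \<omega>)\<^sup>2 * exp (\<theta> j * Z \<omega>)) / mgf (\<theta> j)"
      using Q_expectation[OF j, of "\<lambda>z. z\<^sup>2"] by (simp add: f_def mult.commute)
    also have "\<dots> \<le> expectation (\<lambda>\<omega>. (Z \<omega>)\<^sup>2 * exp (\<theta> j * Z \<omega>)) / 1"
      using mgf1[OF j] by (intro divide_left_mono) auto
    finally show "Q.expectation (\<lambda>\<omega>. (X j \<omega>)\<^sup>2) \<le> cum" using est(4)[OF j] by simp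
  qed
  have tail: "Q.prob {\<omega> \<in> space Q. t \<le> \<bar>\<Sum>j=1..l. w j * (X j \<omega> - \<mu> j)\<bar>} \<le> (\<Sum>j=1..l. (w j)\<^sup>2 * cum) / t\<^sup>2"
    if l: "l \<le> N" and t: "t > 0" for l t and w :: "nat \<Rightarrow> real"
  proof (rule Q.indep_centered_sum_Chebyshev[OF _ _ _ _ _ _ t])
    show "Q.indep_vars (\<lambda>_. borel) (\<lambda>j \<omega>. w j * (X j \<omega> - \<mu> j)) {1..l}"
      by (rule Q.indep_vars_compose2[OF Q.indep_vars_subset[OF indQ], of "{1..l}" "\<lambda>j x. w j * (x - \<mu> j)"])
         (use l in auto)
    fix j assume "j \<in> {1..l}"
    then have j: "j \<in> {1..N}" using l by auto
    show "integrable Q (\<lambda>\<omega>. w j * (X j \<omega> - \<mu> j))" using X1[OF j] by simp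
    show "Q.expectation (\<lambda>\<omega>. w j * (X j \<omega> - \<mu> j)) = 0" using X1[OF j] by (simp add: Q.prob_space)
    have eq: "(w j * (X j \<omega> - \<mu> j))\<^sup>2 = (w j)\<^sup>2 * ((X j \<omega>)\<^sup>2 - 2 * \<mu> j * X j \<omega> + (\<mu> j)\<^sup>2)" for \<omega>
      by (simp add: power2_eq_square algebra_simps)
    show "integrable Q (\<lambda>\<omega>. (w j * (X j \<omega> - \<mu> j))\<^sup>2)" unfolding eq using X1[OF j] X2[OF j] by simp
    have "Q.expectation (\<lambda>\<omega>. (w j * (X j \<omega> - \<mu> j))\<^sup>2) = (w j)\<^sup>2 * (Q.expectation (\<lambda>\<omega>. (X j \<omega>)\<^sup>2) - (\<mu> j)\<^sup>2)"
      unfolding eq using X1[OF j] X2[OF j] by (simp add: Q.prob_space power2_eq_square)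
    also have "\<dots> \<le> (w j)\<^sup>2 * cum"
      using X2(2)[OF j] by (intro mult_left_mono) (auto intro: order_trans[of _ "Q.expectation (\<lambda>\<omega>. (X j \<omega>)\<^sup>2)"])
    finally show "Q.expectation (\<lambda>\<omega>. (w j * (X j \<omega> - \<mu> j))\<^sup>2) \<le> (w j)\<^sup>2 * cum" .
  qed simp
  have sb: "(\<Sum>j=1..N. (b j)\<^sup>2) = a / \<sigma>\<^sup>2" using b \<sigma>_pos by (simp add: field_simps)
  \<comment> \<open>Half of \<delta> is for the fluctuation and half for the bias; the factor 3 of
    Etemadi's inequality turns \<open>\<delta> / 6\<close> into \<open>\<delta> / 2\<close>.\<close>
  let ?B1 = "{\<omega> \<in> space Q. \<exists>l\<le>N. 3 * (\<delta> / 6) \<le> \<bar>\<Sum>j=1..l. b j * (X j \<omega> - \<mu> j)\<bar>}"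
  let ?B2 = "{\<omega> \<in> space Q. \<delta> / 2 \<le> \<bar>\<Sum>j=1..N. h j * b j * (X j \<omega> - \<mu> j)\<bar>}"
  have B1: "Q.prob ?B1 \<le> 3 * (cum * a / \<sigma>\<^sup>2 / (\<delta> / 6)\<^sup>2)"
  proof (rule Q.Etemadi_inequality)
    show "Q.indep_vars (\<lambda>_. borel) (\<lambda>j \<omega>. b j * (X j \<omega> - \<mu> j)) {1..N}"
      by (rule Q.indep_vars_compose2[OF indQ, of "\<lambda>j x. b j * (x - \<mu> j)"]) auto
    fix l assume l: "l \<le> N"
    have "Q.prob {\<omega> \<in> space Q. \<delta> / 6 \<le> \<bar>\<Sum>j=1..l. b j * (X j \<omega> - \<mu> j)\<bar>} \<le> (\<Sum>j=1..l. (b j)\<^sup>2 * cum) / (\<delta> / 6)\<^sup>2"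
      using l \<delta> by (intro tail) auto
    also have "\<dots> \<le> (\<Sum>j=1..N. (b j)\<^sup>2 * cum) / (\<delta> / 6)\<^sup>2"
      using l cum_pos by (intro divide_right_mono sum_mono2) auto
    also have "(\<Sum>j=1..N. (b j)\<^sup>2 * cum) = cum * a / \<sigma>\<^sup>2"
      using sb by (simp add: sum_distrib_right[symmetric])
    finally show "Q.prob {\<omega> \<in> space Q. \<delta> / 6 \<le> \<bar>\<Sum>j=1..l. b j * (X j \<omega> - \<mu> j)\<bar>} \<le> cum * a / \<sigma>\<^sup>2 / (\<delta> / 6)\<^sup>2" .
  qed
  have B2: "Q.prob ?B2 \<le> H\<^sup>2 * cum * a / \<sigma>\<^sup>2 / (\<delta> / 2)\<^sup>2"
  proof -
    have "Q.prob ?B2 \<le> (\<Sum>j=1..N. (h j * b j)\<^sup>2 * cum) / (\<delta> / 2)\<^sup>2"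
      using \<delta> by (intro tail) auto
    also have "\<dots> \<le> (\<Sum>j=1..N. H\<^sup>2 * (b j)\<^sup>2 * cum) / (\<delta> / 2)\<^sup>2"
    proof (intro divide_right_mono sum_mono)
      fix j
      have "(h j)\<^sup>2 \<le> H\<^sup>2" using h[of j] by (metis abs_ge_zero power2_abs power_mono)
      then show "(h j * b j)\<^sup>2 * cum \<le> H\<^sup>2 * (b j)\<^sup>2 * cum"
        using cum_pos by (simp add: power_mult_distrib mult_right_mono)
    qed simp
    also have "(\<Sum>j=1..N. H\<^sup>2 * (b j)\<^sup>2 * cum) = H\<^sup>2 * cum * a / \<sigma>\<^sup>2"
      using sb by (simp add: sum_distrib_right[symmetric] sum_distrib_left[symmetric])
    finally show ?thesis .
  qed
  define d where "d j = \<sigma>\<^sup>2 * (b j)\<^sup>2 / a" for j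
  have d: "d j \<ge> 0" for j using a by (simp add: d_def)
  have sd: "(\<Sum>j=1..N. d j) = 1" using a b by (simp add: d_def sum_divide_distrib[symmetric] sum_distrib_left[symmetric])
  have bias: "\<bar>b j * \<mu> j - h j * d j\<bar> \<le> \<eta> * (\<bar>h j\<bar> * d j)" if j: "j \<in> {1..N}" for j
  proof -
    have "\<bar>b j * \<mu> j - h j * d j\<bar> = \<bar>b j\<bar> * \<bar>\<mu> j - \<sigma>\<^sup>2 * \<theta> j\<bar>"
      by (simp add: abs_mult[symmetric] d_def \<theta>_def power2_eq_square algebra_simps)
    also have "\<dots> \<le> \<bar>b j\<bar> * (\<eta> * (\<sigma>\<^sup>2 * \<bar>\<theta> j\<bar>))"
      using mean[OF \<theta>[OF j]] by (intro mult_left_mono) (auto simp: \<mu>_def)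
    also have "\<dots> = \<eta> * (\<bar>h j\<bar> * d j)"
      using a by (simp add: d_def \<theta>_def abs_mult power2_eq_square abs_divide mult_ac)
    finally show ?thesis .
  qed
  \<comment> \<open>Applied with weights 1 to the path and with weights \<open>h\<close> to the
    exponent of the density; these are the sources of the conditions on \<open>\<eta> * H\<close>
    and \<open>\<eta> * H\<^sup>2\<close>.\<close>
  have bias_sum: "\<bar>(\<Sum>j=1..l. w j * (b j * \<mu> j)) - (\<Sum>j=1..l. w j * (h j * d j))\<bar> \<le> \<eta> * (V * H)"
    if l: "l \<le> N" and w: "\<And>j. \<bar>w j\<bar> \<le> V" for l V and w :: "nat \<Rightarrow> real"
  proof -
    have V: "V \<ge> 0" using w[of 0] by simp
    have "\<bar>(\<Sum>j=1..l. w j * (b j * \<mu> j)) - (\<Sum>j=1..l. w j * (h j * d j))\<bar> =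
        \<bar>\<Sum>j=1..l. w j * (b j * \<mu> j - h j * d j)\<bar>"
      by (simp add: sum_subtractf right_diff_distrib)
    also have "\<dots> \<le> (\<Sum>j=1..l. \<bar>w j * (b j * \<mu> j - h j * d j)\<bar>)" by (rule sum_abs)
    also have "\<dots> \<le> (\<Sum>j=1..l. V * (\<eta> * (H * d j)))"
    proof (rule sum_mono)
      fix j assume "j \<in> {1..l}"
      then have j: "j \<in> {1..N}" using l by auto
      have "\<bar>b j * \<mu> j - h j * d j\<bar> \<le> \<eta> * (H * d j)"
        using bias[OF j] mult_left_mono[OF mult_right_mono[OF h[of j] d[of j]], of \<eta>] \<eta> by linarith
      then show "\<bar>w j * (b j * \<mu> j - h j * d j)\<bar> \<le> V * (\<eta> * (H * d j))"
        unfolding abs_mult using w[of j] V by (intro mult_mono) auto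
    qed
    also have "\<dots> = \<eta> * (V * H) * (\<Sum>j=1..l. d j)" by (simp add: sum_distrib_left mult_ac)
    also have "\<dots> \<le> \<eta> * (V * H) * (\<Sum>j=1..N. d j)"
      using l d \<eta> V h[of 0] by (intro mult_left_mono sum_mono2) (auto intro!: mult_nonneg_nonneg)
    finally show ?thesis unfolding sd by simp
  qed
  let ?W = "{\<omega> \<in> space M. \<forall>l\<le>N. \<bar>(\<Sum>j=1..l. b j * X j \<omega>) - (\<Sum>j=1..l. h j * d j)\<bar> < \<delta>}"
  \<comment> \<open>The second requirement controls the random exponent of the density, without
    which closeness of the path would give no bound on the density.\<close>
  let ?G = "{\<omega> \<in> space M. (\<forall>l\<le>N. \<bar>(\<Sum>j=1..l. b j * X j \<omega>) - (\<Sum>j=1..l. h j * d j)\<bar> < \<delta>) \<and>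
      \<bar>(\<Sum>j=1..N. h j * b j * X j \<omega>) - A\<bar> < \<delta>}"
  have A_eq: "A = (\<Sum>j=1..N. h j * (h j * d j))" by (simp add: A_def d_def power2_eq_square mult.assoc)
  have Gm: "?G \<in> sets M" by measurable
  have G0m: "?W \<in> sets M" by measurable
  have B1m: "?B1 \<in> sets Q" and B2m: "?B2 \<in> sets Q" by measurable
  have cover: "space Q - ?G \<subseteq> ?B1 \<union> ?B2"
  proof
    fix \<omega> assume \<omega>: "\<omega> \<in> space Q - ?G"
    show "\<omega> \<in> ?B1 \<union> ?B2"
    proof (rule ccontr)
      assume n: "\<omega> \<notin> ?B1 \<union> ?B2"
      have "\<bar>(\<Sum>j=1..l. b j * X j \<omega>) - (\<Sum>j=1..l. h j * d j)\<bar> < \<delta>" if l: "l \<le> N" for l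
      proof -
        have "\<not> (3 * (\<delta> / 6) \<le> \<bar>\<Sum>j=1..l. b j * (X j \<omega> - \<mu> j)\<bar>)" using n \<omega> l by blast
        then have "\<bar>(\<Sum>j=1..l. b j * X j \<omega>) - (\<Sum>j=1..l. b j * \<mu> j)\<bar> < \<delta> / 2"
          by (simp add: sum_subtractf right_diff_distrib)
        moreover have "\<bar>(\<Sum>j=1..l. b j * \<mu> j) - (\<Sum>j=1..l. h j * d j)\<bar> \<le> \<delta> / 2"
          using bias_sum[OF l, of "\<lambda>_. 1" 1] \<eta>(3) by simp
        ultimately show ?thesis by linarith
      qed
      moreover have "\<bar>(\<Sum>j=1..N. h j * b j * X j \<omega>) - A\<bar> < \<delta>"
      proof -
        have "\<not> (\<delta> / 2 \<le> \<bar>\<Sum>j=1..N. h j * b j * (X j \<omega> - \<mu> j)\<bar>)" using n \<omega> by blast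
        then have "\<bar>(\<Sum>j=1..N. h j * b j * X j \<omega>) - (\<Sum>j=1..N. h j * (b j * \<mu> j))\<bar> < \<delta> / 2"
          by (simp add: sum_subtractf right_diff_distrib mult.assoc)
        moreover have "\<bar>(\<Sum>j=1..N. h j * (b j * \<mu> j)) - A\<bar> \<le> \<delta> / 2"
          unfolding A_eq using bias_sum[of N h H, OF order_refl h] \<eta>(4) by (simp add: power2_eq_square)
        ultimately show ?thesis by linarith
      qed
      ultimately show False using \<omega> spQ by blast
    qed
  qed
  have "Q.prob (space Q - ?G) \<le> Q.prob (?B1 \<union> ?B2)"
    using cover B1m B2m by (intro Q.finite_measure_mono) auto
  also have "\<dots> \<le> Q.prob ?B1 + Q.prob ?B2" by (rule measure_Un_le[OF B1m B2m])
  also have "\<dots> \<le> 1 / 2" using B1 B2 var by linarith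
  finally have QG: "Q.prob ?G \<ge> 1 / 2" using Q.prob_compl[of ?G] Gm setsQ by simp
  define C where "C = exp (((1 + \<eta>) / 2 * A + \<delta>) / a)"
  have dens: "(\<Prod>j\<in>{1..N}. f j (X j \<omega>)) \<le> C" if "\<omega> \<in> ?G" for \<omega>
  proof -
    have "(\<Prod>j\<in>{1..N}. f j (X j \<omega>)) = exp (\<Sum>j\<in>{1..N}. \<theta> j * X j \<omega>) / (\<Prod>j\<in>{1..N}. mgf (\<theta> j))"
      by (simp add: f_def prod_dividef exp_sum)
    \<comment> \<open>The random exponent costs \<open>A / a\<close> up to \<delta>, and the
      normalising constants return almost half of it; the net cost \<open>A / 2\<close> is the
      discretised rate.\<close>
    also have "\<dots> \<le> exp ((A + \<delta>) / a) / exp ((1 - \<eta>) / 2 * (A / a))"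
    proof (intro frac_le)
      have "(\<Sum>j\<in>{1..N}. \<theta> j * X j \<omega>) = (\<Sum>j=1..N. h j * b j * X j \<omega>) / a"
        by (simp add: \<theta>_def sum_divide_distrib)
      also have "\<dots> \<le> (A + \<delta>) / a" using that a by (intro divide_right_mono) auto
      finally show "exp (\<Sum>j\<in>{1..N}. \<theta> j * X j \<omega>) \<le> exp ((A + \<delta>) / a)" by simp
      have "(\<Sum>j=1..N. \<sigma>\<^sup>2 * (\<theta> j)\<^sup>2) = A / a"
        unfolding A_def sum_divide_distrib
        by (intro sum.cong refl) (simp add: \<theta>_def power_mult_distrib power_divide power2_eq_square)
      then have "exp ((1 - \<eta>) / 2 * (A / a)) = (\<Prod>j\<in>{1..N}. exp ((1 - \<eta>) / 2 * (\<sigma>\<^sup>2 * (\<theta> j)\<^sup>2)))"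
        by (simp only: exp_sum[symmetric] sum_distrib_left[symmetric] finite_atLeastAtMost)
      also have "\<dots> \<le> (\<Prod>j\<in>{1..N}. mgf (\<theta> j))"
        by (intro prod_mono conjI mgf_ge \<theta>) auto
      finally show "exp ((1 - \<eta>) / 2 * (A / a)) \<le> (\<Prod>j\<in>{1..N}. mgf (\<theta> j))" .
    qed auto
    also have "\<dots> = exp ((A + \<delta>) / a - (1 - \<eta>) / 2 * (A / a))" by (simp add: exp_diff)
    also have "(A + \<delta>) / a - (1 - \<eta>) / 2 * (A / a) = ((1 + \<eta>) / 2 * A + \<delta>) / a"
      using a by (simp add: field_simps)
    finally show ?thesis by (simp add: C_def)
  qed
  have "ennreal (Q.prob ?G) = emeasure Q ?G" by (simp add: Q.emeasure_eq_measure)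
  also have "\<dots> = (\<integral>\<^sup>+\<omega>. ennreal (\<Prod>j\<in>{1..N}. f j (X j \<omega>)) * indicator ?G \<omega> \<partial>M)"
    unfolding Q_def tilted_def by (rule emeasure_density[OF _ Gm]) measurable
  also have "\<dots> \<le> (\<integral>\<^sup>+\<omega>. ennreal C * indicator ?G \<omega> \<partial>M)"
    using dens by (intro nn_integral_mono) (auto simp: indicator_def intro!: ennreal_leI)
  also have "\<dots> = ennreal C * emeasure M ?G" by (rule nn_integral_cmult_indicator[OF Gm])
  also have "\<dots> = ennreal (C * prob ?G)"
    by (simp add: emeasure_eq_measure ennreal_mult[symmetric] C_def)
  finally have "Q.prob ?G \<le> C * prob ?G" by (simp add: C_def)
  then have "1 / 2 \<le> C * prob ?G" using QG by linarith
  also have "\<dots> \<le> C * prob ?W"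
    using G0m by (intro mult_left_mono finite_measure_mono) (auto simp: C_def)
  finally have "1 / 2 * inverse C \<le> prob ?W" by (simp add: C_def field_simps)
  moreover have "inverse C = exp (- ((1 + \<eta>) / 2 * A + \<delta>) / a)" by (simp only: C_def exp_minus[symmetric] minus_divide_left)
  ultimately show ?thesis by (simp add: d_def)
qed

end

section \<open>The moderate deviation principle\<close>

text \<open>A prefactor \<open>C\<close> enters only through \<open>a * ln C\<close>, which vanishes
  in the limit.\<close>

lemma ereal_scaled_log_ext_ge:
  assumes "C > 0" "a > 0" "C * exp (- x / a) \<le> p"
  shows "ereal (a * ln C - x) \<le> ereal a * log_ext p"
proof -
  have pos: "C * exp (- x / a) > 0" using assms(1) by simp
  then have p: "p > 0" using assms(3) by linarith
  have "ln (C * exp (- x / a)) \<le> ln p" using pos p assms(3) by simp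
  then have "ln C - x / a \<le> ln p" using assms(1) by (simp add: ln_mult)
  then have "a * (ln C - x / a) \<le> a * ln p" using assms(2) by (intro mult_left_mono) auto
  then show ?thesis using p assms(2) by (simp add: log_ext_def right_diff_distrib)
qed

lemma ereal_scaled_log_ext_le:
  assumes "C > 0" "a > 0" "p \<le> C * exp (- x / a)" "p \<ge> 0"
  shows "ereal a * log_ext p \<le> ereal (a * ln C - x)"
proof (cases "p = 0")
  case True
  then show ?thesis using assms(2) by (simp add: log_ext_def)
next
  case False
  have "ln p \<le> ln (C * exp (- x / a))" using assms False by simp
  then have "ln p \<le> ln C - x / a" using assms(1) by (simp add: ln_mult)
  then have "a * ln p \<le> a * (ln C - x / a)" using assms(2) by (intro mult_left_mono) auto
  then show ?thesis using False assms(2) by (simp add: log_ext_def right_diff_distrib)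
qed

text \<open>With at most one nonzero term the square has no mixed products.\<close>

lemma square_sum_disjoint:
  fixes w :: "'i \<Rightarrow> real"
  assumes "finite S" "\<And>i i'. i \<in> S \<Longrightarrow> i' \<in> S \<Longrightarrow> P i \<Longrightarrow> P i' \<Longrightarrow> i = i'"
  shows "(\<Sum>i\<in>S. if P i then w i else 0)\<^sup>2 = (\<Sum>i\<in>S. if P i then (w i)\<^sup>2 else 0)"
proof (cases "\<exists>i\<in>S. P i")
  case True
  then obtain i where i: "i \<in> S" "P i" by blast
  then have "P i' \<longleftrightarrow> i' = i" if "i' \<in> S" for i' using assms(2) that by blast
  then have "(\<Sum>i'\<in>S. if P i' then f i' else 0) = f i" for f :: "'i \<Rightarrow> real"
    using assms(1) i by (simp cong: sum.cong)
  then show ?thesis by simp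
next
  case False
  then have "(\<Sum>i'\<in>S. if P i' then f i' else 0) = 0" for f :: "'i \<Rightarrow> real" by (intro sum.neutral) auto
  then show ?thesis by simp
qed

locale mdp_array = prob_space M for M :: "'w measure" +
  fixes \<xi> :: "int \<Rightarrow> 'w \<Rightarrow> real" and \<sigma> K :: real and k :: "nat \<Rightarrow> nat"
    and c :: "nat \<Rightarrow> nat \<Rightarrow> real" and a :: "nat \<Rightarrow> real"
  assumes indep: "indep_vars (\<lambda>_. borel) \<xi> UNIV"
    and ident: "\<And>j. distr M borel (\<xi> j) = distr M borel (\<xi> 0)"
    and centered: "integrable M (\<xi> 0)" "(\<integral>\<omega>. \<xi> 0 \<omega> \<partial>M) = 0"
    and variance: "integrable M (\<lambda>\<omega>. (\<xi> 0 \<omega>)\<^sup>2)" "(\<integral>\<omega>. (\<xi> 0 \<omega>)\<^sup>2 \<partial>M) = \<sigma>\<^sup>2" "\<sigma>\<^sup>2 > 0"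
    and k_pos: "\<And>n. k n > 0"
    and s_pos: "\<And>n. s_sq \<sigma> c n (k n) > 0"
    and a_pos: "\<And>n. a n > 0"
    and a_lim: "a \<longlonglongrightarrow> 0"
    and negl: "(\<lambda>n. 1 / (sqrt (a n) * sqrt (s_sq \<sigma> c n (k n))) * (MAX j\<in>{1..k n}. \<bar>c n j\<bar>))
      \<longlonglongrightarrow> 0"
    and K_pos: "K > 0"
    and moments: "\<And>m::nat. (\<integral>\<^sup>+\<omega>. ennreal (\<bar>\<xi> 0 \<omega>\<bar> ^ m) \<partial>M) \<le> ennreal (fact m * K ^ m)"
begin

lemma \<xi>_measurable: "\<xi> j \<in> borel_measurable M"
  using indep by (auto simp: indep_vars_def2)

sublocale iid_subexponential M "\<xi> 0" \<sigma> K "\<lambda>j. \<xi> (int j)"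
proof unfold_locales
  show "indep_vars (\<lambda>_. borel) (\<lambda>j. \<xi> (int j)) UNIV"
    by (rule indep_vars_reindex_inj[OF _ indep]) (simp add: inj_def)
  show "distr M borel (\<xi> (int j)) = distr M borel (\<xi> 0)" for j by (rule ident)
qed (use \<xi>_measurable centered variance K_pos moments in auto)

text \<open>The path \<open>Y n\<close>, which is $\sqrt{a_n}W_n$, has increments \<open>b n j * \<xi> j\<close> at the times \<open>T n j\<close>, whose spacing
  \<open>inc n j\<close> is at most \<open>mesh n\<close>. The negligibility hypothesis says that \<open>eps n\<close>, which bounds
  \<open>\<bar>b n j\<bar> / a n\<close> and hence all tilting parameters, tends to \<open>0\<close>.\<close>

definition b :: "nat \<Rightarrow> nat \<Rightarrow> real" where "b n j = sqrt (a n) * c n j / sqrt (s_sq \<sigma> c n (k n))"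
definition T :: "nat \<Rightarrow> nat \<Rightarrow> real" where "T n j = s_sq \<sigma> c n j / s_sq \<sigma> c n (k n)"
definition inc :: "nat \<Rightarrow> nat \<Rightarrow> real" where "inc n j = \<sigma>\<^sup>2 * (b n j)\<^sup>2 / a n"
definition eps :: "nat \<Rightarrow> real" where
  "eps n = 1 / (sqrt (a n) * sqrt (s_sq \<sigma> c n (k n))) * (MAX j\<in>{1..k n}. \<bar>c n j\<bar>)"
definition mesh :: "nat \<Rightarrow> real" where "mesh n = \<sigma>\<^sup>2 * a n * (eps n)\<^sup>2"
definition PS :: "nat \<Rightarrow> nat \<Rightarrow> 'w \<Rightarrow> real" where "PS n l \<omega> = (\<Sum>j=1..l. b n j * \<xi> (int j) \<omega>)"
definition Y :: "nat \<Rightarrow> 'w \<Rightarrow> real \<Rightarrow> real" where "Y n \<omega> = (\<lambda>t\<in>{0..1}. sqrt (a n) * W_proc k c \<sigma> \<xi> n \<omega> t)"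
abbreviation idx :: "nat \<Rightarrow> real \<Rightarrow> nat" where "idx n \<equiv> W_index k c \<sigma> n"

lemma inc_eq: "inc n j = \<sigma>\<^sup>2 * (c n j)\<^sup>2 / s_sq \<sigma> c n (k n)"
  using a_pos[of n] s_pos[of n] by (simp add: inc_def b_def power_mult_distrib power_divide)

lemma inc_nonneg: "inc n j \<ge> 0" using a_pos[of n] by (simp add: inc_def)

lemma T_eq: "T n l = (\<Sum>j=1..l. inc n j)"
  by (simp add: T_def s_sq_def[of _ _ _ l] inc_eq sum_distrib_left sum_divide_distrib[symmetric])

lemma T_0: "T n 0 = 0" by (simp add: T_eq)
lemma T_k: "T n (k n) = 1" using s_pos[of n] by (simp add: T_def)

lemma T_Suc: "T n (Suc l) = T n l + inc n (Suc l)" by (simp add: T_eq)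

lemma T_mono: "l \<le> l' \<Longrightarrow> T n l \<le> T n l'"
  unfolding T_eq by (rule sum_mono2) (auto simp: inc_nonneg)

lemma T_range: "l \<le> k n \<Longrightarrow> 0 \<le> T n l \<and> T n l \<le> 1"
  using T_mono[of 0 l n] T_mono[of l "k n" n] by (simp add: T_0 T_k)

lemma b_sum: "\<sigma>\<^sup>2 * (\<Sum>j=1..k n. (b n j)\<^sup>2) = a n"
proof -
  have "(\<Sum>j=1..k n. inc n j) = 1" using T_k[of n] by (simp add: T_eq)
  then show ?thesis using a_pos[of n] by (simp add: inc_def sum_divide_distrib[symmetric] sum_distrib_left[symmetric])
qed

lemma b_le_eps:
  assumes j: "j \<in> {1..k n}"
  shows "\<bar>b n j\<bar> / a n \<le> eps n"
proof -
  have "\<bar>b n j\<bar> / a n = 1 / (sqrt (a n) * sqrt (s_sq \<sigma> c n (k n))) * \<bar>c n j\<bar>"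
    using a_pos[of n] s_pos[of n] real_sqrt_mult_self[of "a n"]
    by (simp add: b_def abs_mult field_simps)
  also have "\<dots> \<le> eps n" unfolding eps_def
    using j a_pos[of n] s_pos[of n] by (intro mult_left_mono Max_ge) auto
  finally show ?thesis .
qed

lemma eps_lim: "eps \<longlonglongrightarrow> 0" using negl by (simp add: eps_def[abs_def])

lemma mesh_nonneg: "mesh n \<ge> 0" using a_pos[of n] by (simp add: mesh_def)

lemma mesh_lim: "mesh \<longlonglongrightarrow> 0"
  unfolding mesh_def[abs_def] using a_lim eps_lim by (auto intro!: tendsto_eq_intros)

lemma inc_le_mesh:
  assumes j: "j \<in> {1..k n}"
  shows "inc n j \<le> mesh n"
proof -
  have "inc n j = \<sigma>\<^sup>2 * a n * (\<bar>b n j\<bar> / a n)\<^sup>2"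
    using a_pos[of n] by (simp add: inc_def power_divide power2_eq_square)
  also have "\<dots> \<le> mesh n" unfolding mesh_def
    using b_le_eps[OF j] a_pos[of n] by (intro mult_left_mono power_mono) auto
  finally show ?thesis .
qed

lemmas idx_props = W_index_props[where c = c and k = k and \<sigma> = \<sigma>, OF s_pos, folded T_def]

lemma idx_mono: "s \<le> t \<Longrightarrow> idx n s \<le> idx n t"
  unfolding W_index_def by (intro card_mono) auto

lemma T_idx:
  assumes "0 \<le> t" "t \<le> 1"
  shows "T n (idx n t) \<le> t" "t - T n (idx n t) \<le> mesh n"
proof -
  show le: "T n (idx n t) \<le> t" by (rule idx_props(2)[OF assms])
  show "t - T n (idx n t) \<le> mesh n"
  proof (cases "idx n t < k n")
    case True
    have "t < T n (Suc (idx n t))" using idx_props(3)[OF assms True] .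
    also have "\<dots> \<le> T n (idx n t) + mesh n" using inc_le_mesh[of "Suc (idx n t)" n] True by (simp add: T_Suc)
    finally show ?thesis by simp
  next
    case False
    then have "idx n t = k n" using idx_props(1)[OF assms, of n] by simp
    then show ?thesis using T_k[of n] assms mesh_nonneg[of n] by simp
  qed
qed

lemma PS_measurable [measurable]: "PS n l \<in> borel_measurable M"
  unfolding PS_def[abs_def] using \<xi>_measurable by measurable

lemma Y_eq: "t \<in> {0..1} \<Longrightarrow> Y n \<omega> t = PS n (idx n t) \<omega>"
  by (simp add: Y_def W_proc_eq_index[where c = c and k = k, OF s_pos] partial_sum_def PS_def b_def
      sum_distrib_left sum_divide_distrib mult_ac)

text \<open>Several indices may belong to time 0, but only if their coefficients vanish.\<close>

lemma Y_0: "Y n \<omega> 0 = 0"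
proof -
  have "(\<Sum>j=1..idx n 0. inc n j) \<le> 0" using T_idx(1)[of 0 n] by (simp add: T_eq)
  then have "(\<Sum>j=1..idx n 0. inc n j) = 0" using sum_nonneg[of "{1..idx n 0}" "inc n"] inc_nonneg by force
  then have "inc n j = 0" if "j \<in> {1..idx n 0}" for j
    using sum_nonneg_eq_0_iff[of "{1..idx n 0}" "inc n"] inc_nonneg that by blast
  then have "b n j = 0" if "j \<in> {1..idx n 0}" for j
    using that a_pos[of n] \<sigma>_pos by (force simp: inc_def)
  then show ?thesis by (simp add: Y_eq PS_def)
qed

lemma Y_scale: "Y n \<omega> = W_proc k c \<sigma> (\<lambda>j \<omega>. sqrt (a n) * \<xi> j \<omega>) n \<omega>"
  unfolding Y_def by (rule W_proc_scale)

lemma Y_cadlag01: "Y n \<omega> \<in> cadlag01"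
  unfolding Y_scale by (rule W_proc_cadlag01[where c = c and k = k, OF s_pos])

lemma Y_event:
  assumes "\<Gamma> \<in> sets D01_borel"
  shows "{\<omega> \<in> space M. Y n \<omega> \<in> \<Gamma>} \<in> events"
proof -
  have "Y n \<in> M \<rightarrow>\<^sub>M D01_borel"
    unfolding Y_scale[abs_def] using \<xi>_measurable by (intro W_proc_measurable s_pos) auto
  then have "Y n -` \<Gamma> \<inter> space M \<in> events" using assms by (rule measurable_sets)
  also have "Y n -` \<Gamma> \<inter> space M = {\<omega> \<in> space M. Y n \<omega> \<in> \<Gamma>}" by auto
  finally show ?thesis .
qed

section \<open>Lower bound\<close>

text \<open>A third of \<delta> each goes to the distance of \<open>y\<close> from \<open>z\<close>,
  to the distance of the partial sums from \<open>y\<close> at the grid times, and to the variation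
  of \<open>y\<close> between grid times. Half of \<epsilon> pays for the additive error \<delta>'
  in the exponent and half for the factor \<open>1 + \<eta>\<close>.\<close>

lemma lower_bound:
  assumes \<Gamma>: "\<Gamma> \<in> sets D01_borel" and z: "rate_fn z \<le> ereal \<alpha>" and \<delta>: "\<delta> > 0"
    and nbhd: "\<And>y. y \<in> cadlag01 \<Longrightarrow> (\<And>t. t \<in> {0..1} \<Longrightarrow> \<bar>y t - z t\<bar> \<le> \<delta>) \<Longrightarrow> y \<in> \<Gamma>"
    and \<epsilon>: "\<epsilon> > 0"
  shows "\<forall>\<^sub>F n in sequentially. 1 / 2 * exp (- (\<alpha> + \<epsilon>) / a n) \<le> prob {\<omega> \<in> space M. Y n \<omega> \<in> \<Gamma>}"
proof -
  have \<delta>3: "\<delta> / 3 > 0" using \<delta> by simp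
  obtain y R where R: "R > 0" and y0: "y 0 = 0" and yE: "energy_le (2 * \<alpha>) y"
    and yL: "\<And>s t. 0 \<le> s \<Longrightarrow> s \<le> t \<Longrightarrow> t \<le> 1 \<Longrightarrow> \<bar>y t - y s\<bar> \<le> R * (t - s)"
    and yz: "\<And>t. t \<in> {0..1} \<Longrightarrow> \<bar>y t - z t\<bar> \<le> \<delta> / 3"
    by (rule Lipschitz_approximation[OF z \<delta>3], rule that)
  have \<alpha>: "\<alpha> \<ge> 0" using energy_le_nonneg[OF yE] by simp
  define \<delta>' where "\<delta>' = min (\<delta> / 3) (\<epsilon> / 2)"
  have \<delta>': "\<delta>' > 0" "\<delta>' \<le> \<delta> / 3" "\<delta>' \<le> \<epsilon> / 2" unfolding \<delta>'_def using \<delta> \<epsilon> by linarith+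
  \<comment> \<open>In order: the range required by \<open>Gaussian_comparison\<close>, the two bias
    conditions of \<open>tilted_lower_bound\<close> with \<open>H = R\<close>, and the cost
    \<open>\<eta> * \<alpha> \<le> \<epsilon> / 2\<close>.\<close>
  define \<eta> where "\<eta> = Min {1, \<delta>' / 2 / R, \<delta>' / 2 / R\<^sup>2, \<epsilon> / 2 / (\<alpha> + 1)}"
  have \<eta>0: "\<eta> > 0" unfolding \<eta>_def using R \<delta>' \<epsilon> \<alpha> by (subst Min_gr_iff) auto
  have \<eta>le: "\<eta> \<le> x" if "x \<in> {1, \<delta>' / 2 / R, \<delta>' / 2 / R\<^sup>2, \<epsilon> / 2 / (\<alpha> + 1)}" for x
    unfolding \<eta>_def by (rule Min_le) (use that in auto)
  have \<eta>: "0 < \<eta>" "\<eta> \<le> 1" "\<eta> * R \<le> \<delta>' / 2" "\<eta> * R\<^sup>2 \<le> \<delta>' / 2" "\<eta> * (\<alpha> + 1) \<le> \<epsilon> / 2"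
  proof -
    have "\<eta> * (\<alpha> + 1) \<le> \<epsilon> / 2 / (\<alpha> + 1) * (\<alpha> + 1)" using \<alpha> by (intro mult_right_mono \<eta>le) auto
    also have "\<dots> = \<epsilon> / 2"
    proof -
      have "x / w * w = x" if "w > 0" for x w :: real using that by simp
      then show ?thesis using \<alpha> by (metis add_nonneg_pos zero_less_one)
    qed
    finally show "\<eta> * (\<alpha> + 1) \<le> \<epsilon> / 2" .
  qed (use \<eta>0 \<eta>le[of 1] mult_right_mono[OF \<eta>le[of "\<delta>' / 2 / R"], of R] mult_right_mono[OF \<eta>le[of "\<delta>' / 2 / R\<^sup>2"], of "R\<^sup>2"] R in simp_all)
  obtain \<theta>0 where \<theta>0: "\<theta>0 > 0" "\<theta>0 \<le> rad / 2"
    "\<And>\<theta>. \<bar>\<theta>\<bar> \<le> \<theta>0 \<Longrightarrow> mgf \<theta> \<le> exp ((1 + \<eta>) / 2 * (\<sigma>\<^sup>2 * \<theta>\<^sup>2))"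
    "\<And>\<theta>. \<bar>\<theta>\<bar> \<le> \<theta>0 \<Longrightarrow> mgf \<theta> \<ge> exp ((1 - \<eta>) / 2 * (\<sigma>\<^sup>2 * \<theta>\<^sup>2))"
    "\<And>\<theta>. \<bar>\<theta>\<bar> \<le> \<theta>0 \<Longrightarrow> \<bar>expectation (\<lambda>\<omega>. \<xi> 0 \<omega> * exp (\<theta> * \<xi> 0 \<omega>)) / mgf \<theta> - \<sigma>\<^sup>2 * \<theta>\<bar> \<le> \<eta> * (\<sigma>\<^sup>2 * \<bar>\<theta>\<bar>)"
    by (rule Gaussian_comparison[OF \<eta>(1,2)], rule that)
  have "(\<lambda>n. R * eps n) \<longlonglongrightarrow> R * 0" by (intro tendsto_intros eps_lim)
  then have ev1: "\<forall>\<^sub>F n in sequentially. R * eps n < \<theta>0" using \<theta>0(1) by (intro order_tendstoD) auto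
  have "(\<lambda>n. R * mesh n) \<longlonglongrightarrow> R * 0" by (intro tendsto_intros mesh_lim)
  then have ev2: "\<forall>\<^sub>F n in sequentially. R * mesh n < \<delta> / 3" using \<delta> by (intro order_tendstoD) auto
  have "(\<lambda>n. 3 * (cum * a n / \<sigma>\<^sup>2 / (\<delta>' / 6)\<^sup>2) + R\<^sup>2 * cum * a n / \<sigma>\<^sup>2 / (\<delta>' / 2)\<^sup>2) \<longlonglongrightarrow>
      3 * (cum * 0 / \<sigma>\<^sup>2 / (\<delta>' / 6)\<^sup>2) + R\<^sup>2 * cum * 0 / \<sigma>\<^sup>2 / (\<delta>' / 2)\<^sup>2"
    using \<sigma>_pos \<delta>' by (intro tendsto_intros a_lim) auto
  then have ev3: "\<forall>\<^sub>F n in sequentially. 3 * (cum * a n / \<sigma>\<^sup>2 / (\<delta>' / 6)\<^sup>2) + R\<^sup>2 * cum * a n / \<sigma>\<^sup>2 / (\<delta>' / 2)\<^sup>2 < 1 / 2"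
    by (intro order_tendstoD) auto
  from ev1 ev2 ev3 show ?thesis
  proof eventually_elim
    case (elim n)
    \<comment> \<open>slopes of \<open>y\<close> along the time grid; zero steps give the junk value \<open>0\<close>, as needed\<close>
    define h where "h j = (if j \<in> {1..k n} then (y (T n j) - y (T n (j - 1))) / inc n j else 0)" for j
    have Tj: "T n j = T n (j - 1) + inc n j" if "j \<in> {1..k n}" for j using T_Suc[of n "j - 1"] that by simp
    have Tr: "0 \<le> T n (j - 1)" "T n (j - 1) \<le> T n j" "T n j \<le> 1" if "j \<in> {1..k n}" for j
      using T_range[of "j - 1" n] T_range[of j n] T_mono[of "j - 1" j n] that by auto
    have hR: "\<bar>h j\<bar> \<le> R" for j
    proof (cases "j \<in> {1..k n} \<and> inc n j > 0")
      case True
      then have "\<bar>y (T n j) - y (T n (j - 1))\<bar> \<le> R * inc n j" using yL[OF Tr[of j]] Tj[of j] by simp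
      then show ?thesis using True by (simp add: h_def abs_divide pos_divide_le_eq)
    next
      case False
      then have "h j = 0" using inc_nonneg[of n j] by (auto simp: h_def)
      then show ?thesis using R by simp
    qed
    have hinc: "h j * inc n j = y (T n j) - y (T n (j - 1))" if j: "j \<in> {1..k n}" for j
      using j Tj[OF j] by (cases "inc n j = 0") (auto simp: h_def)
    have tele: "(\<Sum>j=1..l. h j * inc n j) = y (T n l)" if "l \<le> k n" for l
      using that
    proof (induction l)
      case 0
      then show ?case by (simp add: T_0 y0)
    next
      case (Suc l)
      then show ?case using hinc[of "Suc l"] by simp
    qed
    \<comment> \<open>The time grid is one of the interval families in \<open>energy_le\<close>, so
      the discretised energy is bounded for every \<open>n\<close> without a limit argument.\<close>
    have A: "(\<Sum>j=1..k n. (h j)\<^sup>2 * inc n j) \<le> 2 * \<alpha>"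
    proof -
      have "(\<Sum>i<k n. (y (T n (Suc i)) - y (T n i))\<^sup>2 / (T n (Suc i) - T n i)) \<le> 2 * \<alpha>"
      proof (rule energy_leD[OF yE])
        show "0 \<le> T n i \<and> T n i \<le> T n (Suc i) \<and> T n (Suc i) \<le> 1" if "i < k n" for i
          using Tr[of "Suc i"] that by simp
        show "disjoint_family_on (\<lambda>i. {T n i<..<T n (Suc i)}) {..<k n}"
          unfolding disjoint_family_on_def
        proof (intro ballI impI)
          fix i j :: nat assume "i \<noteq> j"
          have "T n (Suc i) \<le> T n j" if "i < j" for i j using T_mono[of "Suc i" j n] that by simp
          from this[of i j] this[of j i] \<open>i \<noteq> j\<close>
          show "{T n i<..<T n (Suc i)} \<inter> {T n j<..<T n (Suc j)} = {}"
            by (cases i j rule: linorder_cases) auto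
        qed
      qed
      also have "(\<Sum>i<k n. (y (T n (Suc i)) - y (T n i))\<^sup>2 / (T n (Suc i) - T n i)) = (\<Sum>i<k n. (h (Suc i))\<^sup>2 * inc n (Suc i))"
      proof (rule sum.cong)
        fix i assume "i \<in> {..<k n}"
        then have j: "Suc i \<in> {1..k n}" by auto
        show "(y (T n (Suc i)) - y (T n i))\<^sup>2 / (T n (Suc i) - T n i) = (h (Suc i))\<^sup>2 * inc n (Suc i)"
          using j by (cases "inc n (Suc i) = 0") (simp_all add: T_Suc h_def power2_eq_square)
      qed simp
      also have "\<dots> = (\<Sum>j=1..k n. (h j)\<^sup>2 * inc n j)"
        using sum.shift_bounds_Suc_ivl[of "\<lambda>j. (h j)\<^sup>2 * inc n j" 0 "k n"]
        by (simp add: atLeast0LessThan atLeastLessThanSuc_atLeastAtMost)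
      finally show ?thesis .
    qed
    let ?E = "{\<omega> \<in> space M. \<forall>l\<le>k n. \<bar>(\<Sum>j=1..l. b n j * \<xi> (int j) \<omega>) - (\<Sum>j=1..l. h j * (\<sigma>\<^sup>2 * (b n j)\<^sup>2 / a n))\<bar> < \<delta>'}"
    have "1 / 2 * exp (- ((1 + \<eta>) / 2 * (\<Sum>j=1..k n. (h j)\<^sup>2 * (\<sigma>\<^sup>2 * (b n j)\<^sup>2 / a n)) + \<delta>') / a n) \<le> prob ?E"
    proof (rule tilted_lower_bound[OF a_pos b_sum hR \<eta>(1,2,3,4) \<delta>'(1) \<theta>0(2,4,5)])
      show "\<bar>h j * b n j / a n\<bar> \<le> \<theta>0" if j: "j \<in> {1..k n}" for j
      proof -
        have "\<bar>h j * b n j / a n\<bar> = \<bar>h j\<bar> * (\<bar>b n j\<bar> / a n)" using a_pos[of n] by (simp add: abs_mult abs_divide)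
        also have "\<dots> \<le> R * eps n" using hR[of j] b_le_eps[OF j] R a_pos[of n] by (intro mult_mono) auto
        finally show ?thesis using elim(1) by simp
      qed
    qed (use elim(3) in auto)
    moreover have "1 / 2 * exp (- (\<alpha> + \<epsilon>) / a n) \<le>
        1 / 2 * exp (- ((1 + \<eta>) / 2 * (\<Sum>j=1..k n. (h j)\<^sup>2 * (\<sigma>\<^sup>2 * (b n j)\<^sup>2 / a n)) + \<delta>') / a n)"
    proof -
      have "(1 + \<eta>) / 2 * (\<Sum>j=1..k n. (h j)\<^sup>2 * (\<sigma>\<^sup>2 * (b n j)\<^sup>2 / a n)) \<le> (1 + \<eta>) / 2 * (2 * \<alpha>)"
        using A \<eta>(1) unfolding inc_def by (intro mult_left_mono) auto
      also have "\<dots> = \<alpha> + \<eta> * \<alpha>" by (simp add: field_simps)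
      also have "\<dots> \<le> \<alpha> + \<epsilon> / 2" using \<eta>(1,5) by (simp add: distrib_left)
      finally have "- (\<alpha> + \<epsilon>) \<le> - ((1 + \<eta>) / 2 * (\<Sum>j=1..k n. (h j)\<^sup>2 * (\<sigma>\<^sup>2 * (b n j)\<^sup>2 / a n)) + \<delta>')"
        using \<delta>'(3) by linarith
      then have "- (\<alpha> + \<epsilon>) / a n \<le> - ((1 + \<eta>) / 2 * (\<Sum>j=1..k n. (h j)\<^sup>2 * (\<sigma>\<^sup>2 * (b n j)\<^sup>2 / a n)) + \<delta>') / a n"
        using a_pos[of n] by (intro divide_right_mono) auto
      then show ?thesis by simp
    qed
    moreover have "prob ?E \<le> prob {\<omega> \<in> space M. Y n \<omega> \<in> \<Gamma>}"
    proof (rule finite_measure_mono[OF _ Y_event[OF \<Gamma>]])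
      show "?E \<subseteq> {\<omega> \<in> space M. Y n \<omega> \<in> \<Gamma>}"
      proof
        fix \<omega> assume \<omega>: "\<omega> \<in> ?E"
        have "Y n \<omega> \<in> \<Gamma>"
        proof (rule nbhd[OF Y_cadlag01])
          fix t :: real assume t: "t \<in> {0..1}"
          let ?l = "idx n t"
          have l: "?l \<le> k n" using idx_props(1) t by auto
          have "\<bar>PS n ?l \<omega> - y (T n ?l)\<bar> < \<delta>'"
            using \<omega> l tele[OF l] unfolding PS_def inc_def by auto
          moreover have "\<bar>y t - y (T n ?l)\<bar> \<le> \<delta> / 3"
          proof -
            have "\<bar>y t - y (T n ?l)\<bar> \<le> R * (t - T n ?l)" using T_idx[of t n] t T_range[OF l] by (intro yL) auto
            also have "\<dots> \<le> R * mesh n" using T_idx[of t n] t R by (intro mult_left_mono) auto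
            finally show ?thesis using elim(2) by simp
          qed
          ultimately show "\<bar>Y n \<omega> t - z t\<bar> \<le> \<delta>"
            unfolding Y_eq[OF t] using yz[OF t] \<delta>'(2) by linarith
        qed
        then show "\<omega> \<in> {\<omega> \<in> space M. Y n \<omega> \<in> \<Gamma>}" using \<omega> by simp
      qed
    qed
    ultimately show ?case by linarith
  qed
qed

section \<open>Block increments and the upper bound\<close>

definition block_inc :: "nat \<Rightarrow> nat \<Rightarrow> nat \<Rightarrow> 'w \<Rightarrow> real" where
  "block_inc n m i \<omega> = Y n \<omega> ((real i + 1) / real m) - Y n \<omega> (real i / real m)"

lemma grid_in_unit: "i < m \<Longrightarrow> 0 \<le> real i / real m \<and> real i / real m \<le> 1 \<and> 0 \<le> (real i + 1) / real m \<and> (real i + 1) / real m \<le> 1"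
  by (auto simp: divide_le_eq_1)

lemma PS_diff:
  assumes "u \<le> l"
  shows "PS n l \<omega> - PS n u \<omega> = (\<Sum>j\<in>{u<..l}. b n j * \<xi> (int j) \<omega>)"
proof -
  have split: "{1..l} = {1..u} \<union> {u<..l}" using assms by auto
  have "PS n l \<omega> = PS n u \<omega> + (\<Sum>j\<in>{u<..l}. b n j * \<xi> (int j) \<omega>)"
    unfolding PS_def split by (rule sum.union_disjoint) auto
  then show ?thesis by simp
qed

text \<open>The term \<open>mesh n\<close> appears because the index at the left end may belong to a
  time up to one mesh before the block begins.\<close>

lemma T_block:
  assumes i: "i < m"
  shows "(\<Sum>j\<in>{idx n (real i / real m)<..idx n ((real i + 1) / real m)}. inc n j) \<le> 1 / real m + mesh n"
proof -
  let ?u = "idx n (real i / real m)" and ?v = "idx n ((real i + 1) / real m)"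
  have uv: "?u \<le> ?v" by (intro idx_mono divide_right_mono) auto
  have split: "{1..?v} = {1..?u} \<union> {?u<..?v}" using uv by auto
  have "T n ?v = T n ?u + (\<Sum>j\<in>{?u<..?v}. inc n j)"
    unfolding T_eq split by (rule sum.union_disjoint) auto
  moreover have "T n ?v \<le> (real i + 1) / real m" using grid_in_unit[OF i] by (intro T_idx) auto
  moreover have "real i / real m - T n ?u \<le> mesh n" using grid_in_unit[OF i] by (intro T_idx) auto
  ultimately show ?thesis by (simp add: add_divide_distrib)
qed

text \<open>A block of time length \<open>1 / m\<close> has an exponent growing linearly in
  \<open>m\<close>, so a large \<open>m\<close> beats any \<beta>. The factor 6 is the 3 of
  Etemadi's inequality times 2 for the two signs, and \<open>m\<close> counts the blocks.\<close>

lemma block_oscillation_bound: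
  assumes \<delta>: "\<delta> > 0"
  obtains m where "m > 0" "\<forall>\<^sub>F n in sequentially.
      prob {\<omega> \<in> space M. \<exists>i<m. \<exists>l\<in>{idx n (real i / real m)..idx n ((real i + 1) / real m)}.
        \<delta> \<le> \<bar>PS n l \<omega> - PS n (idx n (real i / real m)) \<omega>\<bar>} \<le> 6 * real m * exp (- \<beta> / a n)"
proof -
  \<comment> \<open>Chosen so that the exponent \<open>m * \<delta>\<^sup>2 / 72\<close> found below
    reaches \<beta>.\<close>
  obtain m0 :: nat where m0: "72 * \<beta> / \<delta>\<^sup>2 \<le> real m0" using real_arch_simple by blast
  define m where "m = Suc m0"
  have m: "m > 0" "\<beta> \<le> real m * \<delta>\<^sup>2 / 72"
  proof -
    have "72 * \<beta> / \<delta>\<^sup>2 \<le> real m" using m0 by (simp add: m_def)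
    then show "\<beta> \<le> real m * \<delta>\<^sup>2 / 72" using \<delta> by (simp add: field_simps)
  qed (simp add: m_def)
  \<comment> \<open>The crude comparison with \<eta> = 1 is precise enough, since \<open>m\<close>
    makes up for constant factors.\<close>
  obtain \<theta>0 where \<theta>0: "\<theta>0 > 0" "\<theta>0 \<le> rad / 2"
    "\<And>\<theta>. \<bar>\<theta>\<bar> \<le> \<theta>0 \<Longrightarrow> mgf \<theta> \<le> exp ((1 + 1) / 2 * (\<sigma>\<^sup>2 * \<theta>\<^sup>2))"
    by (rule Gaussian_comparison[OF zero_less_one order_refl], rule that)
  \<comment> \<open>The minimiser of
    \<open>\<kappa>\<^sup>2 * (2 / real m) - \<kappa> * (\<delta> / 3)\<close>: for small mesh
    \<open>2 / real m\<close> bounds the time covered by a block, and \<open>\<delta> / 3\<close> is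
    the level in Etemadi's inequality.\<close>
  define \<kappa> where "\<kappa> = real m * \<delta> / 12"
  have \<kappa>: "\<kappa> > 0" using m \<delta> by (simp add: \<kappa>_def)
  have "(\<lambda>n. \<kappa> * eps n) \<longlonglongrightarrow> \<kappa> * 0" by (intro tendsto_intros eps_lim)
  then have ev1: "\<forall>\<^sub>F n in sequentially. \<kappa> * eps n < \<theta>0" using \<theta>0(1) by (intro order_tendstoD) auto
  have ev2: "\<forall>\<^sub>F n in sequentially. mesh n < 1 / real m" using mesh_lim m by (intro order_tendstoD) auto
  from ev1 ev2 have "\<forall>\<^sub>F n in sequentially.
      prob {\<omega> \<in> space M. \<exists>i<m. \<exists>l\<in>{idx n (real i / real m)..idx n ((real i + 1) / real m)}.
        \<delta> \<le> \<bar>PS n l \<omega> - PS n (idx n (real i / real m)) \<omega>\<bar>} \<le> 6 * real m * exp (- \<beta> / a n)"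
  proof eventually_elim
    case (elim n)
    define u where "u i = idx n (real i / real m)" for i
    define v where "v i = idx n ((real i + 1) / real m)" for i
    let ?B = "\<lambda>i. {\<omega> \<in> space M. \<exists>l\<in>{u i..v i}. \<delta> \<le> \<bar>PS n l \<omega> - PS n (u i) \<omega>\<bar>}"
    have Bm: "?B i \<in> events" for i by measurable
    have B: "prob (?B i) \<le> 6 * exp (- \<beta> / a n)" if i: "i < m" for i
    proof -
      \<comment> \<open>Erasing the coefficients outside the block turns sums that start inside the
        array into initial partial sums, to which Etemadi's inequality applies.\<close>
      define w where "w j = (if j \<in> {u i<..v i} then b n j else 0)" for j
      have vk: "v i \<le> k n" unfolding v_def using grid_in_unit[OF i] by (intro idx_props(1)) auto
      have W: "(\<Sum>j=1..l. w j * \<xi> (int j) \<omega>) = PS n l \<omega> - PS n (u i) \<omega>" if l: "l \<in> {u i..v i}" for l \<omega>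
      proof -
        have "(\<Sum>j=1..l. w j * \<xi> (int j) \<omega>) = (\<Sum>j\<in>{u i<..l}. b n j * \<xi> (int j) \<omega>)"
          by (rule sum.mono_neutral_cong_right) (use l in \<open>auto simp: w_def\<close>)
        then show ?thesis using PS_diff[of "u i" l n \<omega>] l by simp
      qed
      have w0: "w j = 0" if "j \<notin> {1..k n}" for j using that vk by (auto simp: w_def)
      have one_sided: "prob {\<omega> \<in> space M. \<delta> / 3 \<le> (\<Sum>j=1..l. \<tau> * w j * \<xi> (int j) \<omega>)} \<le> exp (- \<beta> / a n)"
        if \<tau>: "\<bar>\<tau>\<bar> = 1" for \<tau> l
      proof -
        have an: "a n > 0" by (rule a_pos)
        have "{\<omega> \<in> space M. \<delta> / 3 \<le> (\<Sum>j=1..l. \<tau> * w j * \<xi> (int j) \<omega>)} =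
            {\<omega> \<in> space M. \<kappa> / a n * (\<delta> / 3) \<le> (\<Sum>j=1..l. (\<kappa> / a n * \<tau> * w j) * \<xi> (int j) \<omega>)}"
        proof -
          have "(\<Sum>j=1..l. (\<kappa> / a n * \<tau> * w j) * \<xi> (int j) \<omega>) = \<kappa> / a n * (\<Sum>j=1..l. \<tau> * w j * \<xi> (int j) \<omega>)" for \<omega>
            by (simp add: sum_distrib_left mult.assoc)
          moreover have "\<kappa> / a n > 0" using an \<kappa> by simp
          ultimately show ?thesis by (simp only: mult_le_cancel_left_pos)
        qed
        also have "prob \<dots> \<le> exp ((1 + 1) / 2 * (\<sigma>\<^sup>2 * (\<Sum>j=1..l. (\<kappa> / a n * \<tau> * w j)\<^sup>2)) - \<kappa> / a n * (\<delta> / 3))"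
        proof (rule Chernoff_bound[OF _ \<theta>0(2,3)])
          fix j
          show "\<bar>\<kappa> / a n * \<tau> * w j\<bar> \<le> \<theta>0"
          proof (cases "j \<in> {1..k n} \<and> j \<in> {u i<..v i}")
            case True
            have "\<bar>\<kappa> / a n * \<tau> * w j\<bar> = \<kappa> * (\<bar>b n j\<bar> / a n)" using True an \<kappa> \<tau> by (simp add: w_def abs_mult abs_divide)
            also have "\<dots> \<le> \<kappa> * eps n" using \<kappa> True by (intro mult_left_mono b_le_eps) auto
            finally show ?thesis using elim(1) by simp
          next
            case False
            have "w j = 0"
            proof (cases "j \<in> {1..k n}")
              case True
              then have "j \<notin> {u i<..v i}" using False by blast
              then show ?thesis unfolding w_def by (rule if_not_P)
            qed (use w0 in blast)
            then show ?thesis using \<theta>0(1) by simp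
          qed
        qed auto
        also have "(1 + 1) / 2 * (\<sigma>\<^sup>2 * (\<Sum>j=1..l. (\<kappa> / a n * \<tau> * w j)\<^sup>2)) - \<kappa> / a n * (\<delta> / 3) \<le> - \<beta> / a n"
        proof -
          have \<tau>2: "\<tau>\<^sup>2 = 1" using \<tau> by (metis one_power2 power2_abs)
          have "\<sigma>\<^sup>2 * (\<kappa> / a n * \<tau> * w j)\<^sup>2 = \<kappa>\<^sup>2 / a n * (\<sigma>\<^sup>2 * (w j)\<^sup>2 / a n)" for j
            by (simp add: power_mult_distrib power_divide \<tau>2 power2_eq_square[of "a n"])
          then have "\<sigma>\<^sup>2 * (\<Sum>j=1..l. (\<kappa> / a n * \<tau> * w j)\<^sup>2) = \<kappa>\<^sup>2 / a n * (\<Sum>j=1..l. \<sigma>\<^sup>2 * (w j)\<^sup>2 / a n)"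
            by (simp only: sum_distrib_left)
          also have "(\<Sum>j=1..l. \<sigma>\<^sup>2 * (w j)\<^sup>2 / a n) \<le> (\<Sum>j\<in>{u i<..v i}. inc n j)"
          proof -
            have "(\<Sum>j=1..l. \<sigma>\<^sup>2 * (w j)\<^sup>2 / a n) = (\<Sum>j\<in>{1..l} \<inter> {u i<..v i}. inc n j)"
              by (rule sum.mono_neutral_cong_right) (auto simp: w_def inc_def)
            also have "\<dots> \<le> (\<Sum>j\<in>{u i<..v i}. inc n j)" by (rule sum_mono2) (auto simp: inc_nonneg)
            finally show ?thesis .
          qed
          also have "\<dots> \<le> 1 / real m + mesh n" unfolding u_def v_def by (rule T_block[OF i])
          also have "\<dots> \<le> 2 / real m" using elim(2) by simp
          finally have "\<sigma>\<^sup>2 * (\<Sum>j=1..l. (\<kappa> / a n * \<tau> * w j)\<^sup>2) \<le> \<kappa>\<^sup>2 / a n * (2 / real m)"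
            using an by (simp add: mult_left_mono divide_right_mono)
          then have "(1 + 1) / 2 * (\<sigma>\<^sup>2 * (\<Sum>j=1..l. (\<kappa> / a n * \<tau> * w j)\<^sup>2)) - \<kappa> / a n * (\<delta> / 3) \<le>
              \<kappa>\<^sup>2 / a n * (2 / real m) - \<kappa> / a n * (\<delta> / 3)"
            by simp
          also have "\<dots> = (\<kappa>\<^sup>2 * (2 / real m) - \<kappa> * (\<delta> / 3)) / a n"
            by (simp add: diff_divide_distrib mult.commute)
          also have "\<kappa>\<^sup>2 * (2 / real m) - \<kappa> * (\<delta> / 3) = - (real m * \<delta>\<^sup>2 / 72)"
            using m(1) by (simp add: \<kappa>_def power2_eq_square field_simps)
          also have "- (real m * \<delta>\<^sup>2 / 72) / a n \<le> - \<beta> / a n"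
            using m(2) an by (intro divide_right_mono) auto
          finally show ?thesis .
        qed
        finally show ?thesis by simp
      qed
      have "prob (?B i) \<le> prob {\<omega> \<in> space M. \<exists>l\<le>k n. 3 * (\<delta> / 3) \<le> \<bar>\<Sum>j=1..l. w j * \<xi> (int j) \<omega>\<bar>}"
      proof (rule finite_measure_mono)
        show "?B i \<subseteq> {\<omega> \<in> space M. \<exists>l\<le>k n. 3 * (\<delta> / 3) \<le> \<bar>\<Sum>j=1..l. w j * \<xi> (int j) \<omega>\<bar>}"
        proof
          fix \<omega> assume "\<omega> \<in> ?B i"
          then obtain l where l: "\<omega> \<in> space M" "l \<in> {u i..v i}" "\<delta> \<le> \<bar>PS n l \<omega> - PS n (u i) \<omega>\<bar>" by blast
          then have "l \<le> k n" using vk by auto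
          then show "\<omega> \<in> {\<omega> \<in> space M. \<exists>l\<le>k n. 3 * (\<delta> / 3) \<le> \<bar>\<Sum>j=1..l. w j * \<xi> (int j) \<omega>\<bar>}"
            using l W[OF l(2)] by auto
        qed
        show "{\<omega> \<in> space M. \<exists>l\<le>k n. 3 * (\<delta> / 3) \<le> \<bar>\<Sum>j=1..l. w j * \<xi> (int j) \<omega>\<bar>} \<in> events"
          using \<xi>_measurable by measurable
      qed
      also have "\<dots> \<le> 3 * (2 * exp (- \<beta> / a n))"
      proof (rule Etemadi_inequality)
        show "indep_vars (\<lambda>_. borel) (\<lambda>j \<omega>. w j * \<xi> (int j) \<omega>) {1..k n}"
          by (rule indep_vars_compose2[OF indep_vars_subset[OF X_indep], of "{1..k n}" "\<lambda>j x. w j * x"]) auto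
        fix l
        have "prob {\<omega> \<in> space M. \<delta> / 3 \<le> \<bar>\<Sum>j=1..l. w j * \<xi> (int j) \<omega>\<bar>} \<le>
            prob ({\<omega> \<in> space M. \<delta> / 3 \<le> (\<Sum>j=1..l. 1 * w j * \<xi> (int j) \<omega>)} \<union>
              {\<omega> \<in> space M. \<delta> / 3 \<le> (\<Sum>j=1..l. (-1) * w j * \<xi> (int j) \<omega>)})"
        proof (rule finite_measure_mono)
          show "{\<omega> \<in> space M. \<delta> / 3 \<le> (\<Sum>j=1..l. 1 * w j * \<xi> (int j) \<omega>)} \<union>
              {\<omega> \<in> space M. \<delta> / 3 \<le> (\<Sum>j=1..l. (-1) * w j * \<xi> (int j) \<omega>)} \<in> events"
            using \<xi>_measurable by measurable
          show "{\<omega> \<in> space M. \<delta> / 3 \<le> \<bar>\<Sum>j=1..l. w j * \<xi> (int j) \<omega>\<bar>} \<subseteq> {\<omega> \<in> space M. \<delta> / 3 \<le> (\<Sum>j=1..l. 1 * w j * \<xi> (int j) \<omega>)} \<union>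
              {\<omega> \<in> space M. \<delta> / 3 \<le> (\<Sum>j=1..l. (-1) * w j * \<xi> (int j) \<omega>)}"
            by (auto simp: sum_negf abs_if split: if_splits)
        qed
        also have "\<dots> \<le> prob {\<omega> \<in> space M. \<delta> / 3 \<le> (\<Sum>j=1..l. 1 * w j * \<xi> (int j) \<omega>)} +
            prob {\<omega> \<in> space M. \<delta> / 3 \<le> (\<Sum>j=1..l. (-1) * w j * \<xi> (int j) \<omega>)}"
          using \<xi>_measurable by (intro measure_Un_le) measurable
        also have "\<dots> \<le> 2 * exp (- \<beta> / a n)" using one_sided[of 1 l] one_sided[of "-1" l] by simp
        finally show "prob {\<omega> \<in> space M. \<delta> / 3 \<le> \<bar>\<Sum>j=1..l. w j * \<xi> (int j) \<omega>\<bar>} \<le> 2 * exp (- \<beta> / a n)" .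
      qed
      finally show ?thesis by simp
    qed
    have un: "{\<omega> \<in> space M. \<exists>i<m. \<exists>l\<in>{u i..v i}. \<delta> \<le> \<bar>PS n l \<omega> - PS n (u i) \<omega>\<bar>} = (\<Union>i\<in>{..<m}. ?B i)" by auto
    have "prob (\<Union>i\<in>{..<m}. ?B i) \<le> (\<Sum>i\<in>{..<m}. prob (?B i))"
      using Bm by (intro finite_measure_subadditive_finite) auto
    also have "\<dots> \<le> (\<Sum>i\<in>{..<m}. 6 * exp (- \<beta> / a n))"
      by (rule sum_mono) (rule B, simp)
    also have "\<dots> = 6 * real m * exp (- \<beta> / a n)" by simp
    finally have "prob (\<Union>i\<in>{..<m}. ?B i) \<le> 6 * real m * exp (- \<beta> / a n)" .
    then show ?case unfolding un[unfolded u_def v_def] u_def v_def .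
  qed
  then show ?thesis using that m(1) by blast
qed

text \<open>A linear functional of the block increments is a weighted sum of the variables whose
  weights are constant on each block. Up to \<open>1 + \<eta>\<close> and the mesh, the bound is the
  one for independent normal increments of variance \<open>a n / m\<close>.\<close>

lemma block_Chernoff:
  fixes g :: "nat \<Rightarrow> real"
  assumes m: "m > 0" and g: "\<And>i. i < m \<Longrightarrow> \<bar>g i\<bar> \<le> G" and \<theta>0: "0 \<le> \<theta>0" "\<theta>0 \<le> rad / 2"
    and mgf_le: "\<And>\<theta>. \<bar>\<theta>\<bar> \<le> \<theta>0 \<Longrightarrow> mgf \<theta> \<le> exp ((1 + \<eta>) / 2 * (\<sigma>\<^sup>2 * \<theta>\<^sup>2))" and \<eta>: "0 \<le> \<eta>"
    and small: "G * eps n \<le> \<theta>0"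
  shows "prob {\<omega> \<in> space M. x \<le> (\<Sum>i<m. g i * block_inc n m i \<omega>)} \<le>
    exp (((1 + \<eta>) / 2 * (\<Sum>i<m. (g i)\<^sup>2) * (1 / real m + mesh n) - x) / a n)"
proof -
  have an: "a n > 0" by (rule a_pos)
  define u where "u i = idx n (real i / real m)" for i :: nat
  have u_Suc: "idx n ((real i + 1) / real m) = u (Suc i)" for i by (simp add: u_def add.commute)
  have u_mono: "u i \<le> u i'" if "i \<le> i'" for i i' unfolding u_def using that by (intro idx_mono divide_right_mono) auto
  have u_k: "u i \<le> k n" if "i \<le> m" for i unfolding u_def using that m by (intro idx_props(1)) auto
  \<comment> \<open>The weight of the block that contains \<open>j\<close>, and 0 if there is none;
    the blocks are disjoint, so at most one summand is nonzero.\<close>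
  define h where "h j = (\<Sum>i<m. if j \<in> {u i<..u (Suc i)} then g i else 0)" for j
  have uniq: "i = i'" if "j \<in> {u i<..u (Suc i)}" "j \<in> {u i'<..u (Suc i')}" for i i' j
  proof (rule ccontr)
    have *: "False" if "i < i'" "j \<in> {u i<..u (Suc i)}" "j \<in> {u i'<..u (Suc i')}" for i i'
      using u_mono[of "Suc i" i'] that by auto
    assume "i \<noteq> i'"
    then show False using *[of i i'] *[of i' i] that by (cases i i' rule: linorder_cases) auto
  qed
  have h2: "(h j)\<^sup>2 = (\<Sum>i<m. if j \<in> {u i<..u (Suc i)} then (g i)\<^sup>2 else 0)" for j
    unfolding h_def by (rule square_sum_disjoint) (use uniq in auto)
  have G: "G \<ge> 0" using g[of 0] m by simp
  have hG: "\<bar>h j\<bar> \<le> G" for j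
  proof (cases "\<exists>i<m. j \<in> {u i<..u (Suc i)}")
    case True
    then obtain i where i: "i < m" "j \<in> {u i<..u (Suc i)}" by blast
    have "h j = (\<Sum>i'<m. if i' = i then g i' else 0)"
      unfolding h_def using uniq i(2) by (intro sum.cong refl) metis
    then show ?thesis using g[OF i(1)] i(1) by simp
  next
    case False
    then have "h j = 0" unfolding h_def by (intro sum.neutral) auto
    then show ?thesis using G by simp
  qed
  have inner: "(\<Sum>j=1..k n. if j \<in> {u i<..u (Suc i)} then f j else 0) = (\<Sum>j\<in>{u i<..u (Suc i)}. f j)" if "i < m" for i and f :: "nat \<Rightarrow> real"
  proof -
    have "{1..k n} \<inter> {u i<..u (Suc i)} = {u i<..u (Suc i)}" using u_k[of "Suc i"] that by auto
    moreover have "(\<Sum>j=1..k n. if j \<in> {u i<..u (Suc i)} then f j else 0) = sum f ({1..k n} \<inter> {u i<..u (Suc i)})"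
      by (rule sum.inter_restrict[symmetric]) simp
    ultimately show ?thesis by simp
  qed
  have blk: "block_inc n m i \<omega> = (\<Sum>j\<in>{u i<..u (Suc i)}. b n j * \<xi> (int j) \<omega>)" if "i < m" for i \<omega>
    using grid_in_unit[OF that] PS_diff[OF u_mono[of i "Suc i"], of n \<omega>]
    by (simp add: block_inc_def Y_eq u_Suc) (simp add: u_def)
  have lin: "(\<Sum>i<m. g i * block_inc n m i \<omega>) = (\<Sum>j=1..k n. h j * b n j * \<xi> (int j) \<omega>)" for \<omega>
  proof -
    have "(\<Sum>i<m. g i * block_inc n m i \<omega>) =
        (\<Sum>i<m. \<Sum>j=1..k n. if j \<in> {u i<..u (Suc i)} then g i * (b n j * \<xi> (int j) \<omega>) else 0)"
      by (intro sum.cong refl) (simp only: lessThan_iff inner blk sum_distrib_left)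
    also have "\<dots> = (\<Sum>j=1..k n. \<Sum>i<m. if j \<in> {u i<..u (Suc i)} then g i * (b n j * \<xi> (int j) \<omega>) else 0)"
      by (rule sum.swap)
    also have "\<dots> = (\<Sum>j=1..k n. h j * b n j * \<xi> (int j) \<omega>)"
      unfolding h_def sum_distrib_right by (intro sum.cong refl) auto
    finally show ?thesis .
  qed
  have "{\<omega> \<in> space M. x \<le> (\<Sum>i<m. g i * block_inc n m i \<omega>)} =
      {\<omega> \<in> space M. x / a n \<le> (\<Sum>j=1..k n. (h j * b n j / a n) * \<xi> (int j) \<omega>)}"
  proof -
    have "(\<Sum>j=1..k n. (h j * b n j / a n) * \<xi> (int j) \<omega>) = (\<Sum>j=1..k n. h j * b n j * \<xi> (int j) \<omega>) / a n" for \<omega>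
      by (simp add: sum_divide_distrib)
    then show ?thesis unfolding lin using an by (simp add: divide_le_cancel)
  qed
  moreover have "prob {\<omega> \<in> space M. x / a n \<le> (\<Sum>j=1..k n. (h j * b n j / a n) * \<xi> (int j) \<omega>)} \<le>
      exp ((1 + \<eta>) / 2 * (\<sigma>\<^sup>2 * (\<Sum>j=1..k n. (h j * b n j / a n)\<^sup>2)) - x / a n)"
  proof (rule Chernoff_bound[OF _ \<theta>0(2) mgf_le])
    fix j assume j: "j \<in> {1..k n}"
    have "\<bar>h j * b n j / a n\<bar> = \<bar>h j\<bar> * (\<bar>b n j\<bar> / a n)" using an by (simp add: abs_mult abs_divide)
    also have "\<dots> \<le> G * eps n" using hG[of j] b_le_eps[OF j] G an by (intro mult_mono) auto
    finally show "\<bar>h j * b n j / a n\<bar> \<le> \<theta>0" using small by simp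
  qed auto
  moreover have "\<sigma>\<^sup>2 * (\<Sum>j=1..k n. (h j * b n j / a n)\<^sup>2) = (\<Sum>j=1..k n. (h j)\<^sup>2 * inc n j) / a n"
  proof -
    have "\<sigma>\<^sup>2 * (h j * b n j / a n)\<^sup>2 = (h j)\<^sup>2 * inc n j / a n" for j
      by (simp add: inc_def power_mult_distrib power_divide power2_eq_square[of "a n"])
    then show ?thesis by (simp only: sum_distrib_left sum_divide_distrib)
  qed
  moreover have "(\<Sum>j=1..k n. (h j)\<^sup>2 * inc n j) = (\<Sum>i<m. (g i)\<^sup>2 * (\<Sum>j\<in>{u i<..u (Suc i)}. inc n j))"
  proof -
    have "(\<Sum>j=1..k n. (h j)\<^sup>2 * inc n j) = (\<Sum>j=1..k n. \<Sum>i<m. if j \<in> {u i<..u (Suc i)} then (g i)\<^sup>2 * inc n j else 0)"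
      unfolding h2 sum_distrib_right by (intro sum.cong refl) (rule if_distrib[THEN trans], simp)
    also have "\<dots> = (\<Sum>i<m. \<Sum>j=1..k n. if j \<in> {u i<..u (Suc i)} then (g i)\<^sup>2 * inc n j else 0)" by (rule sum.swap)
    also have "\<dots> = (\<Sum>i<m. (g i)\<^sup>2 * (\<Sum>j\<in>{u i<..u (Suc i)}. inc n j))"
      by (intro sum.cong refl) (simp only: lessThan_iff inner sum_distrib_left)
    finally show ?thesis .
  qed
  ultimately have "prob {\<omega> \<in> space M. x \<le> (\<Sum>i<m. g i * block_inc n m i \<omega>)} \<le>
      exp ((1 + \<eta>) / 2 * ((\<Sum>i<m. (g i)\<^sup>2 * (\<Sum>j\<in>{u i<..u (Suc i)}. inc n j)) / a n) - x / a n)" by (simp only:)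
  also have "\<dots> \<le> exp (((1 + \<eta>) / 2 * (\<Sum>i<m. (g i)\<^sup>2) * (1 / real m + mesh n) - x) / a n)"
  proof -
    have "(\<Sum>i<m. (g i)\<^sup>2 * (\<Sum>j\<in>{u i<..u (Suc i)}. inc n j)) \<le> (\<Sum>i<m. (g i)\<^sup>2 * (1 / real m + mesh n))"
      using T_block[of _ m n] by (intro sum_mono mult_left_mono) (auto simp: u_Suc u_def[symmetric])
    also have "\<dots> = (\<Sum>i<m. (g i)\<^sup>2) * (1 / real m + mesh n)" by (rule sum_distrib_right[symmetric])
    finally have "(1 + \<eta>) / 2 * (\<Sum>i<m. (g i)\<^sup>2 * (\<Sum>j\<in>{u i<..u (Suc i)}. inc n j)) \<le>
        (1 + \<eta>) / 2 * ((\<Sum>i<m. (g i)\<^sup>2) * (1 / real m + mesh n))" using \<eta> by (intro mult_left_mono) auto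
    then have "((1 + \<eta>) / 2 * (\<Sum>i<m. (g i)\<^sup>2 * (\<Sum>j\<in>{u i<..u (Suc i)}. inc n j)) - x) / a n \<le>
        ((1 + \<eta>) / 2 * ((\<Sum>i<m. (g i)\<^sup>2) * (1 / real m + mesh n)) - x) / a n"
      using an by (intro divide_right_mono) auto
    then show ?thesis by (simp add: diff_divide_distrib mult.assoc)
  qed
  finally show ?thesis .
qed

end

lemma square_le_of_abs_le: "\<bar>x\<bar> \<le> y \<Longrightarrow> x\<^sup>2 \<le> y\<^sup>2" for x y :: real
  using power_mono[of "\<bar>x\<bar>" y 2] by simp

context mdp_array
begin

text \<open>\<open>C\<close> counts bad events, block oscillations and half-spaces, and is free of
  \<open>n\<close> because \<open>m\<close> and the lattice are fixed before \<open>n\<close>. A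
  third of \<epsilon> each is reserved for rounding the increments, for the factor
  \<open>1 + \<eta>\<close>, and for the mesh.\<close>

lemma upper_bound:
  assumes \<Gamma>: "\<Gamma> \<in> sets D01_borel" and gap: "\<And>z. z \<in> D01_topology closure_of \<Gamma> \<Longrightarrow> rate_fn z > ereal \<beta>" and \<epsilon>: "\<epsilon> > 0"
  obtains C where "C > 0" "\<forall>\<^sub>F n in sequentially. prob {\<omega> \<in> space M. Y n \<omega> \<in> \<Gamma>} \<le> C * exp (- (\<beta> - \<epsilon>) / a n)"
proof -
  have sp: "space D01_borel = cadlag01"
    unfolding D01_borel_def using openin_subset[of D01_topology] by (intro space_measure_of) auto
  have \<Gamma>sub: "\<Gamma> \<subseteq> cadlag01" using sets.sets_into_space[OF \<Gamma>] sp by simp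
  obtain \<delta> where \<delta>: "\<delta> > 0" "\<And>x y. x \<in> \<Gamma> \<Longrightarrow> y \<in> cadlag01 \<Longrightarrow> (\<And>t. t \<in> {0..1} \<Longrightarrow> \<bar>y t - x t\<bar> \<le> \<delta>) \<Longrightarrow> rate_fn y > ereal \<beta>"
  proof (rule rate_fn_gap[OF \<Gamma>sub])
    show "ereal \<beta> < rate_fn z" if "z \<in> D01_topology closure_of \<Gamma>" for z by (rule gap[OF that])
    fix \<delta> :: real
    assume 1: "\<delta> > 0" and 2: "\<And>x y. x \<in> \<Gamma> \<Longrightarrow> y \<in> cadlag01 \<Longrightarrow> (\<And>t. t \<in> {0..1} \<Longrightarrow> \<bar>y t - x t\<bar> \<le> \<delta>) \<Longrightarrow> rate_fn y > ereal \<beta>"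
    show thesis by (rule that[OF 1]) (use 2 in blast)
  qed
  \<comment> \<open>\<open>grid_interpolation\<close> displaces the path by twice the block
    oscillation.\<close>
  define \<delta>' where "\<delta>' = \<delta> / 2"
  have \<delta>': "\<delta>' > 0" using \<delta>(1) by (simp add: \<delta>'_def)
  define Osc where "Osc m n = {\<omega> \<in> space M. \<exists>i<m. \<exists>l\<in>{idx n (real i / real m)..idx n ((real i + 1) / real m)}.
        \<delta>' \<le> \<bar>PS n l \<omega> - PS n (idx n (real i / real m)) \<omega>\<bar>}" for m n
  obtain m where m: "m > 0" "\<forall>\<^sub>F n in sequentially. prob (Osc m n) \<le> 6 * real m * exp (- \<beta> / a n)"
    by (rule block_oscillation_bound[OF \<delta>', of \<beta>, folded Osc_def], rule that)
  \<comment> \<open>The lattice width for which rounding all \<open>m\<close> increments changes the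
    energy identity below by at most \<open>\<epsilon> / 3\<close>.\<close>
  define \<eta>0 where "\<eta>0 = sqrt (2 * \<epsilon> / 3) / real m"
  have \<eta>0: "\<eta>0 > 0" "real m / 2 * (real m * \<eta>0\<^sup>2) = \<epsilon> / 3"
    using m(1) \<epsilon> by (auto simp: \<eta>0_def power_divide power2_eq_square[of "real m"])
  \<comment> \<open>Increments at most \<delta>' in absolute value give lattice coordinates at most
    \<open>\<delta>' / \<eta>0\<close>; the \<open>+ 1\<close> allows for rounding down.\<close>
  define N where "N = nat \<lceil>\<delta>' / \<eta>0\<rceil> + 1"
  define G where "G = \<eta>0 * real N"
  have G: "G \<ge> 0" using \<eta>0(1) by (simp add: G_def)
  define \<eta> where "\<eta> = min 1 (\<epsilon> / 3 / (real m * (real m * G\<^sup>2) + 1))"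
  have mG: "real m * (real m * G\<^sup>2) \<ge> 0" by simp
  have \<eta>: "0 < \<eta>" "\<eta> \<le> 1" "\<eta> * (real m * (real m * G\<^sup>2)) \<le> \<epsilon> / 3"
  proof -
    have pos: "real m * (real m * G\<^sup>2) + 1 > 0" using mG by linarith
    then have "\<epsilon> / 3 / (real m * (real m * G\<^sup>2) + 1) > 0" using \<epsilon> by (intro divide_pos_pos) auto
    then show "0 < \<eta>" "\<eta> \<le> 1" unfolding \<eta>_def by linarith+
    have "\<eta> \<le> \<epsilon> / 3 / (real m * (real m * G\<^sup>2) + 1)" unfolding \<eta>_def by (rule min.cobounded2)
    then have "\<eta> * (real m * (real m * G\<^sup>2) + 1) \<le> \<epsilon> / 3"
      by (simp only: pos_le_divide_eq[OF pos])
    then show "\<eta> * (real m * (real m * G\<^sup>2)) \<le> \<epsilon> / 3" using \<open>0 < \<eta>\<close> by (simp add: distrib_left)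
  qed
  obtain \<theta>0 where \<theta>0: "\<theta>0 > 0" "\<theta>0 \<le> rad / 2"
    "\<And>\<theta>. \<bar>\<theta>\<bar> \<le> \<theta>0 \<Longrightarrow> mgf \<theta> \<le> exp ((1 + \<eta>) / 2 * (\<sigma>\<^sup>2 * \<theta>\<^sup>2))"
    by (rule Gaussian_comparison[OF \<eta>(1,2)], rule that)
  have "(\<lambda>n. real m * G * eps n) \<longlonglongrightarrow> real m * G * 0" by (intro tendsto_intros eps_lim)
  then have ev1: "\<forall>\<^sub>F n in sequentially. real m * G * eps n < \<theta>0" using \<theta>0(1) by (intro order_tendstoD) auto
  have "(\<lambda>n. real m * (real m * (real m * G\<^sup>2)) * mesh n) \<longlonglongrightarrow> real m * (real m * (real m * G\<^sup>2)) * 0"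
    by (intro tendsto_intros mesh_lim)
  then have ev2: "\<forall>\<^sub>F n in sequentially. real m * (real m * (real m * G\<^sup>2)) * mesh n < \<epsilon> / 3"
    using \<epsilon> by (intro order_tendstoD) auto
  define Grid where "Grid = PiE {..<m} (\<lambda>_. {- int N..int N})"
  have fin: "finite Grid" unfolding Grid_def by (intro finite_PiE) auto
  \<comment> \<open>The gradient of the grid energy
    \<open>real m / 2 * (\<Sum>i<m. (V i)\<^sup>2)\<close> at the lattice point with coordinates
    \<open>\<eta>0 * q i\<close>. With this direction the Gaussian term of the Chernoff exponent is
    \<open>real m / 2 * S q\<close>, which cancels against the same term in \<open>x q\<close> and
    leaves about \<open>- \<beta>\<close>.\<close>
  define g where "g q i = real m * (\<eta>0 * real_of_int (q i))" for q :: "nat \<Rightarrow> int" and i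
  define S where "S q = (\<Sum>i<m. (\<eta>0 * real_of_int (q i))\<^sup>2)" for q :: "nat \<Rightarrow> int"
  define x where "x q = \<beta> - \<epsilon> / 3 + real m / 2 * S q" for q
  define H where "H n q = {\<omega> \<in> space M. x q \<le> (\<Sum>i<m. g q i * block_inc n m i \<omega>)}" for n q
  have gG: "\<bar>\<eta>0 * real_of_int (q i)\<bar> \<le> G" if "q \<in> Grid" "i < m" for q i
  proof -
    have "q i \<in> {- int N..int N}" by (rule PiE_mem[OF that(1)[unfolded Grid_def]]) (simp add: that(2))
    then have "real_of_int \<bar>q i\<bar> \<le> real_of_int (int N)"
      unfolding of_int_le_iff by (simp add: abs_le_iff)
    then have "\<bar>real_of_int (q i)\<bar> \<le> real N" by simp
    then show ?thesis using \<eta>0(1) by (simp add: G_def abs_mult)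
  qed
  have SG: "S q \<le> real m * G\<^sup>2" if "q \<in> Grid" for q
  proof -
    have "S q \<le> (\<Sum>i<m. G\<^sup>2)" unfolding S_def
      by (rule sum_mono) (rule square_le_of_abs_le[OF gG[OF that]], simp)
    then show ?thesis by simp
  qed
  have S0: "S q \<ge> 0" for q unfolding S_def by (intro sum_nonneg) auto
  have H: "prob (H n q) \<le> exp (- (\<beta> - \<epsilon>) / a n)"
    if ev: "real m * G * eps n < \<theta>0" "real m * (real m * (real m * G\<^sup>2)) * mesh n < \<epsilon> / 3" and q: "q \<in> Grid" for n q
  proof -
    have "prob (H n q) \<le> exp (((1 + \<eta>) / 2 * (\<Sum>i<m. (g q i)\<^sup>2) * (1 / real m + mesh n) - x q) / a n)"
      unfolding H_def
    proof (rule block_Chernoff[OF m(1) _ less_imp_le[OF \<theta>0(1)] \<theta>0(2,3)])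
      show "\<bar>g q i\<bar> \<le> real m * G" if "i < m" for i
        using gG[OF q that] m(1) unfolding g_def by (simp add: abs_mult mult_left_mono)
    qed (use ev \<eta> in auto)
    also have "\<dots> \<le> exp (- (\<beta> - \<epsilon>) / a n)"
    proof -
      have sg: "(\<Sum>i<m. (g q i)\<^sup>2) = real m * (real m * S q)"
        unfolding g_def S_def sum_distrib_left by (intro sum.cong refl) (simp add: power2_eq_square)
      have "(1 + \<eta>) / 2 * (\<Sum>i<m. (g q i)\<^sup>2) * (1 / real m + mesh n) =
          real m * S q / 2 + \<eta> * (real m * S q) / 2 + (1 + \<eta>) / 2 * (real m * (real m * S q) * mesh n)"
        unfolding sg using m(1) by (simp add: field_simps)
      also have "\<eta> * (real m * S q) / 2 \<le> \<epsilon> / 3"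
      proof -
        have "\<eta> * (real m * S q) \<le> \<eta> * (real m * (real m * G\<^sup>2))"
          using SG[OF q] \<eta>(1) by (intro mult_left_mono) auto
        moreover have "\<eta> * (real m * S q) \<ge> 0" using \<eta>(1) S0[of q] by simp
        ultimately show ?thesis using \<eta>(3) by linarith
      qed
      also have "(1 + \<eta>) / 2 * (real m * (real m * S q) * mesh n) \<le> \<epsilon> / 3"
      proof -
        have nn: "real m * (real m * S q) * mesh n \<ge> 0" using S0[of q] mesh_nonneg[of n] by simp
        then have "(1 + \<eta>) / 2 * (real m * (real m * S q) * mesh n) \<le> 1 * (real m * (real m * S q) * mesh n)"
          using \<eta>(2) by (intro mult_right_mono) auto
        also have "\<dots> \<le> real m * (real m * (real m * G\<^sup>2)) * mesh n"
          using SG[OF q] mesh_nonneg[of n] by (simp add: mult_left_mono mult_right_mono)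
        finally show ?thesis using ev(2) by linarith
      qed
      finally have "(1 + \<eta>) / 2 * (\<Sum>i<m. (g q i)\<^sup>2) * (1 / real m + mesh n) - x q \<le> - (\<beta> - \<epsilon>)"
        unfolding x_def by linarith
      then have "((1 + \<eta>) / 2 * (\<Sum>i<m. (g q i)\<^sup>2) * (1 / real m + mesh n) - x q) / a n \<le> - (\<beta> - \<epsilon>) / a n"
        using a_pos[of n] by (intro divide_right_mono) auto
      then show ?thesis by (simp only: exp_le_cancel_iff)
    qed
    finally show ?thesis .
  qed
  have Hm: "H n q \<in> events" for n q
  proof -
    have "(\<lambda>\<omega>. block_inc n m i \<omega>) \<in> borel_measurable M" if "i < m" for i
      using grid_in_unit[OF that] by (simp add: block_inc_def Y_eq)
    then have "(\<lambda>\<omega>. \<Sum>i<m. g q i * block_inc n m i \<omega>) \<in> borel_measurable M"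
      by (intro borel_measurable_sum borel_measurable_times) auto
    then show ?thesis unfolding H_def by measurable
  qed
  have Oscm: "Osc m n \<in> events" for n unfolding Osc_def by measurable
  have cover: "{\<omega> \<in> space M. Y n \<omega> \<in> \<Gamma>} \<subseteq> Osc m n \<union> (\<Union>q\<in>Grid. H n q)" for n
  proof
    fix \<omega> assume \<omega>: "\<omega> \<in> {\<omega> \<in> space M. Y n \<omega> \<in> \<Gamma>}"
    show "\<omega> \<in> Osc m n \<union> (\<Union>q\<in>Grid. H n q)"
    proof (cases "\<omega> \<in> Osc m n")
      case False
      have osc: "\<bar>Y n \<omega> t - Y n \<omega> (real i / real m)\<bar> \<le> \<delta>'"
        if i: "i < m" and t: "real i / real m \<le> t" "t \<le> (real i + 1) / real m" for i t
      proof -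
        have "0 \<le> t" by (rule order_trans[OF _ t(1)]) simp
        moreover have "t \<le> 1" by (rule order_trans[OF t(2)]) (use grid_in_unit[OF i] in simp)
        ultimately have tt: "t \<in> {0..1}" "real i / real m \<in> {0..1}" using grid_in_unit[OF i] by auto
        have "idx n t \<in> {idx n (real i / real m)..idx n ((real i + 1) / real m)}" using t by (simp add: idx_mono)
        then have "\<not> \<delta>' \<le> \<bar>PS n (idx n t) \<omega> - PS n (idx n (real i / real m)) \<omega>\<bar>"
          using False \<omega> i unfolding Osc_def by blast
        then show ?thesis by (simp add: Y_eq[OF tt(1)] Y_eq[OF tt(2)])
      qed
      define V where "V i = block_inc n m i \<omega>" for i
      have V: "\<bar>V i\<bar> \<le> \<delta>'" if "i < m" for i
        using osc[OF that, of "(real i + 1) / real m"] by (simp add: V_def block_inc_def divide_right_mono)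
      obtain y where y: "y \<in> cadlag01" "\<And>t. t \<in> {0..1} \<Longrightarrow> \<bar>y t - Y n \<omega> t\<bar> \<le> 2 * \<delta>'"
        "rate_fn y \<le> ereal (real m / 2 * (\<Sum>i<m. (Y n \<omega> ((real i + 1) / real m) - Y n \<omega> (real i / real m))\<^sup>2))"
        by (rule grid_interpolation[of m "Y n \<omega>" \<delta>', OF m(1) Y_0 osc], assumption+, rule that)
      \<comment> \<open>Without large oscillation the interpolation is within \<delta> of a member
        of \<Gamma>, so the gap applies to it and its grid energy exceeds \<beta>.\<close>
      have "ereal \<beta> < rate_fn y"
        by (rule \<delta>(2)[of "Y n \<omega>" y]) (use y \<omega> in \<open>auto simp: \<delta>'_def\<close>)
      also note y(3)
      finally have \<beta>: "\<beta> < real m / 2 * (\<Sum>i<m. (V i)\<^sup>2)" by (simp add: V_def block_inc_def)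
      define q where "q = (\<lambda>i\<in>{..<m}. \<lfloor>V i / \<eta>0\<rfloor>)"
      have q: "\<bar>V i - \<eta>0 * real_of_int (q i)\<bar> \<le> \<eta>0" if "i < m" for i
      proof -
        have "real_of_int (q i) \<le> V i / \<eta>0" "V i / \<eta>0 \<le> real_of_int (q i) + 1"
          using that by (auto simp: q_def)
        then have "\<eta>0 * real_of_int (q i) \<le> V i" "V i \<le> \<eta>0 * real_of_int (q i) + \<eta>0"
          using \<eta>0(1) by (auto simp: field_simps)
        then show ?thesis by simp
      qed
      have "q \<in> Grid"
        unfolding Grid_def
      proof (rule PiE_I)
        fix i assume "i \<in> {..<m}"
        then have i: "i < m" by simp
        have "\<bar>V i / \<eta>0\<bar> \<le> \<delta>' / \<eta>0" using V[OF i] \<eta>0(1) by (simp add: abs_divide divide_right_mono)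
        also have "\<dots> \<le> real N - 1" using \<delta>' \<eta>0(1) by (simp add: N_def of_nat_ceiling)
        finally have "V i / \<eta>0 \<le> real N - 1" "- (real N - 1) \<le> V i / \<eta>0" by linarith+
        then have "\<lfloor>V i / \<eta>0\<rfloor> \<le> int N" "- int N \<le> \<lfloor>V i / \<eta>0\<rfloor>" by linarith+
        then show "q i \<in> {- int N..int N}" using i by (simp add: q_def)
      qed (simp add: q_def)
      moreover have "\<omega> \<in> H n q"
      proof -
        let ?z = "\<lambda>i. \<eta>0 * real_of_int (q i)"
        have "(\<Sum>i<m. (V i - ?z i)\<^sup>2) \<le> (\<Sum>i<m. \<eta>0\<^sup>2)"
          by (rule sum_mono) (rule square_le_of_abs_le[OF q], simp)
        then have "real m / 2 * (\<Sum>i<m. (V i - ?z i)\<^sup>2) \<le> real m / 2 * (real m * \<eta>0\<^sup>2)"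
          by (intro mult_left_mono) auto
        then have 1: "real m / 2 * (\<Sum>i<m. (V i - ?z i)\<^sup>2) \<le> \<epsilon> / 3" by (simp only: \<eta>0(2))
        \<comment> \<open>completing the square: the quadratic event lies in finitely many half-spaces\<close>
        have "(\<Sum>i<m. g q i * V i) = real m / 2 * (\<Sum>i<m. (V i)\<^sup>2) + real m / 2 * S q - real m / 2 * (\<Sum>i<m. (V i - ?z i)\<^sup>2)"
          unfolding S_def g_def sum_distrib_left sum.distrib[symmetric] sum_subtractf[symmetric]
          by (intro sum.cong refl) (simp add: power2_eq_square field_simps)
        then have "x q \<le> (\<Sum>i<m. g q i * V i)" using \<beta> 1 unfolding x_def by linarith
        then show ?thesis using \<omega> by (simp add: H_def V_def)
      qed
      ultimately show ?thesis by blast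
    qed simp
  qed
  define C where "C = 6 * real m + real (card Grid)"
  from m(2) ev1 ev2 have "\<forall>\<^sub>F n in sequentially. prob {\<omega> \<in> space M. Y n \<omega> \<in> \<Gamma>} \<le> C * exp (- (\<beta> - \<epsilon>) / a n)"
  proof eventually_elim
    case (elim n)
    have Um: "(\<Union>q\<in>Grid. H n q) \<in> events" using fin Hm by auto
    have "prob {\<omega> \<in> space M. Y n \<omega> \<in> \<Gamma>} \<le> prob (Osc m n \<union> (\<Union>q\<in>Grid. H n q))"
      using cover Oscm Um by (intro finite_measure_mono) auto
    also have "\<dots> \<le> prob (Osc m n) + prob (\<Union>q\<in>Grid. H n q)" by (rule measure_Un_le[OF Oscm Um])
    also have "prob (\<Union>q\<in>Grid. H n q) \<le> (\<Sum>q\<in>Grid. prob (H n q))"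
      using fin Hm by (intro finite_measure_subadditive_finite) auto
    also have "\<dots> \<le> (\<Sum>q\<in>Grid. exp (- (\<beta> - \<epsilon>) / a n))" by (rule sum_mono) (rule H[OF elim(2,3)])
    also have "\<dots> = real (card Grid) * exp (- (\<beta> - \<epsilon>) / a n)" by simp
    also have "prob (Osc m n) \<le> 6 * real m * exp (- (\<beta> - \<epsilon>) / a n)"
    proof -
      have "- \<beta> / a n \<le> - (\<beta> - \<epsilon>) / a n" using a_pos[of n] \<epsilon> by (intro divide_right_mono) auto
      then have "6 * real m * exp (- \<beta> / a n) \<le> 6 * real m * exp (- (\<beta> - \<epsilon>) / a n)"
        by (intro mult_left_mono) auto
      then show ?thesis using elim(1) by linarith
    qed
    finally show ?case by (simp add: C_def distrib_right)
  qed
  moreover have "C > 0" using m(1) by (simp add: C_def)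
  ultimately show ?thesis using that by blast
qed

section \<open>Passage to the limits and conclusion\<close>

text \<open>Only a finite rate calls on \<open>lower_bound\<close>: an infinite one makes the claim
  trivial, and a negative one contradicts nonnegativity of the energy.\<close>

lemma liminf_lower:
  assumes \<Gamma>: "\<Gamma> \<in> sets D01_borel" and z: "z \<in> D01_topology interior_of \<Gamma>"
  shows "- rate_fn z \<le> liminf (\<lambda>n. ereal (a n) * log_ext (prob {\<omega> \<in> space M. Y n \<omega> \<in> \<Gamma>}))" (is "_ \<le> ?L")
proof (cases "rate_fn z")
  case (real \<alpha>)
  obtain \<delta> where \<delta>: "\<delta> > 0" "\<And>y. y \<in> cadlag01 \<Longrightarrow> (\<And>t. t \<in> {0..1} \<Longrightarrow> \<bar>y t - z t\<bar> \<le> \<delta>) \<Longrightarrow> y \<in> D01_topology interior_of \<Gamma>"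
  proof (rule openin_D01_uniform_nbhd[OF openin_interior_of z])
    fix \<delta> :: real
    assume 1: "\<delta> > 0" and 2: "\<And>y. y \<in> cadlag01 \<Longrightarrow> (\<And>t. t \<in> {0..1} \<Longrightarrow> \<bar>y t - z t\<bar> \<le> \<delta>) \<Longrightarrow> y \<in> D01_topology interior_of \<Gamma>"
    show thesis by (rule that[OF 1]) (use 2 in blast)
  qed
  have nbhd: "y \<in> \<Gamma>" if "y \<in> cadlag01" "\<And>t. t \<in> {0..1} \<Longrightarrow> \<bar>y t - z t\<bar> \<le> \<delta>" for y
    using \<delta>(2)[OF that] interior_of_subset[of D01_topology \<Gamma>] by auto
  have ge: "ereal (- (\<alpha> + e)) \<le> ?L" if e: "e > 0" for e
  proof (rule Liminf_bounded)
    have "(\<lambda>n. a n * ln (1 / 2)) \<longlonglongrightarrow> 0 * ln (1 / 2)" by (intro tendsto_intros a_lim)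
    then have "\<forall>\<^sub>F n in sequentially. - (e / 2) < a n * ln (1 / 2)" by (rule order_tendstoD(1)) (use e in simp)
    moreover have "\<forall>\<^sub>F n in sequentially. 1 / 2 * exp (- (\<alpha> + e / 2) / a n) \<le> prob {\<omega> \<in> space M. Y n \<omega> \<in> \<Gamma>}"
      by (rule lower_bound[where z = z, OF \<Gamma> _ \<delta>(1) nbhd]) (use real e in auto)
    ultimately show "\<forall>\<^sub>F n in sequentially. ereal (- (\<alpha> + e)) \<le> ereal (a n) * log_ext (prob {\<omega> \<in> space M. Y n \<omega> \<in> \<Gamma>})"
    proof eventually_elim
      case (elim n)
      have "ereal (a n * ln (1 / 2) - (\<alpha> + e / 2)) \<le> ereal (a n) * log_ext (prob {\<omega> \<in> space M. Y n \<omega> \<in> \<Gamma>})"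
        by (rule ereal_scaled_log_ext_ge[OF _ a_pos elim(2)]) simp
      moreover have "ereal (- (\<alpha> + e)) \<le> ereal (a n * ln (1 / 2) - (\<alpha> + e / 2))" using elim(1) by simp
      ultimately show ?case by (rule order_trans[rotated])
    qed
  qed
  have "ereal (- \<alpha>) \<le> ?L"
  proof (rule ereal_le_epsilon2)
    fix e :: real assume "e > 0"
    have "ereal (- \<alpha>) = ereal (- (\<alpha> + e)) + ereal e" by simp
    also have "\<dots> \<le> ?L + ereal e" by (intro add_right_mono ge \<open>e > 0\<close>)
    finally show "ereal (- \<alpha>) \<le> ?L + ereal e" .
  qed
  then show ?thesis using real by simp
next
  case MInf
  then have "rate_fn z \<le> ereal (-1)" by simp
  then show ?thesis using energy_le_nonneg[of "2 * (-1)" z] by (simp only: rate_fn_le_iff_energy) simp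
qed simp

text \<open>Stated for real \<beta> below the infimum, so that an infinite infimum, for instance
  over an empty closure, is covered too.\<close>

lemma limsup_upper:
  assumes \<Gamma>: "\<Gamma> \<in> sets D01_borel" and gap: "ereal \<beta> < (INF z\<in>D01_topology closure_of \<Gamma>. rate_fn z)"
  shows "limsup (\<lambda>n. ereal (a n) * log_ext (prob {\<omega> \<in> space M. Y n \<omega> \<in> \<Gamma>})) \<le> ereal (- \<beta>)" (is "?L \<le> _")
proof (rule ereal_le_epsilon2)
  fix e :: real assume e: "e > 0"
  have e2: "e / 2 > 0" using e by simp
  obtain C where C: "C > 0" "\<forall>\<^sub>F n in sequentially. prob {\<omega> \<in> space M. Y n \<omega> \<in> \<Gamma>} \<le> C * exp (- (\<beta> - e / 2) / a n)"
  proof (rule upper_bound[OF \<Gamma> _ e2, of \<beta>])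
    show "rate_fn z > ereal \<beta>" if "z \<in> D01_topology closure_of \<Gamma>" for z
      using gap INF_lower[OF that] by (rule less_le_trans)
  qed (assumption | rule that)+
  have "?L \<le> ereal (- \<beta> + e)"
  proof (rule Limsup_bounded)
    have "(\<lambda>n. a n * ln C) \<longlonglongrightarrow> 0 * ln C" by (intro tendsto_intros a_lim)
    then have "\<forall>\<^sub>F n in sequentially. a n * ln C < e / 2" by (rule order_tendstoD(2)) (use e in simp)
    with C(2) show "\<forall>\<^sub>F n in sequentially. ereal (a n) * log_ext (prob {\<omega> \<in> space M. Y n \<omega> \<in> \<Gamma>}) \<le> ereal (- \<beta> + e)"
    proof eventually_elim
      case (elim n)
      have "ereal (a n) * log_ext (prob {\<omega> \<in> space M. Y n \<omega> \<in> \<Gamma>}) \<le> ereal (a n * ln C - (\<beta> - e / 2))"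
        by (rule ereal_scaled_log_ext_le[OF C(1) a_pos elim(1)]) simp
      also have "\<dots> \<le> ereal (- \<beta> + e)" using elim(2) by simp
      finally show ?case .
    qed
  qed
  then show "?L \<le> ereal (- \<beta>) + ereal e" by simp
qed

theorem functional_mdp_W: "functional_mdp M (W_proc k c \<sigma> \<xi>) a rate_fn"
  unfolding functional_mdp_def
proof (intro conjI allI ballI impI)
  show "W_proc k c \<sigma> \<xi> n \<in> M \<rightarrow>\<^sub>M D01_borel" for n
    by (rule W_proc_measurable[where c = c and k = k, OF s_pos \<xi>_measurable])
  show "compactin D01_topology {x \<in> cadlag01. rate_fn x \<le> \<alpha>}" if "\<alpha> < \<infinity>" for \<alpha>
    by (rule rate_fn_good[OF that])
  fix \<Gamma> assume \<Gamma>: "\<Gamma> \<in> sets D01_borel"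
  let ?L = "\<lambda>n. ereal (a n) * log_ext (prob {\<omega> \<in> space M. Y n \<omega> \<in> \<Gamma>})"
  have "- liminf ?L \<le> (INF z\<in>D01_topology interior_of \<Gamma>. rate_fn z)"
    by (rule INF_greatest) (use liminf_lower[OF \<Gamma>] ereal_uminus_le_reorder in blast)
  then have lo: "- (INF z\<in>D01_topology interior_of \<Gamma>. rate_fn z) \<le> liminf ?L"
    using ereal_uminus_le_reorder by blast
  \<comment> \<open>If the bound failed, a real \<beta> would fit strictly between
    \<open>- limsup ?L\<close> and the infimum, against \<open>limsup_upper\<close>.\<close>
  have up: "limsup ?L \<le> - (INF z\<in>D01_topology closure_of \<Gamma>. rate_fn z)"
  proof (rule ccontr)
    assume "\<not> ?thesis"
    then have "- limsup ?L < (INF z\<in>D01_topology closure_of \<Gamma>. rate_fn z)"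
      by (simp add: not_le ereal_uminus_less_reorder)
    then obtain \<beta> where \<beta>: "- limsup ?L < ereal \<beta>" "ereal \<beta> < (INF z\<in>D01_topology closure_of \<Gamma>. rate_fn z)"
      using ereal_dense2 by blast
    have "limsup ?L \<le> ereal (- \<beta>)" by (rule limsup_upper[OF \<Gamma> \<beta>(2)])
    then have "- ereal (- \<beta>) \<le> - limsup ?L" by (simp only: ereal_minus_le_minus)
    then show False using \<beta>(1) by simp
  qed
  show "let L = \<lambda>n. ereal (a n) * log_ext (measure M {\<omega> \<in> space M. (\<lambda>t\<in>{0..1}. sqrt (a n) * W_proc k c \<sigma> \<xi> n \<omega> t) \<in> \<Gamma>})
      in - (INF z\<in>D01_topology interior_of \<Gamma>. rate_fn z) \<le> liminf L \<and> liminf L \<le> limsup L \<and>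
         limsup L \<le> - (INF z\<in>D01_topology closure_of \<Gamma>. rate_fn z)"
    unfolding Let_def Y_def[symmetric] using lo up by (simp add: Liminf_le_Limsup)
qed

end

theorem proposition11:
  fixes M :: "'w measure" and \<xi> :: "int \<Rightarrow> 'w \<Rightarrow> real"
    and \<sigma> K :: real and k :: "nat \<Rightarrow> nat"
    and c :: "nat \<Rightarrow> nat \<Rightarrow> real" and a :: "nat \<Rightarrow> real"
  assumes prob: "prob_space M"
    and indep: "prob_space.indep_vars M (\<lambda>_. borel) \<xi> UNIV"
    and ident: "\<And>j. distr M borel (\<xi> j) = distr M borel (\<xi> 0)"
    and centered: "integrable M (\<xi> 0)" "(\<integral>\<omega>. \<xi> 0 \<omega> \<partial>M) = 0"
    and variance: "integrable M (\<lambda>\<omega>. (\<xi> 0 \<omega>)\<^sup>2)" "(\<integral>\<omega>. (\<xi> 0 \<omega>)\<^sup>2 \<partial>M) = \<sigma>\<^sup>2" "\<sigma>\<^sup>2 > 0"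
    and k_pos: "\<And>n. k n > 0"
    and s_pos: "\<And>n. s_sq \<sigma> c n (k n) > 0"
    and a_pos: "\<And>n. a n > 0"
    and a_lim: "a \<longlonglongrightarrow> 0"
    and negl: "(\<lambda>n. 1 / (sqrt (a n) * sqrt (s_sq \<sigma> c n (k n))) * (MAX j\<in>{1..k n}. \<bar>c n j\<bar>))
      \<longlonglongrightarrow> 0"
    and K_pos: "K > 0"
    and moments: "\<And>m::nat. (\<integral>\<^sup>+\<omega>. ennreal (\<bar>\<xi> 0 \<omega>\<bar> ^ m) \<partial>M) \<le> ennreal (fact m * K ^ m)"
  shows "functional_mdp M (W_proc k c \<sigma> \<xi>) a rate_fn"
proof -
  interpret prob_space M by (rule prob)
  interpret mdp_array M \<xi> \<sigma> K k c a
    by unfold_locales (fact assms)+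
  show ?thesis by (rule functional_mdp_W)
qed

end
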